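(* Let $n \geq 3$ and let $Q_n$ be the $n$-dimensional hypercube in which a set $F$ of $f = |F|$ vertices is faulty. Let $k$ be an integer with $1 \leq k \leq n-2$. Suppose that $f \leq 2n - 2k - 3$ and that every fault-free vertex of $Q_n$ has at least two fault-free neighbors. Then for any two sets $S$ and $T$, each consisting of $k$ fault-free vertices, with $S$ contained in one part and $T$ contained in the other part of the bipartition of $Q_n$, there exist $k$ pairwise vertex-disjoint fault-free paths linking $S$ and $T$ (each path joins a vertex of $S$ to a vertex of $T$, and every vertex of $S \cup T$ is an end-vertex of exactly one of the paths) whose union contains at least $2^n - 2f$ vertices.
   Context: The $n$-dimensional hypercube $Q_n$ has vertex set all binary strings of length $n$, two vertices being adjacent iff they differ in exactly one coordinate; it is bipartite, with parts given by the parity of the number of 1's. A path is fault-free if it contains no vertex of $F$. Paths are disjoint if they share no vertices. *)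

theory Defs
  imports "Graph_Theory.Graph_Theory"
begin

text \<open>A graph is represented, as in \<^theory>\<open>Graph_Theory.Digraph\<close>, by its symmetric digraph.\<close>

definition hypercube :: "nat \<Rightarrow> (bool list, bool list \<times> bool list) pre_digraph" where
  "hypercube n = with_proj
     \<lparr> pverts = {v. length v = n},
       parcs = {(u, v). length u = n \<and> length v = n \<and> card {i. i < n \<and> u ! i \<noteq> v ! i} = 1} \<rparr>"

definition even_part :: "nat \<Rightarrow> bool list set" where
  "even_part n = {v \<in> verts (hypercube n). even (count_list v True)}"

definition odd_part :: "nat \<Rightarrow> bool list set" where
  "odd_part n = {v \<in> verts (hypercube n). odd (count_list v True)}"

definition fault_free_neighbors ::
  "('a, 'b) pre_digraph \<Rightarrow> 'a set \<Rightarrow> 'a \<Rightarrow> 'a set" where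
  "fault_free_neighbors G F u = {v \<in> verts G - F. u \<rightarrow>\<^bsub>G\<^esub> v}"

definition fault_free_path :: "('a, 'b) pre_digraph \<Rightarrow> 'a set \<Rightarrow> 'a list \<Rightarrow> bool" where
  "fault_free_path G F p \<longleftrightarrow> vpath p G \<and> set p \<inter> F = {}"

text \<open>
  A set of pairwise disjoint fault-free paths linking \<open>S\<close> and \<open>T\<close>. A path is given by its
  vertex list, read from its end-vertex in \<open>S\<close> to its end-vertex in \<open>T\<close>.
\<close>

definition linking_paths ::
  "('a, 'b) pre_digraph \<Rightarrow> 'a set \<Rightarrow> 'a set \<Rightarrow> 'a set \<Rightarrow> 'a list set \<Rightarrow> bool" where
  "linking_paths G F S T P \<longleftrightarrow>
     (\<forall>p\<in>P. fault_free_path G F p \<and> hd p \<in> S \<and> last p \<in> T) \<and>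
     (\<forall>p\<in>P. \<forall>q\<in>P. p \<noteq> q \<longrightarrow> set p \<inter> set q = {}) \<and>
     (\<forall>v\<in>S \<union> T. \<exists>!p. p \<in> P \<and> (v = hd p \<or> v = last p))"

lemma finite_verts_hypercube: "finite (verts (hypercube n))"
  using finite_lists_length_eq[of "UNIV :: bool set" n] by (simp add: hypercube_def)

lemma card_verts_hypercube: "card (verts (hypercube n)) = 2 ^ n"
  using card_lists_length_eq[of "UNIV :: bool set" n] by (simp add: hypercube_def)

lemma hypercube_dominates_iff:
  "u \<rightarrow>\<^bsub>hypercube n\<^esub> v \<longleftrightarrow>
     length u = n \<and> length v = n \<and> card {i. i < n \<and> u ! i \<noteq> v ! i} = 1"
  by (auto simp: hypercube_def arcs_ends_conv)

lemma graph_hypercube: "graph (hypercube n)"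
proof -
  define V where "V = {v :: bool list. length v = n}"
  define E where "E = {(u :: bool list, v :: bool list).
    length u = n \<and> length v = n \<and> card {i. i < n \<and> u ! i \<noteq> v ! i} = 1}"
  have V: "finite V"
    unfolding V_def using finite_lists_length_eq[of "UNIV :: bool set" n] by simp
  have E: "E \<subseteq> V \<times> V"
    unfolding V_def E_def by blast
  have irrefl: "(u, u) \<notin> E" for u
    unfolding E_def by simp
  have "(v, u) \<in> E" if "(u, v) \<in> E" for u v
  proof -
    have "{i. i < n \<and> v ! i \<noteq> u ! i} = {i. i < n \<and> u ! i \<noteq> v ! i}"
      by blast
    then have "card {i. i < n \<and> v ! i \<noteq> u ! i} = card {i. i < n \<and> u ! i \<noteq> v ! i}"
      by (rule arg_cong)
    with that show ?thesis
      unfolding E_def mem_Collect_eq prod.case by (elim conjE, intro conjI) (assumption, assumption, rule trans)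
  qed
  then have sym: "sym E"
    by (rule symI)
  have "pair_graph \<lparr> pverts = V, parcs = E \<rparr>"
  proof (unfold_locales, goal_cases)
    case (5 e)
    then show ?case using irrefl by (cases e) auto
  next
    case 6
    have "arcs_ends (with_proj \<lparr> pverts = V, parcs = E \<rparr>) = E"
      by (simp add: arcs_ends_conv)
    then show ?case
      using sym by (simp add: symmetric_def)
  qed (use E V in \<open>auto intro: finite_subset\<close>)
  then show ?thesis
    unfolding hypercube_def V_def E_def by (rule pair_graph.pair_graphD_graph)
qed

end

theory Submission
  imports Defs
begin

text \<open>
  The proof is an induction on the dimension. A coordinate splits the cube into two halves. In one
  half one solves the linkage problem with extra terminals, all of one parity, whose neighbours in
  the other half serve as extra terminals there; a half without terminals is inserted as a detour
  replacing an edge. With few faults (\<open>k + f < n\<close>) this needs no condition on neighbours.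

  In general it is better to allow fault-free vertices with at most one fault-free neighbour, as
  long as they are not terminals. A split works unless all faults but at most one lie in one half.
  If no usable coordinate splits the faults better, then the faults are, relative to a centre,
  pairwise disjoint sets of coordinates and \<open>f\<close> has its maximal value. For \<open>k \<ge> 2\<close> one then relieves
  the crowded half by turning one of its terminals into an ordinary vertex, and for \<open>k = 1\<close> only
  dimensions at most six remain, with explicitly known fault sets.
\<close>

text \<open>The constants fit the splitting exactly. The lengths \<open>2 ^ (n - 1) - 2 * f0\<close>
  and \<open>2 ^ (n - 1) - 2 * f1\<close> obtained in the halves add up to
  \<open>2 ^ n - 2 * f\<close>. The tolerance \<open>2n - 2k - 3\<close> drops by two when
  \<open>n\<close> drops by one, so a half that keeps at most \<open>f - 2\<close> faults is covered
  by induction with the same \<open>k\<close>; and carrying only \<open>k - 1\<close> paths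
  compensates for two more faults. The other half, holding at most \<open>f / 2\<close> faults,
  holds at most \<open>n - k - 2\<close>, which is few in its dimension. Hence a minimal
  counterexample has at most one fault on the smaller side of every coordinate that can be used. A
  majority vote in each coordinate therefore produces the centre: each coordinate separates at most
  one fault from it, and this is why the faults become disjoint sets. Since every fault other than
  the centre uses up a coordinate, about \<open>2n\<close> faults against \<open>n\<close>
  coordinates leave only small dimensions when \<open>k = 1\<close>.\<close>

definition flip :: "'a \<Rightarrow> 'a set \<Rightarrow> 'a set" where
  "flip i A = (if i \<in> A then A - {i} else insert i A)"

definition adj :: "'a set \<Rightarrow> 'a set \<Rightarrow> bool" where
  "adj A B \<longleftrightarrow> (\<exists>i. B = flip i A)"

text \<open>
  Vertices are finite sets and edges toggle one element, so that all subcubes live in one type: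
  \<open>cube I z\<close> is the subcube through \<open>z\<close> in the directions \<open>I\<close>.
\<close>

definition cube :: "'a set \<Rightarrow> 'a set \<Rightarrow> 'a set set" where
  "cube I z = {A. finite A \<and> (\<forall>j. j \<notin> I \<longrightarrow> (j \<in> A \<longleftrightarrow> j \<in> z))}"

abbreviation ev :: "'a set \<Rightarrow> bool" where
  "ev A \<equiv> even (card A)"

section \<open>Toggling one element of a set\<close>

lemma mem_flip: "j \<in> flip i A \<longleftrightarrow> (j \<in> A) \<noteq> (j = i)"
  by (auto simp: flip_def)

lemma flip_flip [simp]: "flip i (flip i A) = A"
  by (auto simp: set_eq_iff mem_flip)

lemma flip_commute: "flip i (flip j A) = flip j (flip i A)"
  by (auto simp: set_eq_iff mem_flip)

lemma flip_neq [simp]: "flip i A \<noteq> A" "A \<noteq> flip i A"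
  by (auto simp: set_eq_iff mem_flip)

lemma flip_eq_iff [simp]: "flip i A = flip i B \<longleftrightarrow> A = B"
  by (metis flip_flip)

lemma flip_eq_flip_iff [simp]: "flip i A = flip j A \<longleftrightarrow> i = j"
  unfolding set_eq_iff mem_flip by metis

lemma inj_flip: "inj_on (flip i) X"
  by (simp add: inj_on_def)

lemma finite_flip [simp]: "finite (flip i A) \<longleftrightarrow> finite A"
  by (simp add: flip_def)

lemma ev_flip: "finite A \<Longrightarrow> ev (flip i A) \<longleftrightarrow> \<not> ev A"
  using card_Suc_Diff1[of A i] by (cases "i \<in> A") (auto simp: flip_def simp del: card_Suc_Diff1)

lemma adj_flip [simp]: "adj A (flip i A)" "adj (flip i A) A"
  unfolding adj_def by (metis flip_flip)+

lemma adj_sym: "adj A B \<Longrightarrow> adj B A"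
  by (metis adj_def flip_flip)

lemma ev_adj: "adj A B \<Longrightarrow> finite A \<Longrightarrow> ev B \<longleftrightarrow> \<not> ev A"
  by (auto simp: adj_def ev_flip)

subsection \<open>Subcubes\<close>

lemma cube_finite_mem: "A \<in> cube I z \<Longrightarrow> finite A"
  by (simp add: cube_def)

lemma flip_mem_cube_iff: "A \<in> cube I z \<Longrightarrow> flip i A \<in> cube I z \<longleftrightarrow> i \<in> I"
  by (auto simp: cube_def mem_flip)

lemma cube_self: "finite z \<Longrightarrow> z \<in> cube I z"
  by (simp add: cube_def)

lemma cube_cong: "c \<in> cube I z \<Longrightarrow> cube I c = cube I z"
  by (auto simp: cube_def)

lemma adj_cube_imp_flip:
  assumes "A \<in> cube I z" "B \<in> cube I z" "adj A B"
  shows "\<exists>i\<in>I. B = flip i A"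
  using assms flip_mem_cube_iff unfolding adj_def by metis

lemma cube_empty: "finite z \<Longrightarrow> cube {} z = {z}"
  by (auto simp: cube_def)

lemma cube_remove:
  assumes "i \<in> I"
  shows "cube (I - {i}) z = {A \<in> cube I z. i \<in> A \<longleftrightarrow> i \<in> z}"
  using assms by (auto simp: cube_def)

lemma flip_cube_remove:
  assumes "i \<in> I"
  shows "cube (I - {i}) (flip i z) = {A \<in> cube I z. \<not> (i \<in> A \<longleftrightarrow> i \<in> z)}"
  using assms by (auto simp: cube_def mem_flip)

lemma cube_split:
  assumes "i \<in> I"
  shows "cube I z = cube (I - {i}) z \<union> cube (I - {i}) (flip i z)"
    and "cube (I - {i}) z \<inter> cube (I - {i}) (flip i z) = {}"
  unfolding flip_cube_remove[OF assms] cube_remove[OF assms, of z] by auto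

lemma flip_image_cube: "i \<notin> J \<Longrightarrow> flip i ` cube J z = cube J (flip i z)"
proof -
  have *: "i \<notin> J \<Longrightarrow> flip i ` cube J z \<subseteq> cube J (flip i z)" for z
    by (auto simp: cube_def mem_flip)
  moreover have "cube J (flip i z) \<subseteq> flip i ` cube J z" if "i \<notin> J"
    using *[OF that, of "flip i z"] by (force simp: image_iff)
  ultimately show "i \<notin> J \<Longrightarrow> flip i ` cube J z = cube J (flip i z)" by blast
qed

lemma flip_mem_cube: "i \<notin> J \<Longrightarrow> flip i A \<in> cube J (flip i z) \<longleftrightarrow> A \<in> cube J z"
  by (auto simp: cube_def mem_flip)

lemma flip_mem_cube': "i \<notin> J \<Longrightarrow> flip i A \<in> cube J z \<longleftrightarrow> A \<in> cube J (flip i z)"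
  by (auto simp: cube_def mem_flip)

lemma finite_cube: "finite I \<Longrightarrow> finite z \<Longrightarrow> finite (cube I z)"
proof (induction I arbitrary: z rule: finite_induct)
  case empty
  then show ?case by (simp add: cube_empty)
next
  case (insert i I)
  then show ?case
    using cube_split(1)[of i "insert i I" z] by simp
qed

lemma card_cube: "finite I \<Longrightarrow> finite z \<Longrightarrow> card (cube I z) = 2 ^ card I"
proof (induction I arbitrary: z rule: finite_induct)
  case empty
  then show ?case by (simp add: cube_empty)
next
  case (insert i I)
  then show ?case
    using cube_split[of i "insert i I" z] by (simp add: card_Un_disjoint finite_cube)
qed

text \<open>Toggling a fixed element of \<open>I\<close> is a bijection between the two parity
  classes.\<close>

lemma card_cube_parity:
  assumes "finite I" "finite z" "I \<noteq> {}"
  shows "card {A \<in> cube I z. ev A = p} = 2 ^ (card I - 1)"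
proof -
  obtain i where i: "i \<in> I" using assms by blast
  have fl: "flip i A \<in> cube I z" if "A \<in> cube I z" for A
    using that i by (simp add: flip_mem_cube_iff)
  have "bij_betw (flip i) {A \<in> cube I z. ev A = p} {A \<in> cube I z. ev A \<noteq> p}"
  proof (rule bij_betw_byWitness[where f' = "flip i"])
    show "flip i ` {A \<in> cube I z. ev A = p} \<subseteq> {A \<in> cube I z. ev A \<noteq> p}"
      using fl by (auto simp: ev_flip cube_finite_mem)
    show "flip i ` {A \<in> cube I z. ev A \<noteq> p} \<subseteq> {A \<in> cube I z. ev A = p}"
      using fl by (auto simp: ev_flip cube_finite_mem)
  qed auto
  then have "card {A \<in> cube I z. ev A = p} = card {A \<in> cube I z. ev A \<noteq> p}"
    by (rule bij_betw_same_card)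
  moreover have "card (cube I z) = card {A \<in> cube I z. ev A = p} + card {A \<in> cube I z. ev A \<noteq> p}"
    using finite_cube[OF assms(1,2)]
    by (subst card_Un_disjoint[symmetric]) (auto intro: arg_cong[where f=card])
  moreover have "2 ^ card I = 2 * (2::nat) ^ (card I - 1)"
    using assms by (metis card_gt_0_iff power_eq_if not_gr_zero)
  ultimately show ?thesis using card_cube[OF assms(1,2)] by simp
qed

subsection \<open>Paths and linkages\<close>

text \<open>The last argument of the next two predicates is the set of all vertices used.\<close>

inductive path_on :: "'a set \<Rightarrow> 'a set \<Rightarrow> 'a set set \<Rightarrow> bool" where
  single: "path_on a a {a}"
| step: "path_on a b C \<Longrightarrow> adj c a \<Longrightarrow> c \<notin> C \<Longrightarrow> path_on c b (insert c C)"

inductive linkage :: "'a set set \<Rightarrow> 'a set set \<Rightarrow> 'a set set \<Rightarrow> bool" where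
  empty: "linkage {} {} {}"
| add: "path_on s t A \<Longrightarrow> linkage S T C \<Longrightarrow> A \<inter> C = {} \<Longrightarrow> linkage (insert s S) (insert t T) (A \<union> C)"

lemma path_on_ends: "path_on a b C \<Longrightarrow> a \<in> C \<and> b \<in> C \<and> finite C"
  by (induction rule: path_on.induct) auto

lemma path_on_join:
  "path_on a b C \<Longrightarrow> path_on c d D \<Longrightarrow> adj b c \<Longrightarrow> C \<inter> D = {} \<Longrightarrow> path_on a d (C \<union> D)"
  by (induction rule: path_on.induct) (auto intro: path_on.step)

lemma path_on_rev: "path_on a b C \<Longrightarrow> path_on b a C"
proof (induction rule: path_on.induct)
  case (single a)
  then show ?case by (rule path_on.single)
next
  case (step a b C c)
  then show ?case
    using path_on_join[of b a C c c "{c}"] by (auto intro: path_on.single adj_sym)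
qed

text \<open>The witness \<open>pr\<close> maps a vertex to its predecessor on the path. Its
  injectivity is kept because edges are later counted by their heads.\<close>

lemma path_on_pred:
  "path_on a b C \<Longrightarrow> \<exists>pr. inj_on pr (C - {a}) \<and>
     (\<forall>u\<in>C - {a}. \<exists>A B. path_on a (pr u) A \<and> path_on u b B \<and> adj (pr u) u \<and> A \<inter> B = {} \<and> A \<union> B = C)"
proof (induction rule: path_on.induct)
  case (single a)
  then show ?case by simp
next
  case (step a b C c)
  then obtain pr where inj: "inj_on pr (C - {a})"
    and pr: "\<And>u. u \<in> C - {a} \<Longrightarrow>
      \<exists>A B. path_on a (pr u) A \<and> path_on u b B \<and> adj (pr u) u \<and> A \<inter> B = {} \<and> A \<union> B = C"
    by blast
  define pr' where "pr' = pr(a := c)"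
  have prC: "pr u \<in> C" if "u \<in> C - {a}" for u
    using pr[OF that] path_on_ends by blast
  have "inj_on pr' (insert c C - {c})"
    using inj prC step.hyps unfolding pr'_def inj_on_def by (auto; metis DiffI singletonD)
  moreover have "\<exists>A B. path_on c (pr' u) A \<and> path_on u b B \<and> adj (pr' u) u \<and> A \<inter> B = {} \<and> A \<union> B = insert c C"
    if u: "u \<in> insert c C - {c}" for u
  proof (cases "u = a")
    case True
    then show ?thesis
      using step.hyps by (intro exI[of _ "{c}"] exI[of _ C]) (auto simp: pr'_def intro: path_on.single)
  next
    case False
    then obtain A B where "path_on a (pr u) A" "path_on u b B" "adj (pr u) u" "A \<inter> B = {}" "A \<union> B = C"
      using pr[of u] u by auto
    then show ?thesis
      using step.hyps False
      by (intro exI[of _ "insert c A"] exI[of _ B]) (auto simp: pr'_def intro: path_on.step)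
  qed
  ultimately show ?case by blast
qed

lemma path_on_split:
  assumes "path_on a b C" "u \<in> C" "u \<noteq> a"
  shows "\<exists>q A B. path_on a q A \<and> path_on u b B \<and> adj q u \<and> A \<inter> B = {} \<and> A \<union> B = C"
  using path_on_pred[OF assms(1)] assms(2,3) by (metis DiffI singletonD)

lemma path_on_split':
  assumes "path_on a b C" "u \<in> C" "u \<noteq> b"
  shows "\<exists>q A B. path_on a u A \<and> path_on q b B \<and> adj u q \<and> A \<inter> B = {} \<and> A \<union> B = C"
proof -
  obtain q A B where "path_on b q A" "path_on u a B" "adj q u" "A \<inter> B = {}" "A \<union> B = C"
    using path_on_split[OF path_on_rev[OF assms(1)] assms(2,3)] by blast
  then show ?thesis
    by (intro exI[of _ q] exI[of _ B] exI[of _ A]) (auto intro: path_on_rev adj_sym)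
qed

section \<open>Extracting and cutting the paths of a linkage\<close>

lemma linkage_subset: "linkage S T C \<Longrightarrow> S \<subseteq> C \<and> T \<subseteq> C \<and> finite C \<and> card S = card T"
proof (induction rule: linkage.induct)
  case empty
  then show ?case by simp
next
  case (add s t A S T C)
  have "s \<notin> S" "t \<notin> T" "finite S" "finite T"
    using add path_on_ends[of s t A] by (auto intro: finite_subset)
  then show ?case using add path_on_ends[of s t A] by auto
qed

lemma linkage_single: "path_on s t C \<Longrightarrow> linkage {s} {t} C"
  using linkage.add[OF _ linkage.empty] by fastforce

lemma linkage_Un: "linkage S T C \<Longrightarrow> linkage S' T' C' \<Longrightarrow> C \<inter> C' = {} \<Longrightarrow> linkage (S \<union> S') (T \<union> T') (C \<union> C')"
proof (induction rule: linkage.induct)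
  case empty
  then show ?case by simp
next
  case (add s t A S T C)
  then have "linkage (insert s (S \<union> S')) (insert t (T \<union> T')) (A \<union> (C \<union> C'))"
    by (intro linkage.add) auto
  then show ?case by (simp add: Un_assoc)
qed

lemma linkage_rev: "linkage S T C \<Longrightarrow> linkage T S C"
  by (induction rule: linkage.induct) (auto intro: linkage.intros path_on_rev)

lemma linkage_extract:
  "linkage S T C \<Longrightarrow> v \<in> C \<Longrightarrow> \<exists>s t A B. path_on s t A \<and> v \<in> A \<and> linkage (S - {s}) (T - {t}) B \<and>
     A \<inter> B = {} \<and> A \<union> B = C \<and> s \<in> S \<and> t \<in> T"
proof (induction rule: linkage.induct)
  case empty
  then show ?case by simp
next
  case (add s t A S T C)
  have A: "s \<in> A" "t \<in> A" "finite A" using path_on_ends[OF add.hyps(1)] by auto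
  have C: "S \<subseteq> C" "T \<subseteq> C" using linkage_subset[OF add.hyps(2)] by auto
  have st: "s \<notin> S" "t \<notin> T" using A C add.hyps(3) by auto
  show ?case
  proof (cases "v \<in> A")
    case True
    moreover have "insert s S - {s} = S" "insert t T - {t} = T"
      using st by auto
    ultimately show ?thesis using add.hyps(1-3) by (metis insertI1)
  next
    case False
    then obtain s' t' A' B where *: "path_on s' t' A'" "v \<in> A'" "linkage (S - {s'}) (T - {t'}) B"
      "A' \<inter> B = {}" "A' \<union> B = C" "s' \<in> S" "t' \<in> T"
      using add by auto
    then have "linkage (insert s (S - {s'})) (insert t (T - {t'})) (A \<union> B)"
      using add.hyps by (intro linkage.add) auto
    moreover have "insert s (S - {s'}) = insert s S - {s'}" "insert t (T - {t'}) = insert t T - {t'}"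
      using * st by auto
    ultimately have "linkage (insert s S - {s'}) (insert t T - {t'}) (A \<union> B)" by simp
    moreover have "A' \<inter> (A \<union> B) = {}" "A' \<union> (A \<union> B) = A \<union> C"
      using * add.hyps(3) by blast+
    ultimately show ?thesis using *(1,2,6,7) by blast
  qed
qed

lemma linkage_extract_source:
  assumes "linkage S T C" "s \<in> S"
  shows "\<exists>t A B. path_on s t A \<and> linkage (S - {s}) (T - {t}) B \<and> A \<inter> B = {} \<and> A \<union> B = C \<and> t \<in> T"
proof -
  have "s \<in> C" using assms linkage_subset by blast
  then obtain s' t A B where *: "path_on s' t A" "s \<in> A" "linkage (S - {s'}) (T - {t}) B"
    "A \<inter> B = {}" "A \<union> B = C" "t \<in> T"
    using linkage_extract[OF assms(1)] by blast
  then have "s' = s" using linkage_subset[OF *(3)] assms(2) by blast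
  then show ?thesis using * by blast
qed

lemma linkage_extract_sink:
  assumes "linkage S T C" "t \<in> T"
  shows "\<exists>s A B. path_on s t A \<and> linkage (S - {s}) (T - {t}) B \<and> A \<inter> B = {} \<and> A \<union> B = C \<and> s \<in> S"
  using linkage_extract_source[OF linkage_rev[OF assms(1)] assms(2)] by (metis path_on_rev linkage_rev)

lemma linkage_pair:
  assumes "linkage {s} {t} C"
  shows "path_on s t C"
proof -
  obtain A B where "path_on s t A" "linkage {} {} B" "A \<union> B = C"
    using linkage_extract_source[OF assms, of s] by auto
  moreover have "B = {}" using \<open>linkage {} {} B\<close> by (auto elim: linkage.cases)
  ultimately show ?thesis by simp
qed

text \<open>The predecessor maps of the single paths glue together, as the paths are disjoint. Thus
  the linkage has exactly one edge per vertex outside \<open>S\<close>, and the remaining clauses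
  describe what is left when that edge is deleted.\<close>

lemma linkage_pred:
  assumes "linkage S T C"
  shows "\<exists>pr. inj_on pr (C - S) \<and>
     (\<forall>u\<in>C - S. \<exists>s t A A' B. path_on s (pr u) A \<and> path_on u t A' \<and> adj (pr u) u \<and> linkage (S - {s}) (T - {t}) B \<and>
        A \<inter> A' = {} \<and> A \<inter> B = {} \<and> A' \<inter> B = {} \<and> A \<union> A' \<union> B = C \<and> s \<in> S \<and> t \<in> T)"
  using assms
proof (induction rule: linkage.induct)
  case empty
  then show ?case by simp
next
  case (add s t A S T C)
  then obtain pr where inj: "inj_on pr (C - S)"
    and pr: "\<And>u. u \<in> C - S \<Longrightarrow> \<exists>s t A A' B. path_on s (pr u) A \<and> path_on u t A' \<and> adj (pr u) u \<and>
        linkage (S - {s}) (T - {t}) B \<and>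
        A \<inter> A' = {} \<and> A \<inter> B = {} \<and> A' \<inter> B = {} \<and> A \<union> A' \<union> B = C \<and> s \<in> S \<and> t \<in> T"
    by blast
  obtain pr1 where inj1: "inj_on pr1 (A - {s})"
    and pr1: "\<And>u. u \<in> A - {s} \<Longrightarrow>
      \<exists>A1 B. path_on s (pr1 u) A1 \<and> path_on u t B \<and> adj (pr1 u) u \<and> A1 \<inter> B = {} \<and> A1 \<union> B = A"
    using path_on_pred[OF add.hyps(1)] by blast
  have A: "s \<in> A" "t \<in> A" using path_on_ends[OF add.hyps(1)] by auto
  have C: "S \<subseteq> C" "T \<subseteq> C" using linkage_subset[OF add.hyps(2)] by auto
  have st: "s \<notin> S" "t \<notin> T" using A C add.hyps(3) by auto
  define pr' where "pr' u = (if u \<in> A then pr1 u else pr u)" for u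
  have pr1A: "pr1 u \<in> A" if "u \<in> A - {s}" for u using pr1[OF that] path_on_ends by blast
  have prC: "pr u \<in> C" if "u \<in> C - S" for u using pr[OF that] path_on_ends by blast
  have "inj_on pr' ((A \<union> C) - insert s S)"
  proof (rule inj_onI)
    fix u v assume uv: "u \<in> A \<union> C - insert s S" "v \<in> A \<union> C - insert s S" "pr' u = pr' v"
    show "u = v"
    proof (cases "u \<in> A"; cases "v \<in> A")
      assume "u \<in> A" "v \<in> A" then show ?thesis using uv inj1 by (auto simp: pr'_def inj_on_def)
    next
      assume "u \<notin> A" "v \<notin> A" then show ?thesis using uv inj by (auto simp: pr'_def inj_on_def)
    next
      assume "u \<in> A" "v \<notin> A" then show ?thesis
        using uv pr1A[of u] prC[of v] add.hyps(3) by (auto simp: pr'_def)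
    next
      assume "u \<notin> A" "v \<in> A" then show ?thesis
        using uv pr1A[of v] prC[of u] add.hyps(3) by (auto simp: pr'_def)
    qed
  qed
  moreover have "\<exists>s' t' A1 A2 B. path_on s' (pr' u) A1 \<and> path_on u t' A2 \<and> adj (pr' u) u \<and>
      linkage (insert s S - {s'}) (insert t T - {t'}) B \<and>
      A1 \<inter> A2 = {} \<and> A1 \<inter> B = {} \<and> A2 \<inter> B = {} \<and> A1 \<union> A2 \<union> B = A \<union> C \<and>
      s' \<in> insert s S \<and> t' \<in> insert t T"
    if u: "u \<in> (A \<union> C) - insert s S" for u
  proof (cases "u \<in> A")
    case True
    then obtain A1 A2 where "path_on s (pr1 u) A1" "path_on u t A2" "adj (pr1 u) u" "A1 \<inter> A2 = {}" "A1 \<union> A2 = A"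
      using pr1[of u] u by auto
    moreover have "A1 \<inter> C = {}" "A2 \<inter> C = {}" "A1 \<union> A2 \<union> C = A \<union> C"
      using calculation add.hyps(3) by blast+
    moreover have "pr' u = pr1 u" "insert s S - {s} = S" "insert t T - {t} = T"
      using st True by (auto simp: pr'_def)
    ultimately show ?thesis using add.hyps(2) by (metis insertI1)
  next
    case False
    then obtain s' t' A1 A2 B where *: "path_on s' (pr u) A1" "path_on u t' A2" "adj (pr u) u"
      "linkage (S - {s'}) (T - {t'}) B"
      "A1 \<inter> A2 = {}" "A1 \<inter> B = {}" "A2 \<inter> B = {}" "A1 \<union> A2 \<union> B = C" "s' \<in> S" "t' \<in> T"
    proof -
      have "u \<in> C - S" using u False by blast
      from pr[OF this] show ?thesis using that by blast
    qed
    have "linkage (insert s (S - {s'})) (insert t (T - {t'})) (A \<union> B)"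
      using * add.hyps by (intro linkage.add) auto
    moreover have "insert s (S - {s'}) = insert s S - {s'}" "insert t (T - {t'}) = insert t T - {t'}"
      using * st by auto
    ultimately have "linkage (insert s S - {s'}) (insert t T - {t'}) (A \<union> B)" by simp
    moreover have "A1 \<inter> (A \<union> B) = {}" "A2 \<inter> (A \<union> B) = {}" "A1 \<union> A2 \<union> (A \<union> B) = A \<union> C"
      using *(5-8) add.hyps(3) by blast+
    moreover have "pr' u = pr u" using False by (simp add: pr'_def)
    ultimately show ?thesis using *(1-3,5,9,10) by (metis insertI2)
  qed
  ultimately show ?case by blast
qed

text \<open>Deleting the edge that enters \<open>u\<close> makes \<open>u\<close> a source and its
  predecessor \<open>q\<close> a sink. Since \<open>q\<close> is not the last vertex of its path, it
  is a new sink.\<close>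

lemma linkage_cut:
  assumes "linkage S T C" "u \<in> C" "u \<notin> S"
  shows "\<exists>q. adj q u \<and> q \<in> C \<and> q \<notin> T \<and> linkage (insert u S) (insert q T) C"
proof -
  obtain q s t A A' B where *: "path_on s q A" "path_on u t A'" "adj q u" "linkage (S - {s}) (T - {t}) B"
    "A \<inter> A' = {}" "A \<inter> B = {}" "A' \<inter> B = {}" "A \<union> A' \<union> B = C" "s \<in> S" "t \<in> T"
    using linkage_pred[OF assms(1)] assms(2,3) by (metis DiffI)
  have "linkage (insert u (S - {s})) (insert t (T - {t})) (A' \<union> B)"
    using * by (intro linkage.add) auto
  then have "linkage (insert s (insert u (S - {s}))) (insert q (insert t (T - {t}))) (A \<union> (A' \<union> B))"
    using * by (intro linkage.add) auto
  moreover have "insert s (insert u (S - {s})) = insert u S" "insert t (T - {t}) = T"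
    using * by auto
  moreover have "q \<notin> T"
    using * path_on_ends[OF *(1)] path_on_ends[OF *(2)] linkage_subset[OF *(4)] by blast
  ultimately show ?thesis using * path_on_ends[OF *(1)] by (metis Un_assoc UnI1)
qed

text \<open>This keeps a vertex with a single usable neighbour off every linkage of which it is not
  a terminal.\<close>

lemma linkage_two_neighbours:
  assumes "linkage S T C" "v \<in> C" "v \<notin> S" "v \<notin> T"
  shows "\<exists>p q. p \<in> C \<and> q \<in> C \<and> p \<noteq> q \<and> adj v p \<and> adj v q"
proof -
  obtain s t A B where *: "path_on s t A" "v \<in> A" "A \<union> B = C" "s \<in> S" "t \<in> T"
    using linkage_extract[OF assms(1,2)] by blast
  obtain p A1 A2 where p: "path_on s p A1" "path_on v t A2" "adj p v" "A1 \<inter> A2 = {}" "A1 \<union> A2 = A"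
    using path_on_split[OF *(1,2)] * assms by blast
  obtain q B1 B2 where q: "path_on v v B1" "path_on q t B2" "adj v q" "B1 \<inter> B2 = {}" "B1 \<union> B2 = A2"
    using path_on_split'[OF p(2), of v] path_on_ends[OF p(2)] * assms by blast
  have "p \<noteq> q" using p q path_on_ends[OF p(1)] path_on_ends[OF q(2)] by blast
  then show ?thesis
    using p q path_on_ends[OF p(1)] path_on_ends[OF q(2)] * by (intro exI[of _ p] exI[of _ q]) (auto intro: adj_sym)
qed

text \<open>Sinks are joined to sources only, hence no cycle can close up.\<close>

lemma linkage_compose:
  assumes "finite W"
  shows "\<lbrakk>linkage S0 (T0 \<union> W) C0; linkage (g ` W \<union> S1) T1 C1; C0 \<inter> C1 = {}; T0 \<inter> W = {}; inj_on g W;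
     g ` W \<inter> S1 = {}; \<And>w. w \<in> W \<Longrightarrow> adj w (g w)\<rbrakk> \<Longrightarrow> linkage (S0 \<union> S1) (T0 \<union> T1) (C0 \<union> C1)"
  using assms
proof (induction W arbitrary: S0 C0 T1 C1 rule: finite_induct)
  case empty
  then show ?case by (auto intro: linkage_Un)
next
  case (insert w W)
  obtain s A0 B0 where 0: "path_on s w A0" "linkage (S0 - {s}) (T0 \<union> insert w W - {w}) B0"
    "A0 \<inter> B0 = {}" "A0 \<union> B0 = C0" "s \<in> S0"
    using linkage_extract_sink[OF insert.prems(1), of w] by blast
  obtain t A1 B1 where 1: "path_on (g w) t A1" "linkage (g ` insert w W \<union> S1 - {g w}) (T1 - {t}) B1"
    "A1 \<inter> B1 = {}" "A1 \<union> B1 = C1" "t \<in> T1"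
    using linkage_extract_source[OF insert.prems(2), of "g w"] by blast
  have e0: "T0 \<union> insert w W - {w} = T0 \<union> W"
    using insert.prems(4) insert.hyps by auto
  have e1: "g ` insert w W \<union> S1 - {g w} = g ` W \<union> S1"
    using insert.prems(5,6) insert.hyps by (auto simp: inj_on_def)
  have l: "linkage (S0 - {s} \<union> S1) (T0 \<union> (T1 - {t})) (B0 \<union> B1)"
  proof (rule insert.IH)
    show "linkage (S0 - {s}) (T0 \<union> W) B0" using 0 e0 by simp
    show "linkage (g ` W \<union> S1) (T1 - {t}) B1" using 1 e1 by simp
    show "B0 \<inter> B1 = {}" using insert.prems(3) 0 1 by blast
  qed (use insert.prems in auto)
  have "path_on s t (A0 \<union> A1)"
    using 0 1 insert.prems(3,7) by (intro path_on_join) auto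
  from linkage.add[OF this l] have "linkage (insert s (S0 - {s} \<union> S1)) (insert t (T0 \<union> (T1 - {t}))) (A0 \<union> A1 \<union> (B0 \<union> B1))"
    using 0 1 insert.prems(3) by blast
  moreover have "insert s (S0 - {s} \<union> S1) = S0 \<union> S1"
    using 0 by auto
  moreover have "insert t (T0 \<union> (T1 - {t})) = T0 \<union> T1"
    using 1 by auto
  moreover have "A0 \<union> A1 \<union> (B0 \<union> B1) = C0 \<union> C1" using 0 1 by auto
  ultimately show ?case by simp
qed

subsection \<open>Splitting along a coordinate\<close>

definition terminals :: "bool \<Rightarrow> 'a set set \<Rightarrow> 'a set set \<Rightarrow> 'a set set \<Rightarrow> bool" where
  "terminals p V S T \<longleftrightarrow> S \<subseteq> {v \<in> V. ev v = p} \<and> T \<subseteq> {v \<in> V. ev v \<noteq> p} \<and> card S = card T"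

text \<open>The bound is stated additively because subtraction of naturals truncates.\<close>

definition linkable :: "'a set \<Rightarrow> 'a set \<Rightarrow> 'a set set \<Rightarrow> 'a set set \<Rightarrow> 'a set set \<Rightarrow> bool" where
  "linkable I z F S T \<longleftrightarrow>
     (\<exists>C. C \<subseteq> cube I z - F \<and> linkage S T C \<and> 2 ^ card I \<le> card C + 2 * card F)"

text \<open>The vertices in \<open>D\<close> may be used by the paths, but are not allowed as terminals.\<close>

definition solvable :: "'a set \<Rightarrow> 'a set \<Rightarrow> 'a set set \<Rightarrow> nat \<Rightarrow> 'a set set \<Rightarrow> bool" where
  "solvable I z F K D \<longleftrightarrow>
     (\<forall>p S T. terminals p (cube I z - F - D) S T \<longrightarrow> 1 \<le> card S \<longrightarrow> card S \<le> K \<longrightarrow> linkable I z F S T)"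

lemma solvableD: "solvable I z F K D \<Longrightarrow> terminals p (cube I z - F - D) S T \<Longrightarrow> 1 \<le> card S \<Longrightarrow> card S \<le> K \<Longrightarrow>
   \<exists>C. C \<subseteq> cube I z - F \<and> linkage S T C \<and> 2 ^ card I \<le> card C + 2 * card F"
  unfolding solvable_def linkable_def by blast

lemma linkable_sym: "linkable I z F S T \<Longrightarrow> linkable I z F T S"
  unfolding linkable_def using linkage_rev by blast

lemma terminals_sym: "terminals p V S T \<Longrightarrow> terminals (\<not> p) V T S"
  unfolding terminals_def by auto

lemma terminalsD:
  assumes "terminals p V S T"
  shows "S \<subseteq> V" "T \<subseteq> V" "\<And>v. v \<in> S \<Longrightarrow> ev v = p" "\<And>v. v \<in> T \<Longrightarrow> ev v = (\<not> p)" "card S = card T" "S \<inter> T = {}"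
  using assms unfolding terminals_def by auto

text \<open>The members of \<open>W\<close> become extra terminals in one half, and their neighbours
  along \<open>i\<close> extra terminals in the other. Of the \<open>2 ^ (card J - 1)\<close>
  vertices of the right parity, each element of \<open>X\<close> or \<open>Y\<close> excludes at
  most one.\<close>

lemma ex_crossing_set:
  assumes fin: "finite J" "finite z" "J \<noteq> {}" "finite X" "finite Y"
    and le: "m + card X + card Y \<le> 2 ^ (card J - 1)"
  shows "\<exists>W \<subseteq> {w \<in> cube J z. ev w = p}. card W = m \<and> W \<inter> X = {} \<and> flip i ` W \<inter> Y = {}"
proof -
  let ?V = "{w \<in> cube J z. ev w = p}"
  have "card (X \<union> flip i ` Y) \<le> card X + card Y"
    using card_Un_le[of X "flip i ` Y"] card_image_le[OF fin(5), of "flip i"] by linarith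
  moreover have "card ?V - card (X \<union> flip i ` Y) \<le> card (?V - (X \<union> flip i ` Y))"
    by (rule diff_card_le_card_Diff) (use fin in auto)
  ultimately have "m \<le> card (?V - (X \<union> flip i ` Y))"
    using le card_cube_parity[OF fin(1,2,3), of p] by linarith
  then obtain W where W: "W \<subseteq> ?V - (X \<union> flip i ` Y)" "card W = m"
    by (meson obtain_subset_with_card_n)
  have "flip i ` W \<inter> Y = {}"
  proof (rule ccontr)
    assume "flip i ` W \<inter> Y \<noteq> {}"
    then obtain w where "w \<in> W" "flip i w \<in> Y" by blast
    then have "w \<in> flip i ` Y" by (metis flip_flip image_eqI)
    then show False using W \<open>w \<in> W\<close> by blast
  qed
  then show ?thesis using W by blast
qed

text \<open>The linkage has \<open>card C0 - card S\<close> edges, counted by their heads. A faulty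
  or barred vertex of the other half spoils at most two of them, one through its head and one
  through its tail. So some edge has usable neighbours across both ends, and it is replaced by a
  long path between these neighbours.\<close>

lemma linkage_detour:
  assumes fin: "finite J" "finite z" "i \<notin> J" "finite F1" "finite D1"
    and l: "linkage S T C0" "C0 \<subseteq> cube J z"
    and sol: "solvable J (flip i z) F1 K D1" "1 \<le> K"
    and le: "2 * card F1 + 2 * card D1 + card S < card C0"
  shows "\<exists>C1 \<subseteq> cube J (flip i z) - F1. linkage S T (C0 \<union> C1) \<and> 2 ^ card J \<le> card C1 + 2 * card F1"
proof -
  let ?B = "F1 \<union> D1"
  obtain pr where inj: "inj_on pr (C0 - S)"
    and pr: "\<And>u. u \<in> C0 - S \<Longrightarrow> \<exists>s t A A' B. path_on s (pr u) A \<and> path_on u t A' \<and> adj (pr u) u \<and>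
        linkage (S - {s}) (T - {t}) B \<and>
        A \<inter> A' = {} \<and> A \<inter> B = {} \<and> A' \<inter> B = {} \<and> A \<union> A' \<union> B = C0 \<and> s \<in> S \<and> t \<in> T"
    using linkage_pred[OF l(1)] by blast
  have finC: "finite C0" and SC: "S \<subseteq> C0" using linkage_subset[OF l(1)] by auto
  define U1 where "U1 = {u \<in> C0 - S. flip i u \<in> ?B}"
  define U2 where "U2 = {u \<in> C0 - S. flip i (pr u) \<in> ?B}"
  have "card U1 \<le> card ?B"
    by (rule card_inj_on_le[of "flip i"]) (use fin in \<open>auto simp: inj_on_def U1_def\<close>)
  moreover have "card U2 \<le> card ?B"
    by (rule card_inj_on_le[of "\<lambda>u. flip i (pr u)"]) (use fin inj in \<open>auto simp: inj_on_def U2_def\<close>)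
  moreover have "card ?B \<le> card F1 + card D1" by (rule card_Un_le)
  moreover have "card (U1 \<union> U2) \<le> card U1 + card U2" by (rule card_Un_le)
  moreover have "card (C0 - S) + card S = card C0"
    using SC finC by (metis card_Diff_subset card_mono finite_subset le_add_diff_inverse2)
  ultimately have "card (U1 \<union> U2) < card (C0 - S)"
    using le by linarith
  then obtain u where u: "u \<in> C0 - S" "flip i u \<notin> ?B" "flip i (pr u) \<notin> ?B"
  proof -
    have "\<not> C0 - S \<subseteq> U1 \<union> U2"
      using \<open>card (U1 \<union> U2) < card (C0 - S)\<close> card_mono[of "U1 \<union> U2" "C0 - S"] finC
      by (auto simp: U1_def U2_def)
    then show ?thesis using that unfolding U1_def U2_def by blast
  qed
  obtain s t A A' B where *: "path_on s (pr u) A" "path_on u t A'" "adj (pr u) u"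
    "linkage (S - {s}) (T - {t}) B" "A \<inter> A' = {}" "A \<inter> B = {}" "A' \<inter> B = {}" "A \<union> A' \<union> B = C0"
    "s \<in> S" "t \<in> T"
    using pr[OF u(1)] by blast
  have q: "pr u \<in> cube J z" "u \<in> cube J z"
    using * path_on_ends[OF *(1)] path_on_ends[OF *(2)] l(2) by blast+
  have "terminals (ev (flip i (pr u))) (cube J (flip i z) - F1 - D1) {flip i (pr u)} {flip i u}"
    using q u *(3) fin(3) cube_finite_mem[of "pr u" J z] cube_finite_mem[of u J z] ev_adj[of "pr u" u]
    by (auto simp: terminals_def flip_mem_cube ev_flip)
  from solvableD[OF sol(1) this] obtain C1 where C1: "C1 \<subseteq> cube J (flip i z) - F1"
    "linkage {flip i (pr u)} {flip i u} C1" "2 ^ card J \<le> card C1 + 2 * card F1"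
    using sol(2) by auto
  have disj: "C0 \<inter> C1 = {}"
    using l(2) C1(1) cube_split(2)[of i "insert i J" z] fin(3) by auto
  have "path_on s (flip i u) (A \<union> C1)"
    using *(1,8) linkage_pair[OF C1(2)] disj by (intro path_on_join) auto
  then have "path_on s t (A \<union> C1 \<union> A')"
    by (rule path_on_join[OF _ *(2)]) (use *(5,8) disj in auto)
  then have "linkage (insert s (S - {s})) (insert t (T - {t})) (A \<union> C1 \<union> A' \<union> B)"
    using *(4-8) disj by (intro linkage.add) auto
  moreover have "A \<union> C1 \<union> A' \<union> B = C0 \<union> C1" using * by blast
  ultimately show ?thesis using C1 *(9,10) by (auto simp: insert_absorb)
qed

lemma card_two_halves:
  assumes "C0 \<subseteq> cube J z - F0" "C1 \<subseteq> cube J (flip i z) - F1" "i \<notin> J" "finite J" "finite z"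
  shows "card (C0 \<union> C1) = card C0 + card C1"
proof (rule card_Un_disjoint)
  have "finite (cube J z)" "finite (cube J (flip i z))" using assms by (auto intro: finite_cube)
  then show "finite C0" "finite C1" using assms by (auto intro: finite_subset)
  show "C0 \<inter> C1 = {}" using assms cube_split(2)[of i "insert i J" z] by auto
qed

section \<open>The two halves of a cube along a coordinate\<close>

locale halves =
  fixes I :: "'a set" and z :: "'a set" and i :: 'a and F :: "'a set set"
  assumes finI: "finite I" and finz: "finite z" and iI: "i \<in> I" and FI: "F \<subseteq> cube I z"
begin

definition J where "J = I - {i}"
definition Q0 where "Q0 = cube J z"
definition Q1 where "Q1 = cube J (flip i z)"
definition F0 where "F0 = F \<inter> Q0"
definition F1 where "F1 = F \<inter> Q1"

lemma fJ: "finite J" "i \<notin> J" "card I = Suc (card J)"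
  using finI iI card_Suc_Diff1[OF finI iI] by (auto simp: J_def)

lemma Q: "cube I z = Q0 \<union> Q1" "Q0 \<inter> Q1 = {}" "finite Q0" "finite Q1"
  unfolding Q0_def Q1_def J_def using cube_split[OF iI] finI finz by (auto intro: finite_cube)

lemma finF: "finite F" "finite F0" "finite F1"
  using Q FI unfolding F0_def F1_def by (auto intro: finite_subset)

lemma F01: "F = F0 \<union> F1" "F0 \<inter> F1 = {}" "F0 \<subseteq> Q0" "F1 \<subseteq> Q1" "card F = card F0 + card F1"
proof -
  show *: "F = F0 \<union> F1" "F0 \<inter> F1 = {}" "F0 \<subseteq> Q0" "F1 \<subseteq> Q1"
    using FI Q unfolding F0_def F1_def by auto
  show "card F = card F0 + card F1"
    using card_Un_disjoint[OF finF(2,3) *(2)] *(1) by simp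
qed

lemma flipQ: "flip i v \<in> Q1 \<longleftrightarrow> v \<in> Q0" "flip i v \<in> Q0 \<longleftrightarrow> v \<in> Q1"
  unfolding Q0_def Q1_def using fJ by (auto simp: flip_mem_cube flip_mem_cube')

lemma finQ: "v \<in> Q0 \<Longrightarrow> finite v" "v \<in> Q1 \<Longrightarrow> finite v"
  unfolding Q0_def Q1_def by (auto intro: cube_finite_mem)

lemma Q0_iff: "v \<in> cube I z \<Longrightarrow> v \<in> Q0 \<longleftrightarrow> (i \<in> v \<longleftrightarrow> i \<in> z)"
  unfolding Q0_def J_def using cube_remove[OF iI] by blast

lemma Q1_iff: "v \<in> cube I z \<Longrightarrow> v \<in> Q1 \<longleftrightarrow> \<not> (i \<in> v \<longleftrightarrow> i \<in> z)"
  unfolding Q1_def J_def using flip_cube_remove[OF iI] by blast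

lemma halves_subset: "Q0 - F0 \<subseteq> cube I z - F" "Q1 - F1 \<subseteq> cube I z - F"
  using Q(1) unfolding F0_def F1_def by blast+

lemma card_halves:
  assumes "C0 \<subseteq> Q0 - X" "C1 \<subseteq> Q1 - Y"
  shows "card (C0 \<union> C1) = card C0 + card C1"
  by (rule card_two_halves[OF assms[unfolded Q0_def Q1_def] fJ(2,1) finz])

lemma combine:
  assumes "linkage S T (C0 \<union> C1)" "C0 \<subseteq> Q0 - F0" "C1 \<subseteq> Q1 - F1"
    "2 ^ card J \<le> card C0 + 2 * card F0" "2 ^ card J \<le> card C1 + 2 * card F1"
  shows "linkable I z F S T"
proof -
  have "C0 \<union> C1 \<subseteq> cube I z - F" using assms(2,3) halves_subset by blast
  moreover have "card (C0 \<union> C1) = card C0 + card C1"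
    using card_halves assms(2,3) .
  moreover have "2 ^ card I = 2 ^ card J + (2::nat) ^ card J" using fJ(3) by simp
  ultimately have "2 ^ card I \<le> card (C0 \<union> C1) + 2 * card F" using assms(4,5) F01(5) by linarith
  then show ?thesis using assms(1) \<open>C0 \<union> C1 \<subseteq> cube I z - F\<close> unfolding linkable_def by blast
qed

lemma sol0D:
  "solvable J z F0 K D \<Longrightarrow> terminals p (Q0 - F0 - D) S T \<Longrightarrow> 1 \<le> card S \<Longrightarrow> card S \<le> K \<Longrightarrow>
   \<exists>C. C \<subseteq> Q0 - F0 \<and> linkage S T C \<and> 2 ^ card J \<le> card C + 2 * card F0"
  unfolding Q0_def by (rule solvableD)

lemma sol1D:
  "solvable J (flip i z) F' K D \<Longrightarrow> terminals p (Q1 - F' - D) S T \<Longrightarrow> 1 \<le> card S \<Longrightarrow> card S \<le> K \<Longrightarrow>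
   \<exists>C. C \<subseteq> Q1 - F' \<and> linkage S T C \<and> 2 ^ card J \<le> card C + 2 * card F'"
  unfolding Q1_def by (rule solvableD)

lemma terminals_card:
  assumes "terminals p (cube I z - F) S T"
  shows "finite S" "finite T" "card S = card (S \<inter> Q0) + card (S \<inter> Q1)"
    "card T = card (T \<inter> Q0) + card (T \<inter> Q1)"
proof -
  have *: "S \<subseteq> Q0 \<union> Q1" "T \<subseteq> Q0 \<union> Q1" using terminalsD[OF assms] Q by auto
  then show "finite S" "finite T" using Q by (auto intro: finite_subset)
  then show "card S = card (S \<inter> Q0) + card (S \<inter> Q1)" "card T = card (T \<inter> Q0) + card (T \<inter> Q1)"
    using * Q by (subst card_Un_disjoint[symmetric]; (auto intro: arg_cong[where f = card])?)+
qed

text \<open>The surplus of sources over sinks in the first half ends in auxiliary sinks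
  \<open>W\<close>. Their neighbours across are the auxiliary sources of the second half, where the
  surplus is one of sinks; parities match because crossing changes the parity.\<close>

lemma split_aux:
  assumes sol: "solvable J z F0 K0 D0" "solvable J (flip i z) F1 K1 D1"
    and tr: "terminals p (cube I z - F) S T" "(S \<union> T) \<inter> (D0 \<union> D1) = {}"
    and D: "finite D0" "finite D1" and J: "J \<noteq> {}"
    and ge: "card (T \<inter> Q0) \<le> card (S \<inter> Q0)" "1 \<le> card (S \<inter> Q0)" "1 \<le> card (T \<inter> Q1)"
    and K: "card (S \<inter> Q0) \<le> K0" "card (T \<inter> Q1) \<le> K1"
    and le: "card F + card D0 + card D1 + card S \<le> 2 ^ (card J - 1)"
  shows "linkable I z F S T"
proof -
  note ST = terminalsD[OF tr(1)] terminals_card[OF tr(1)]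
  let ?S0 = "S \<inter> Q0" and ?S1 = "S \<inter> Q1" and ?T0 = "T \<inter> Q0" and ?T1 = "T \<inter> Q1"
  have fin: "finite ?S0" "finite ?S1" "finite ?T0" "finite ?T1" using ST by auto
  have "card (F0 \<union> D0 \<union> ?T0) \<le> card F0 + card D0 + card ?T0"
    by (meson card_Un_le le_trans add_mono order_refl)
  moreover have "card (F1 \<union> D1 \<union> ?S1) \<le> card F1 + card D1 + card ?S1"
    by (meson card_Un_le le_trans add_mono order_refl)
  \<comment> \<open>By \<open>ge\<close> the truncated difference is exact; the surplus, the sinks
    of the first half and the sources of the second add up to \<open>card S\<close>.\<close>
  ultimately have cnt: "(card ?S0 - card ?T0) + card (F0 \<union> D0 \<union> ?T0) + card (F1 \<union> D1 \<union> ?S1) \<le> 2 ^ (card J - 1)"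
    using le ge ST F01(5) by linarith
  then obtain W where W: "W \<subseteq> {w \<in> cube J z. ev w = (\<not> p)}" "card W = card ?S0 - card ?T0"
    "W \<inter> (F0 \<union> D0 \<union> ?T0) = {}" "flip i ` W \<inter> (F1 \<union> D1 \<union> ?S1) = {}"
    using ex_crossing_set[OF fJ(1) finz J _ _ cnt] finF D fin by (meson finite_UnI)
  have WQ: "W \<subseteq> Q0" "finite W" "flip i ` W \<subseteq> Q1"
  proof -
    show *: "W \<subseteq> Q0" using W(1) unfolding Q0_def by blast
    then show "finite W" using Q(3) by (rule finite_subset)
    show "flip i ` W \<subseteq> Q1" using * flipQ(1) by blast
  qed
  have evW: "ev (flip i w) = p" if "w \<in> W" for w
  proof -
    have "w \<in> Q0" "ev w = (\<not> p)" using that W(1) WQ(1) by auto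
    then show ?thesis by (simp add: ev_flip finQ(1))
  qed
  have S0: "?S0 \<subseteq> {v \<in> Q0 - F0 - D0. ev v = p}" "?T0 \<subseteq> {v \<in> Q0 - F0 - D0. ev v \<noteq> p}"
    "?S1 \<subseteq> {v \<in> Q1 - F1 - D1. ev v = p}" "?T1 \<subseteq> {v \<in> Q1 - F1 - D1. ev v \<noteq> p}"
    using ST tr(2) F01(1) by blast+
  have "card (?T0 \<union> W) = card ?S0"
  proof -
    have "card (?T0 \<union> W) = card ?T0 + card W" using W(3) fin WQ(2) by (intro card_Un_disjoint) auto
    then show ?thesis using W(2) ge(1) by linarith
  qed
  then have "terminals p (cube J z - F0 - D0) ?S0 (?T0 \<union> W)"
    using S0(1,2) W(1,3) WQ(1) unfolding terminals_def Q0_def[symmetric] by auto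
  from solvableD[OF sol(1) this] ge(2) K obtain C0 where C0: "C0 \<subseteq> Q0 - F0" "linkage ?S0 (?T0 \<union> W) C0"
    "2 ^ card J \<le> card C0 + 2 * card F0" unfolding Q0_def by auto
  have card1: "card (flip i ` W \<union> ?S1) = card ?T1"
  proof -
    have "card (flip i ` W \<union> ?S1) = card (flip i ` W) + card ?S1"
      using W(4) WQ fin by (intro card_Un_disjoint) auto
    then show ?thesis using W(2) ge(1) ST by (simp add: card_image inj_flip)
  qed
  then have "terminals p (cube J (flip i z) - F1 - D1) (flip i ` W \<union> ?S1) ?T1"
    using S0(3,4) W(4) WQ(3) evW unfolding terminals_def Q1_def[symmetric] by blast
  from solvableD[OF sol(2) this] ge(3) K card1 obtain C1 where C1: "C1 \<subseteq> Q1 - F1"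
    "linkage (flip i ` W \<union> ?S1) ?T1 C1" "2 ^ card J \<le> card C1 + 2 * card F1" unfolding Q1_def by auto
  have "linkage (?S0 \<union> ?S1) (?T0 \<union> ?T1) (C0 \<union> C1)"
    using WQ C0 C1 W Q(2) by (intro linkage_compose[of W]) (auto simp: inj_flip)
  moreover have "?S0 \<union> ?S1 = S" "?T0 \<union> ?T1 = T" using ST Q by auto
  ultimately show ?thesis using combine C0 C1 by simp
qed

lemma split_detour:
  assumes sol: "solvable J z F0 K0 D0" "solvable J (flip i z) F1 K1 D1"
    and tr: "terminals p (cube I z - F) S T" "(S \<union> T) \<inter> (D0 \<union> D1) = {}"
    and D: "finite D0" "finite D1" and J: "J \<noteq> {}"
    and sub: "S \<subseteq> Q0" "T \<subseteq> Q0" "1 \<le> card S"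
    and K: "card S \<le> K0" "1 \<le> K1"
    and le: "card F + card D0 + card D1 + card S \<le> 2 ^ (card J - 1)"
  shows "linkable I z F S T"
proof -
  note ST = terminalsD[OF tr(1)]
  have "terminals p (cube J z - F0 - D0) S T"
    using tr(2) sub ST F01(1) unfolding terminals_def Q0_def[symmetric] by auto
  from solvableD[OF sol(1) this] sub K obtain C0 where C0: "C0 \<subseteq> Q0 - F0" "linkage S T C0"
    "2 ^ card J \<le> card C0 + 2 * card F0" unfolding Q0_def by auto
  have "2 ^ card J = 2 * (2::nat) ^ (card J - 1)"
    using J fJ by (metis card_gt_0_iff power_eq_if not_gr_zero)
  then have "2 * card F1 + 2 * card D1 + card S < card C0"
    using C0(3) le sub F01(5) by linarith
  then obtain C1 where "C1 \<subseteq> Q1 - F1" "linkage S T (C0 \<union> C1)" "2 ^ card J \<le> card C1 + 2 * card F1"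
    using linkage_detour[OF fJ(1) finz fJ(2) finF(3) D(2) C0(2) _ sol(2) K(2)] C0(1)
    unfolding Q0_def Q1_def by blast
  then show ?thesis using combine C0 by blast
qed

lemma halves_flip: "halves I (flip i z) i F"
proof -
  have "flip i z \<in> cube I z" using flip_mem_cube_iff[OF cube_self[OF finz]] iI by blast
  then have "cube I (flip i z) = cube I z" by (rule cube_cong)
  then show ?thesis using finI finz iI FI by unfold_locales auto
qed

text \<open>Moving the base point across the coordinate exchanges the halves, so a result about the
  first half also serves for the second.\<close>

lemma flip_simps:
  "halves.Q0 I (flip i z) i = Q1" "halves.Q1 I (flip i z) i = Q0"
  "halves.F0 I (flip i z) i F = F1" "halves.F1 I (flip i z) i F = F0"
  "cube I (flip i z) = cube I z" "linkable I (flip i z) F S T = linkable I z F S T"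
proof -
  interpret fl: halves I "flip i z" i F by (rule halves_flip)
  show 1: "fl.Q0 = Q1" "fl.Q1 = Q0"
    unfolding fl.Q0_def fl.Q1_def Q0_def Q1_def by auto
  show "fl.F0 = F1" "fl.F1 = F0"
    unfolding fl.F0_def fl.F1_def F0_def F1_def 1 by auto
  show "cube I (flip i z) = cube I z"
    by (rule cube_cong) (use flip_mem_cube_iff[OF cube_self[OF finz], of i I] iI in auto)
  then show "linkable I (flip i z) F S T = linkable I z F S T" by (simp add: linkable_def)
qed

lemma split:
  assumes sol: "solvable J z F0 K0 D0" "solvable J (flip i z) F1 K1 D1"
    and tr: "terminals p (cube I z - F) S T" "(S \<union> T) \<inter> (D0 \<union> D1) = {}"
    and D: "finite D0" "finite D1" and J: "J \<noteq> {}" and S: "1 \<le> card S" and K1: "1 \<le> K0" "1 \<le> K1"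
    and K: "card (S \<inter> Q0) \<le> K0" "card (T \<inter> Q0) \<le> K0" "card (S \<inter> Q1) \<le> K1" "card (T \<inter> Q1) \<le> K1"
    and le: "card F + card D0 + card D1 + card S \<le> 2 ^ (card J - 1)"
  shows "linkable I z F S T"
proof -
  have *: "linkable I z F S T" if tr: "terminals p (cube I z - F) S T" "(S \<union> T) \<inter> (D0 \<union> D1) = {}"
    and S: "1 \<le> card S"
    and K: "card (S \<inter> Q0) \<le> K0" "card (T \<inter> Q0) \<le> K0" "card (S \<inter> Q1) \<le> K1" "card (T \<inter> Q1) \<le> K1"
    and le: "card F + card D0 + card D1 + card S \<le> 2 ^ (card J - 1)"
    and ge: "card (T \<inter> Q0) \<le> card (S \<inter> Q0)" for p S T
  proof -
    note c = terminalsD[OF tr(1)] terminals_card[OF tr(1)]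
    \<comment> \<open>Because of \<open>ge\<close>, the first two alternatives mean that one of the
      halves contains no terminal at all.\<close>
    consider "card (S \<inter> Q0) = 0" | "card (T \<inter> Q1) = 0" | "1 \<le> card (S \<inter> Q0)" "1 \<le> card (T \<inter> Q1)"
      by linarith
    then show ?thesis
    proof cases
      case 1
      interpret fl: halves I "flip i z" i F by (rule halves_flip)
      have "S \<inter> Q0 = {}" "T \<inter> Q0 = {}" using 1 ge c by auto
      then have sub: "S \<subseteq> Q1" "T \<subseteq> Q1" using c Q by auto
      have "card S \<le> K1" using sub K by (simp add: Int_absorb2)
      then show ?thesis
        using fl.split_detour[unfolded flip_simps flip_flip, OF sol(2,1) tr(1) _ D(2,1) J sub S _ K1(1)]
          tr(2) le by (simp add: Un_commute add_ac)
    next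
      case 2
      then have "card (S \<inter> Q1) = 0" using ge c(5,9,10) by linarith
      then have "T \<inter> Q1 = {}" "S \<inter> Q1 = {}" using 2 c(7,8) by auto
      then have sub: "S \<subseteq> Q0" "T \<subseteq> Q0" using c Q by auto
      have "card S \<le> K0" using sub K by (simp add: Int_absorb2)
      then show ?thesis
        by (rule split_detour[OF sol tr D J sub S _ K1(2) le])
    next
      case 3
      then show ?thesis using split_aux[OF sol tr D J ge _ _ K(1,4) le] by blast
    qed
  qed
  show ?thesis
  proof (cases "card (T \<inter> Q0) \<le> card (S \<inter> Q0)")
    case True
    then show ?thesis using * tr S K le by blast
  next
    case False
    then have "linkable I z F T S"
      using *[of "\<not> p" T S] terminals_sym[OF tr(1)] tr(2) S K le terminalsD(5)[OF tr(1)] by (auto simp: Un_commute)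
    then show ?thesis by (rule linkable_sym)
  qed
qed

text \<open>
  All sources lie in the first half. Demoting the source \<open>s\<close> leaves only \<open>k - 1\<close> paths there. If one
  of them visits \<open>s\<close>, it is cut just before \<open>s\<close> and its first part continues in the second half;
  otherwise the path from \<open>s\<close> crosses immediately.
\<close>

lemma shift:
  assumes tr: "terminals p (cube I z - F) S T" and s: "s \<in> S"
    and sub: "S \<subseteq> Q0" "T \<inter> Q0 \<noteq> {}" "T \<inter> Q1 \<noteq> {}"
    and sol0: "solvable J z F0 (card S - 1) D0" and D: "finite D0" "(S - {s} \<union> T \<inter> Q0) \<inter> D0 = {}"
    and sol1: "solvable J (flip i z) F1 (card S - 1) {}"
    and sol2: "F0 \<noteq> {} \<Longrightarrow> solvable J (flip i z) (insert (flip i s) F1) (card S - 1) {}"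
    and s': "flip i s \<notin> F1"
    and nb: "\<And>q. q \<in> Q0 \<Longrightarrow> adj q s \<Longrightarrow> q \<notin> F \<Longrightarrow> q \<notin> T \<Longrightarrow> flip i q \<notin> F1"
    and le: "card F + card D0 + card S \<le> 2 ^ (card J - 1)" "F0 \<noteq> {} \<Longrightarrow> card F1 + card S \<le> card J + 1"
  shows "linkable I z F S T"
proof -
  note ST = terminalsD[OF tr] terminals_card[OF tr]
  let ?T0 = "T \<inter> Q0" and ?T1 = "T \<inter> Q1"
  have fin: "finite ?T0" "finite ?T1" using ST by auto
  have T01: "1 \<le> card ?T0" "1 \<le> card ?T1" using sub(2,3) fin by (simp_all add: Suc_leI card_gt_0_iff)
  have k: "card S = card ?T0 + card ?T1" using ST by simp
  have J: "J \<noteq> {}"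
  proof
    assume "J = {}"
    then have "2 ^ (card J - 1) = (1::nat)" by simp
    then show False using le k T01 by linarith
  qed
  have pJ: "2 ^ card J = 2 * (2::nat) ^ (card J - 1)"
    using J fJ by (metis card_gt_0_iff power_eq_if not_gr_zero)
  have "card (F0 \<union> D0 \<union> ?T0) \<le> card F0 + card D0 + card ?T0"
    by (meson card_Un_le le_trans add_mono order_refl)
  \<comment> \<open>\<open>W\<close> gets one element fewer than \<open>?T1\<close>: the remaining
    sink there is reserved for the path that the demoted source causes to cross.\<close>
  then have cnt: "(card ?T1 - 1) + card (F0 \<union> D0 \<union> ?T0) + card F1 \<le> 2 ^ (card J - 1)"
    using le k F01(5) by linarith
  then obtain W where W: "W \<subseteq> {w \<in> cube J z. ev w = (\<not> p)}" "card W = card ?T1 - 1"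
    "W \<inter> (F0 \<union> D0 \<union> ?T0) = {}" "flip i ` W \<inter> F1 = {}"
    using ex_crossing_set[OF fJ(1) finz J _ _ cnt] finF D fin by (meson finite_UnI)
  have WQ: "W \<subseteq> Q0" "finite W" "flip i ` W \<subseteq> Q1"
  proof -
    show *: "W \<subseteq> Q0" using W(1) unfolding Q0_def by blast
    then show "finite W" using Q(3) by (rule finite_subset)
    show "flip i ` W \<subseteq> Q1" using * flipQ(1) by blast
  qed
  have evW: "ev (flip i w) = p" if "w \<in> W" for w
  proof -
    have "w \<in> Q0" "ev w = (\<not> p)" using that W(1) WQ(1) by auto
    then show ?thesis by (simp add: ev_flip finQ(1))
  qed
  have sQ: "s \<in> Q0" "s \<notin> F" "ev s = p" "finite s" using s sub ST finQ by auto
  have cS: "card (S - {s}) = card S - 1" "finite (S - {s})" using s ST by auto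
  have "card (?T0 \<union> W) = card (S - {s})"
  proof -
    have "card (?T0 \<union> W) = card ?T0 + card W" using W(3) fin WQ(2) by (intro card_Un_disjoint) auto
    then show ?thesis using W(2) cS(1) k T01 by linarith
  qed
  moreover have "S - {s} \<subseteq> {v \<in> Q0 - F0 - D0. ev v = p}"
  proof
    fix v assume "v \<in> S - {s}"
    then have "v \<in> S" "v \<in> Q0" "v \<notin> F" "v \<notin> D0" using ST(1) sub(1) D(2) by blast+
    then show "v \<in> {v \<in> Q0 - F0 - D0. ev v = p}" using F0_def ST(3) by simp
  qed
  moreover have "?T0 \<subseteq> {v \<in> Q0 - F0 - D0. ev v \<noteq> p}"
  proof
    fix v assume "v \<in> ?T0"
    then have "v \<in> T" "v \<in> Q0" "v \<notin> F" "v \<notin> D0" using ST(2) D(2) by blast+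
    then show "v \<in> {v \<in> Q0 - F0 - D0. ev v \<noteq> p}" using F0_def ST(4) by simp
  qed
  ultimately have tr0: "terminals p (Q0 - F0 - D0) (S - {s}) (?T0 \<union> W)"
    using W(1,3) WQ(1) unfolding terminals_def by (auto simp: Q0_def)
  have "1 \<le> card (S - {s})" "card (S - {s}) \<le> card S - 1" using cS k T01 by linarith+
  from sol0D[OF sol0 tr0 this] obtain C0 where C0: "C0 \<subseteq> Q0 - F0" "linkage (S - {s}) (?T0 \<union> W) C0"
    "2 ^ card J \<le> card C0 + 2 * card F0"
    by blast
  have T1: "?T1 \<subseteq> {v \<in> Q1 - F1. ev v \<noteq> p}" using ST F01 by blast
  have K1: "card ?T1 \<le> card S - 1" using k T01 by linarith
  have TT: "?T0 \<union> ?T1 = T" using ST Q by auto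
  have finC0: "finite C0" using C0(1) Q(3) by (auto intro: finite_subset)
  show ?thesis
  proof (cases "s \<in> C0")
    case True
    obtain q where q: "adj q s" "q \<in> C0" "q \<notin> ?T0 \<union> W" "linkage (insert s (S - {s})) (insert q (?T0 \<union> W)) C0"
      using linkage_cut[OF C0(2) True] by blast
    have qQ: "q \<in> Q0" "q \<notin> F" "q \<notin> T" using q(2,3) C0(1) F0_def by auto
    have q1: "flip i q \<notin> F1" using nb[OF qQ(1) q(1) qQ(2,3)] .
    have evq: "ev (flip i q) = p" using q(1) qQ(1) sQ finQ(1) ev_adj by (auto simp: ev_flip)
    have c1: "card (flip i ` insert q W) = card ?T1"
      using q(3) W(2) WQ(2) T01 by (subst card_image) (auto simp: inj_flip)
    then have tr1: "terminals p (Q1 - F1 - {}) (flip i ` insert q W) ?T1"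
      using T1 W(4) WQ(3) evW evq q1 qQ(1) flipQ(1) unfolding terminals_def by blast
    have "1 \<le> card (flip i ` insert q W)" "card (flip i ` insert q W) \<le> card S - 1"
      using c1 K1 T01 by linarith+
    from sol1D[OF sol1 tr1 this] obtain C1 where C1: "C1 \<subseteq> Q1 - F1"
      "linkage (flip i ` insert q W \<union> {}) ?T1 C1" "2 ^ card J \<le> card C1 + 2 * card F1"
          by auto
    have "linkage (insert s (S - {s})) (?T0 \<union> insert q W) C0" using q(4) by simp
    then have "linkage (insert s (S - {s}) \<union> {}) (?T0 \<union> ?T1) (C0 \<union> C1)"
    proof (rule linkage_compose[rotated, OF _ C1(2)])
      show "C0 \<inter> C1 = {}" using C0(1) C1(1) Q by auto
    qed (use W q WQ in \<open>auto simp: inj_flip\<close>)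
    then show ?thesis using combine[OF _ C0(1) C1(1) C0(3) C1(3)] s TT by (simp add: insert_absorb)
  next
    case False
    \<comment> \<open>Without faults the bound forces the paths through every vertex of the half,
      hence through \<open>s\<close>.\<close>
    have ne: "F0 \<noteq> {}"
    proof
      assume "F0 = {}"
      then have "card Q0 \<le> card C0" using C0(3) card_cube[OF fJ(1) finz] unfolding Q0_def by simp
      then have "C0 = Q0" using C0(1) Q(3) by (meson Diff_subset card_seteq order_trans)
      then show False using False sQ by simp
    qed
    note sol2 = sol2[OF ne] and le2 = le(2)[OF ne]
    let ?s = "flip i s"
    have s1: "?s \<in> Q1" "?s \<notin> F" "ev ?s = (\<not> p)"
      using sQ flipQ s' F1_def by (auto simp: ev_flip)
    have finC: "finite (insert ?s F1)" using finF by simp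
    have cF: "card (insert ?s F1) = card F1 + 1" using finF s' by simp
    have ss: "path_on s ?s {s, ?s}"
      using path_on.step[OF path_on.single[of ?s], of s] by simp
    \<comment> \<open>The vertex \<open>?s\<close> is declared faulty in the second half. This
      lowers the guaranteed length by two, which the vertices \<open>s\<close> and \<open>?s\<close>
      restore.\<close>
    have finish: "linkable I z F S T"
      if C1: "C1 \<subseteq> Q1 - insert ?s F1" "2 ^ card J \<le> card C1 + 2 * card (insert ?s F1)"
        and l: "linkage S T ({s, ?s} \<union> (C0 \<union> C1))" for C1
    proof -
      have sC: "s \<notin> C0 \<union> C1" "?s \<notin> C0 \<union> C1" using False C1(1) C0(1) sQ(1) s1(1) Q(2) by blast+
      have "card (C0 \<union> C1) = card C0 + card C1"
        using card_halves C0(1) C1(1) .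
      moreover have "card ({s, ?s} \<union> (C0 \<union> C1)) = card (C0 \<union> C1) + 2"
        using sC finC0 C1(1) Q(4) by (simp add: finite_subset)
      moreover have "{s, ?s} \<union> (C0 \<union> C1) \<subseteq> cube I z - F"
        using sQ s1 C0(1) C1(1) halves_subset Q(1) by blast
      ultimately show ?thesis
        unfolding linkable_def using l C0(3) C1(2) cF F01(5) fJ(3) by (intro exI[of _ "{s, ?s} \<union> (C0 \<union> C1)"]) auto
    qed
    show ?thesis
    proof (cases "?s \<in> T")
      case s1T: True
      let ?Tr = "?T1 - {?s}"
      have T: "insert ?s (?T0 \<union> ?Tr) = T" using s1T s1 TT by blast
      have "\<exists>C1. C1 \<subseteq> Q1 - insert ?s F1 \<and> linkage (S - {s}) (?T0 \<union> ?Tr) (C0 \<union> C1) \<and>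
         2 ^ card J \<le> card C1 + 2 * card (insert ?s F1)"
      proof (cases "?Tr = {}")
        \<comment> \<open>No sink is left in the second half, so it is inserted as a detour into the
          linkage of the first half.\<close>
        case True
        then have "card ?T1 \<le> 1" using s1T s1
          by (metis Diff_eq_empty_iff card.empty card_insert_le_m1 card_mono finite.intros(1,2) is_singletonI is_singleton_altdef)
        then have "W = {}" using W WQ T01 by simp
        then have l: "linkage (S - {s}) ?T0 C0" using C0 by simp
        have le': "2 * card (insert ?s F1) + 2 * card ({} :: 'a set set) + card (S - {s}) < card C0"
          using C0(3) le(1) pJ F01(5) cF cS k T01 by simp
        have K': "1 \<le> card S - 1" and C0': "C0 \<subseteq> cube J z"
          using k T01 C0(1) by (linarith, auto simp: Q0_def)
        from linkage_detour[OF fJ(1) finz fJ(2) finC finite.emptyI l C0' sol2 K' le']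
        show ?thesis unfolding True Un_empty_right unfolding Q1_def by blast
      next
        case F: False
        have cT: "card ?Tr = card ?T1 - 1" using s1T s1 fin by simp
        have T1': "card ?Tr \<ge> 1" using F fin by (simp add: Suc_leI card_gt_0_iff)
        have c1: "card (flip i ` W) = card ?Tr" using W(2) cT by (simp add: card_image inj_flip)
        have sW: "?s \<notin> flip i ` W" using evW s1 by auto
        have tr1: "terminals p (Q1 - insert ?s F1 - {}) (flip i ` W) ?Tr"
          using T1 W(4) WQ(3) evW c1 sW unfolding terminals_def by blast
        have "1 \<le> card (flip i ` W)" "card (flip i ` W) \<le> card S - 1"
          using c1 K1 T1' cT by linarith+
        from sol1D[OF sol2 tr1 this] obtain C1 where C1: "C1 \<subseteq> Q1 - insert ?s F1"
          "linkage (flip i ` W \<union> {}) ?Tr C1" "2 ^ card J \<le> card C1 + 2 * card (insert ?s F1)"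
          by auto
        have "linkage (S - {s} \<union> {}) (?T0 \<union> ?Tr) (C0 \<union> C1)"
        proof (rule linkage_compose[rotated, OF C0(2) C1(2)])
          show "C0 \<inter> C1 = {}" using C0(1) C1(1) Q by auto
        qed (use W WQ in \<open>auto simp: inj_flip\<close>)
        then show ?thesis using C1 by auto
      qed
      then obtain C1 where C1: "C1 \<subseteq> Q1 - insert ?s F1" "linkage (S - {s}) (?T0 \<union> ?Tr) (C0 \<union> C1)"
         "2 ^ card J \<le> card C1 + 2 * card (insert ?s F1)" by blast
      have sC: "s \<notin> C0 \<union> C1" "?s \<notin> C0 \<union> C1" using False C1 C0 sQ s1 Q by auto
      then have "linkage (insert s (S - {s})) (insert ?s (?T0 \<union> ?Tr)) ({s, ?s} \<union> (C0 \<union> C1))"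
        by (intro linkage.add ss C1) auto
      then have "linkage S T ({s, ?s} \<union> (C0 \<union> C1))" using T s by (simp add: insert_absorb)
      then show ?thesis by (rule finish[OF C1(1,3)])
    next
      case s1T: False
      \<comment> \<open>At most \<open>card F1 + card ?T1 - 1 < card J\<close> neighbours of
        \<open>?s\<close> in its half are unsuitable, so one remains on which the path from
        \<open>s\<close> can continue.\<close>
      have "card ((\<lambda>j. flip j ?s) ` J) = card J"
        by (intro card_image) (auto simp: inj_on_def)
      moreover have "card (F1 \<union> flip i ` W) < card J"
      proof -
        have "card (F1 \<union> flip i ` W) \<le> card F1 + card W"
          using card_Un_le[of F1 "flip i ` W"] card_image_le[OF WQ(2), of "flip i"] by linarith
        then show ?thesis using le2 W(2) k T01 by linarith
      qed
      ultimately have "\<not> (\<lambda>j. flip j ?s) ` J \<subseteq> F1 \<union> flip i ` W"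
        using card_mono[of "F1 \<union> flip i ` W" "(\<lambda>j. flip j ?s) ` J"] finF(3) WQ(2)
        by (metis finite_UnI finite_imageI not_less)
      then obtain j where j: "j \<in> J" "flip j ?s \<notin> F1" "flip j ?s \<notin> flip i ` W" by blast
      let ?r = "flip j ?s"
      have r: "?r \<in> Q1" "ev ?r = p"
        using s1 j flip_mem_cube_iff[of ?s J "flip i z" j] sQ(4) ev_flip[of ?s j] by (auto simp: Q1_def)
      \<comment> \<open>All links cross the coordinate, except that the one leaving
        \<open>?s\<close> stays in the second half and leads to \<open>?r\<close>.\<close>
      let ?g = "\<lambda>w. if w = ?s then ?r else flip i w"
      have sW: "?s \<notin> W" "?s \<notin> ?T0" using s1 WQ Q by auto
      have gW: "?g ` insert ?s W = insert ?r (flip i ` W)" using sW by auto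
      have c1: "card (insert ?r (flip i ` W)) = card ?T1"
        using j(3) WQ(2) W(2) T01 by (simp add: card_image inj_flip)
      have sW': "?s \<notin> flip i ` W" using evW s1 by auto
      have T1: "?T1 \<subseteq> {v \<in> Q1 - insert ?s F1. ev v \<noteq> p}" using T1 s1T by auto
      have "insert ?r (flip i ` W) \<subseteq> {v \<in> Q1 - insert ?s F1. ev v = p}"
      proof
        fix v assume v: "v \<in> insert ?r (flip i ` W)"
        then have "v \<in> Q1" "v \<notin> F1" using W(4) WQ(3) r(1) j(2) by blast+
        moreover have "ev v = p" using v evW r(2) by blast
        moreover have "v \<noteq> ?s" using v sW' by auto
        ultimately show "v \<in> {v \<in> Q1 - insert ?s F1. ev v = p}" by simp
      qed
      then have tr1: "terminals p (Q1 - insert ?s F1 - {}) (?g ` insert ?s W) ?T1"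
        unfolding gW terminals_def using T1 c1 by simp
      have "1 \<le> card (?g ` insert ?s W)" "card (?g ` insert ?s W) \<le> card S - 1"
        unfolding gW using c1 K1 T01 by linarith+
      from sol1D[OF sol2 tr1 this] obtain C1 where C1: "C1 \<subseteq> Q1 - insert ?s F1"
        "linkage (?g ` insert ?s W \<union> {}) ?T1 C1" "2 ^ card J \<le> card C1 + 2 * card (insert ?s F1)"
          by auto
      have sC: "s \<notin> C0 \<union> C1" "?s \<notin> C0 \<union> C1" using False C1 C0 sQ s1 Q by auto
      have "linkage (insert s (S - {s})) (insert ?s (?T0 \<union> W)) ({s, ?s} \<union> C0)"
        using sC by (intro linkage.add ss C0) auto
      then have l0: "linkage S (?T0 \<union> insert ?s W) ({s, ?s} \<union> C0)" using s by (simp add: insert_absorb)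
      have "linkage (S \<union> {}) (?T0 \<union> ?T1) ({s, ?s} \<union> C0 \<union> C1)"
      proof (rule linkage_compose[rotated, OF l0 C1(2)])
        show "({s, ?s} \<union> C0) \<inter> C1 = {}" using C0(1) C1(1) Q sC by auto
        show "?T0 \<inter> insert ?s W = {}" using W sW by auto
        show "inj_on ?g (insert ?s W)" using j(3) sW by (auto simp: inj_on_def)
      qed (use WQ in auto)
      then have "linkage S T ({s, ?s} \<union> (C0 \<union> C1))" using TT by (simp add: Un_assoc)
      then show ?thesis by (rule finish[OF C1(1,3)])
    qed
  qed
qed

end

subsection \<open>Few faults\<close>

text \<open>The symmetric difference: the coordinates in which two vertices differ.\<close>

definition sdiff :: "'a set \<Rightarrow> 'a set \<Rightarrow> 'a set" where
  "sdiff A B = {j. (j \<in> A) \<noteq> (j \<in> B)}"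

lemma mem_sdiff: "j \<in> sdiff A B \<longleftrightarrow> (j \<in> A) \<noteq> (j \<in> B)"
  by (simp add: sdiff_def)

lemma sdiff_eq_empty_iff: "sdiff A B = {} \<longleftrightarrow> A = B"
  by (auto simp: sdiff_def)

lemma sdiff_cube: "A \<in> cube I z \<Longrightarrow> B \<in> cube I z \<Longrightarrow> sdiff A B \<subseteq> I"
  by (auto simp: sdiff_def cube_def)

lemma ev_sdiff:
  assumes "finite A" "finite B"
  shows "ev (sdiff A B) \<longleftrightarrow> (ev A \<longleftrightarrow> ev B)"
proof -
  have "card A = card (A \<inter> B) + card (A - B)" "card B = card (A \<inter> B) + card (B - A)"
    using assms by (metis card_Int_Diff, metis card_Int_Diff Int_commute)
  moreover have "card (sdiff A B) = card (A - B) + card (B - A)"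
    using assms by (subst card_Un_disjoint[symmetric]) (auto simp: sdiff_def intro: arg_cong[where f = card])
  ultimately show ?thesis by presburger
qed

lemma sdiff_singleton: "sdiff A B = {j} \<Longrightarrow> B = flip j A"
  unfolding sdiff_def set_eq_iff by (auto simp: mem_flip)

lemma ex_dim:
  assumes "A \<in> cube I z" "B \<in> cube I z" "A \<noteq> B"
  obtains i where "i \<in> I" "(i \<in> A) \<noteq> (i \<in> B)"
proof -
  have "sdiff A B \<noteq> {}" using assms(3) by (simp add: sdiff_eq_empty_iff)
  then obtain i where i: "i \<in> sdiff A B" by blast
  then have "i \<in> I" using sdiff_cube[OF assms(1,2)] by blast
  moreover have "(i \<in> A) \<noteq> (i \<in> B)" by (rule iffD1[OF mem_sdiff i])
  ultimately show ?thesis by (rule that)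
qed

text \<open>An odd distance of at most two equals one.\<close>

lemma adj_small_cube:
  assumes "A \<in> cube I z" "B \<in> cube I z" "ev A \<noteq> ev B" "finite I" "card I \<le> 2"
  shows "adj A B"
proof -
  have fin: "finite A" "finite B" using assms by (auto intro: cube_finite_mem)
  have "odd (card (sdiff A B))" using ev_sdiff[OF fin] assms(3) by blast
  moreover have "card (sdiff A B) \<le> 2"
    using card_mono[OF assms(4) sdiff_cube[OF assms(1,2)]] assms(5) by simp
  ultimately have "card (sdiff A B) = 1" by presburger
  then obtain j where "sdiff A B = {j}" by (metis card_1_singletonE)
  then have "B = flip j A" by (rule sdiff_singleton)
  then show ?thesis by simp
qed

lemma le_pow: "m \<le> 2 ^ (m - Suc 0)"
  by (cases m) (auto simp: Suc_le_eq)

lemma linkable_cong: "c \<in> cube I z \<Longrightarrow> linkable I c F S T \<longleftrightarrow> linkable I z F S T"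
  by (simp add: linkable_def cube_cong)

lemma halves_ref:
  assumes "finite I" "c \<in> cube I z" "i \<in> I" "F \<subseteq> cube I z"
  shows "halves I c i F"
  using assms(1,3,4) cube_finite_mem[OF assms(2)] by unfold_locales (simp_all add: cube_cong[OF assms(2)])

lemma ex_two:
  assumes "2 \<le> card S"
  obtains x y where "x \<in> S" "y \<in> S" "x \<noteq> y"
proof -
  obtain x where "x \<in> S" using assms by fastforce
  moreover from this have "card (S - {x}) \<noteq> 0" using assms by (cases "finite S") auto
  then have "S - {x} \<noteq> {}" by (metis card.empty)
  then obtain y where "y \<in> S - {x}" by blast
  ultimately show ?thesis using that by blast
qed

text \<open>The last alternative of the final hypothesis is what splitting produces for one pair of
  terminals in dimension \<open>f + 2\<close> with \<open>f \<le> 1\<close>, where the halves have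
  dimension \<open>f + 1\<close>. There the terminals are adjacent, and two vertices already reach
  the bound.\<close>

theorem linkable_few_faults:
  assumes "finite I" "finite z" "F \<subseteq> cube I z" "terminals p (cube I z - F) S T" "1 \<le> card S"
    "card S + card F + 1 \<le> card I \<or> card S = 1 \<and> card F + 1 = card I \<and> card I \<le> 2"
  shows "linkable I z F S T"
  using assms
proof (induction "card I" arbitrary: I z F S T p rule: less_induct)
  case less
  note finI = less.prems(1) and FI = less.prems(3) and tr = less.prems(4) and kc = less.prems(6)
  note ST = terminalsD[OF tr]
  let ?k = "card S"
  have sol: "solvable J c G K {}"
    if "finite J" "card J < card I" "finite c" "G \<subseteq> cube J c"
      "K + card G + 1 \<le> card J \<or> K = 1 \<and> card G + 1 = card J \<and> card J \<le> 2" for J c :: "'a set" and G K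
    unfolding solvable_def
  proof (intro allI impI)
    fix p S T assume *: "terminals p (cube J c - G - {}) S T" "1 \<le> card S" "card S \<le> K"
    then have "card S + card G + 1 \<le> card J \<or> card S = 1 \<and> card G + 1 = card J \<and> card J \<le> 2"
      using that(5) by linarith
    then show "linkable J c G S T" using less.hyps[of J c G p S T] that * by auto
  qed
  have finC: "finite (cube I z)" using finite_cube less.prems by blast
  have finS: "finite S" "finite T" "finite F" using ST FI finC by (auto intro: finite_subset)
  show ?case
  proof (cases "card S + card F + 1 \<le> card I")
    case False
    then have n: "?k = 1" "card F + 1 = card I" "card I \<le> 2" using kc by auto
    obtain s where s: "S = {s}" using n(1) by (rule card_1_singletonE)
    obtain t where t: "T = {t}" using n(1)[unfolded ST(5)] by (rule card_1_singletonE)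
    note st = s t
    have st': "s \<in> cube I z - F" "t \<in> cube I z - F" using ST(1,2) st by auto
    have evst: "ev s \<noteq> ev t" using ST(3)[of s] ST(4)[of t] st by simp
    then have "s \<noteq> t" by blast
    have "adj s t"
      using adj_small_cube[OF _ _ evst finI n(3)] st' by blast
    then have "linkage S T {s, t}" unfolding st
      using linkage_single[OF path_on.step[OF path_on.single[of t], of s]] \<open>s \<noteq> t\<close> by simp
    moreover have "card {s, t} = 2" using \<open>s \<noteq> t\<close> by simp
    moreover have "(2::nat) ^ card I \<le> 2 + 2 * card F"
    proof -
      have "card I = 1 \<or> card I = 2" using n by linarith
      then show ?thesis using n by auto
    qed
    moreover have "{s, t} \<subseteq> cube I z - F" using st' by blast
    ultimately show ?thesis unfolding linkable_def by (intro exI[of _ "{s, t}"]) auto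
  next
    case n: True
    have I2: "2 \<le> card I" using n less.prems(5) by linarith
    \<comment> \<open>The bounds on \<open>K0\<close> and \<open>K1\<close> are those of the theorem
      for dimension \<open>card I - 1\<close>: hence \<open>+ 2\<close> in place of
      \<open>+ 1\<close>, and \<open>3\<close> in place of \<open>2\<close>.\<close>
    have main: "linkable I z F S T" if c: "c \<in> cube I z" and i: "i \<in> I"
      and K: "1 \<le> K0" "1 \<le> K1" "K0 \<le> ?k" "K1 \<le> ?k"
        "K0 + card (F \<inter> cube (I - {i}) c) + 2 \<le> card I \<or> K0 = 1 \<and> card (F \<inter> cube (I - {i}) c) + 2 = card I \<and> card I \<le> 3"
        "K1 + card (F \<inter> cube (I - {i}) (flip i c)) + 2 \<le> card I \<or> K1 = 1 \<and> card (F \<inter> cube (I - {i}) (flip i c)) + 2 = card I \<and> card I \<le> 3"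
        "card (S \<inter> cube (I - {i}) c) \<le> K0" "card (T \<inter> cube (I - {i}) c) \<le> K0"
        "card (S \<inter> cube (I - {i}) (flip i c)) \<le> K1" "card (T \<inter> cube (I - {i}) (flip i c)) \<le> K1"
      for c i K0 K1
    proof -
      interpret h: halves I c i F by (rule halves_ref[OF finI c i FI])
      note defs = h.Q0_def h.Q1_def h.J_def
      have fc: "finite (flip i c)" using h.finz by simp
      have s0: "solvable h.J c h.F0 K0 {}"
        by (rule sol) (use h.fJ h.finz h.F01(3) K(5) in \<open>auto simp: h.F0_def defs\<close>)
      have s1: "solvable h.J (flip i c) h.F1 K1 {}"
        by (rule sol) (use h.fJ fc h.F01(4) K(6) in \<open>auto simp: h.F1_def defs\<close>)
      have J: "card h.J + 1 = card I" using h.fJ by simp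
      have ne: "h.J \<noteq> {}" using J I2 by auto
      have "card F + card S \<le> card h.J" using n J by linarith
      also have "\<dots> \<le> 2 ^ (card h.J - 1)" using le_pow by simp
      finally have le: "card F + card ({}::'a set set) + card ({}::'a set set) + card S \<le> 2 ^ (card h.J - 1)" by simp
      have tr': "terminals p (cube I c - F) S T" using tr cube_cong[OF c] by simp
      have "linkable I c F S T"
        by (rule h.split[OF s0 s1 tr' _ _ _ ne less.prems(5) K(1,2) _ _ _ _ le])
          (use K in \<open>simp_all add: defs\<close>)
      then show ?thesis using linkable_cong[OF c] by blast
    qed
    have ref: "F \<inter> cube (I - {i}) c = {v \<in> F. (i \<in> v) = (i \<in> c)}"
      "F \<inter> cube (I - {i}) (flip i c) = {v \<in> F. (i \<in> v) \<noteq> (i \<in> c)}"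
      "S \<inter> cube (I - {i}) c = {v \<in> S. (i \<in> v) = (i \<in> c)}"
      "S \<inter> cube (I - {i}) (flip i c) = {v \<in> S. (i \<in> v) \<noteq> (i \<in> c)}"
      "T \<inter> cube (I - {i}) c = {v \<in> T. (i \<in> v) = (i \<in> c)}"
      "T \<inter> cube (I - {i}) (flip i c) = {v \<in> T. (i \<in> v) \<noteq> (i \<in> c)}"
      if c: "c \<in> cube I z" and i: "i \<in> I" for c i
      unfolding cube_remove[OF i, of c] flip_cube_remove[OF i, of c] cube_cong[OF c]
      using FI ST(1,2) by fast+
    have leS: "card {v \<in> S. P v} \<le> card S" "card {v \<in> T. P v} \<le> card S" for P
      unfolding ST(5) unfolding ST(5)[symmetric]
      by (rule card_mono[OF finS(1)], blast) (simp add: ST(5) card_mono[OF finS(2)])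
    have ltS: "card {v \<in> X. P v} \<le> card X - 1" if "finite X" "x \<in> X" "\<not> P x" for P X and x :: "'a set"
    proof -
      have "{v \<in> X. P v} \<subset> X" using that(2,3) by blast
      then have "card {v \<in> X. P v} < card X" by (rule psubset_card_mono[OF that(1)])
      then show ?thesis by linarith
    qed
    \<comment> \<open>All sinks and all faults lie in the half of \<open>c\<close>, while the
      sources lie on both sides. The shift is applied with sources and sinks exchanged; the half
      into which it crosses has no faults to obstruct it.\<close>
    have shf: "linkable I z F S T"
      if c: "c \<in> cube I z" and i: "i \<in> I" and t: "t \<in> T"
        and agree: "\<And>v. v \<in> T \<union> F \<Longrightarrow> (i \<in> v) = (i \<in> c)"
        and x: "x \<in> S" "(i \<in> x) = (i \<in> c)" and y: "y \<in> S" "(i \<in> y) \<noteq> (i \<in> c)" for c i t x y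
    proof -
      interpret h: halves I c i F by (rule halves_ref[OF finI c i FI])
      have J: "card h.J + 1 = card I" "card h.J < card I" using h.fJ by auto
      have FTQ: "T \<union> F \<subseteq> h.Q0"
      proof
        fix v assume v: "v \<in> T \<union> F"
        then have "v \<in> cube I c" using ST(2) FI cube_cong[OF c] by blast
        then show "v \<in> h.Q0" using h.Q0_iff agree[OF v] by simp
      qed
      have F01: "h.F0 = F" "h.F1 = {}"
        unfolding h.F0_def h.F1_def using FTQ h.Q(2) by blast+
      have SQ: "S \<inter> h.Q0 \<noteq> {}" "S \<inter> h.Q1 \<noteq> {}"
        using x y ST(1) cube_cong[OF c] h.Q0_iff[of x] h.Q1_iff[of y] by blast+
      have fin': "finite h.J" "finite c" "finite (flip i c)" using h.fJ h.finz by simp_all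
      have tQ: "flip i t \<in> h.Q1" using FTQ t h.flipQ by blast
      have "x \<noteq> y" using x y by blast
      then have k2: "2 \<le> ?k" using card_mono[OF finS(1), of "{x, y}"] x(1) y(1) by simp
      have s0: "solvable h.J c h.F0 (card T - 1) {}"
        by (rule sol[OF fin'(1) J(2) fin'(2)]) (use F01 FTQ n J k2 ST(5) in \<open>auto simp: h.Q0_def\<close>)
      have s1: "solvable h.J (flip i c) h.F1 (card T - 1) {}"
        by (rule sol[OF fin'(1) J(2) fin'(3)]) (use F01 n J k2 ST(5) in auto)
      have F1: "1 \<le> card F" if "h.F0 \<noteq> {}"
        using that finS(3) unfolding F01 by (simp add: Suc_leI card_gt_0_iff)
      have s2: "solvable h.J (flip i c) (insert (flip i t) h.F1) (card T - 1) {}" if "h.F0 \<noteq> {}"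
        by (rule sol[OF fin'(1) J(2) fin'(3)])
          (use F01(2) n J k2 ST(5) tQ F1[OF that] in \<open>auto simp: h.Q1_def\<close>)
      have tr': "terminals (\<not> p) (cube I c - F) T S" using terminals_sym[OF tr] cube_cong[OF c] by simp
      have "card F + card T \<le> card h.J" using n J ST(5) by linarith
      also have "\<dots> \<le> 2 ^ (card h.J - 1)" using le_pow by simp
      finally have le: "card F + card ({}::'a set set) + card T \<le> 2 ^ (card h.J - 1)" by simp
      have le2: "card h.F1 + card T \<le> card h.J + 1" using n J ST(5) F01 by simp
      have TQ: "T \<subseteq> h.Q0" using FTQ by blast
      have "linkable I c F T S"
        by (rule h.shift[OF tr' t TQ SQ s0 _ _ s1 s2 _ _ le le2]) (use F01(2) in simp_all)
      then show ?thesis using linkable_cong[OF c] linkable_sym by blast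
    qed
    consider "2 \<le> card F" | "card F \<le> 1" "?k = 1" | "card F = 0" "2 \<le> ?k" | "card F = 1" "2 \<le> ?k"
      using less.prems(5) by linarith
    then show ?thesis
    proof cases
      \<comment> \<open>A coordinate separating two faults leaves at most \<open>card F - 1\<close>
        of them in each half, enough for all \<open>k\<close> paths.\<close>
      case 1
      then obtain x y where xy: "x \<in> F" "y \<in> F" "x \<noteq> y" by (rule ex_two)
      have x: "x \<in> cube I z" "y \<in> cube I z" using xy FI by auto
      obtain i where i: "i \<in> I" "(i \<in> x) \<noteq> (i \<in> y)" using ex_dim[OF x xy(3)] .
      note x = x(1)
      have "card {v \<in> F. (i \<in> v) = (i \<in> x)} \<le> card F - 1" "card {v \<in> F. (i \<in> v) \<noteq> (i \<in> x)} \<le> card F - 1"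
        using ltS[OF finS(3) xy(2), of "\<lambda>v. (i \<in> v) = (i \<in> x)"] ltS[OF finS(3) xy(1), of "\<lambda>v. (i \<in> v) \<noteq> (i \<in> x)"] i by auto
      then show ?thesis
        using n 1 less.prems(5) leS by (intro main[OF x i(1), of ?k ?k]) (auto simp: ref[OF x i(1)])
    next
      case 2
      obtain s where st1: "S = {s}" using 2(2) by (rule card_1_singletonE)
      obtain t where st2: "T = {t}" using 2(2)[unfolded ST(5)] by (rule card_1_singletonE)
      note st = st1 st2
      have s: "s \<in> cube I z" "t \<in> cube I z" "s \<noteq> t" using st ST(1,2,6) by auto
      obtain i where i: "i \<in> I" "(i \<in> s) \<noteq> (i \<in> t)" using ex_dim[OF s] .
      note s = s(1)
      have "card {v \<in> F. (i \<in> v) = (i \<in> s)} \<le> card F" "card {v \<in> F. (i \<in> v) \<noteq> (i \<in> s)} \<le> card F"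
        using finS by (auto intro: card_mono)
      then show ?thesis
        using n 2 leS by (intro main[OF s i(1), of 1 1]) (auto simp: ref[OF s i(1)])
    next
      case 3
      then have F: "F = {}" using finS by simp
      obtain x y where xy: "x \<in> S" "y \<in> S" "x \<noteq> y" using 3(2) by (rule ex_two)
      then have "x \<in> cube I z" "y \<in> cube I z" using ST(1) by auto
      then obtain i where i: "i \<in> I" "(i \<in> x) \<noteq> (i \<in> y)" using ex_dim xy(3) by meson
      have "T \<noteq> {}" using 3(2) ST(5) by auto
      then obtain c where cT: "c \<in> T" by blast
      then have c: "c \<in> cube I z" using ST(2) by auto
      obtain x' where x': "x' \<in> S" "(i \<in> x') = (i \<in> c)" using xy i by metis
      obtain y' where y': "y' \<in> S" "(i \<in> y') \<noteq> (i \<in> c)" using xy i by metis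
      have lS: "card {v \<in> S. (i \<in> v) = (i \<in> c)} \<le> ?k - 1" "card {v \<in> S. (i \<in> v) \<noteq> (i \<in> c)} \<le> ?k - 1"
        using ltS[OF finS(1) y'(1), of "\<lambda>v. (i \<in> v) = (i \<in> c)"] ltS[OF finS(1) x'(1), of "\<lambda>v. (i \<in> v) \<noteq> (i \<in> c)"] x' y'
        by auto
      show ?thesis
      proof (cases "\<exists>t\<in>T. (i \<in> t) \<noteq> (i \<in> c)")
        case True
        then obtain t where t: "t \<in> T" "(i \<in> t) \<noteq> (i \<in> c)" by blast
        have "card {v \<in> T. (i \<in> v) = (i \<in> c)} \<le> ?k - 1" "card {v \<in> T. (i \<in> v) \<noteq> (i \<in> c)} \<le> ?k - 1"
          using ltS[OF finS(2) t(1), of "\<lambda>v. (i \<in> v) = (i \<in> c)"] ltS[OF finS(2) cT, of "\<lambda>v. (i \<in> v) \<noteq> (i \<in> c)"] t ST(5)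
          by auto
        then show ?thesis
          using n 3 F lS by (intro main[OF c i(1), of "?k - 1" "?k - 1"]) (auto simp: ref[OF c i(1)])
      next
        case False
        then show ?thesis using shf[OF c i(1) cT _ x' y'] F by blast
      qed
    next
      case 4
      obtain c where F: "F = {c}" using 4(1) by (rule card_1_singletonE)
      have c: "c \<in> cube I z" using F FI by auto
      \<comment> \<open>The half containing the fault can carry only \<open>k - 1\<close> paths, the
        other one all \<open>k\<close>. So a source and a sink on the side away from
        \<open>c\<close> suffice.\<close>
      show ?thesis
      proof (cases "\<exists>i\<in>I. (\<exists>s\<in>S. (i \<in> s) \<noteq> (i \<in> c)) \<and> (\<exists>t\<in>T. (i \<in> t) \<noteq> (i \<in> c))")
        case True
        then obtain i s t where i: "i \<in> I" "s \<in> S" "(i \<in> s) \<noteq> (i \<in> c)" "t \<in> T" "(i \<in> t) \<noteq> (i \<in> c)" by blast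
        have "card {v \<in> S. (i \<in> v) = (i \<in> c)} \<le> ?k - 1" "card {v \<in> T. (i \<in> v) = (i \<in> c)} \<le> ?k - 1"
          using ltS[OF finS(1) i(2), of "\<lambda>v. (i \<in> v) = (i \<in> c)"] ltS[OF finS(2) i(4), of "\<lambda>v. (i \<in> v) = (i \<in> c)"] i(3,5) ST(5)
          by simp_all
        moreover have "card {v \<in> F. (i \<in> v) = (i \<in> c)} = 1"
        proof -
          have *: "{v \<in> F. (i \<in> v) = (i \<in> c)} = {c}" unfolding F by blast
          show ?thesis unfolding * by simp
        qed
        moreover have "card {v \<in> F. (i \<in> v) \<noteq> (i \<in> c)} = 0"
        proof -
          have *: "{v \<in> F. (i \<in> v) \<noteq> (i \<in> c)} = {}" unfolding F by blast
          show ?thesis unfolding * by simp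
        qed
        ultimately show ?thesis
          using n 4 by (intro main[OF c i(1), of "?k - 1" ?k]) (simp_all add: ref[OF c i(1)] leS del: One_nat_def)
      next
        case False
        obtain x y where xy: "x \<in> S" "y \<in> S" "x \<noteq> y" using 4(2) by (rule ex_two)
        then have "x \<in> cube I z" "y \<in> cube I z" using ST(1) by auto
      then obtain i where i: "i \<in> I" "(i \<in> x) \<noteq> (i \<in> y)" using ex_dim xy(3) by meson
        obtain x' where x': "x' \<in> S" "(i \<in> x') = (i \<in> c)" using xy i by metis
        obtain y' where y': "y' \<in> S" "(i \<in> y') \<noteq> (i \<in> c)" using xy i by metis
        have "T \<noteq> {}" using 4(2) ST(5) by auto
        then obtain t where t: "t \<in> T" by blast
        show ?thesis by (rule shf[OF c i(1) t _ x' y']) (use False F i(1) y' in blast)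
      qed
    qed
  qed
qed

lemma solvable_few_faults:
  assumes "finite I" "finite z" "F \<subseteq> cube I z" "K + card F + 1 \<le> card I"
  shows "solvable I z F K {}"
  unfolding solvable_def
proof (intro allI impI)
  fix p S T assume *: "terminals p (cube I z - F - {}) S T" "1 \<le> card S" "card S \<le> K"
  have "card S + card F + 1 \<le> card I" using *(3) assms(4) by linarith
  then show "linkable I z F S T" using linkable_few_faults[OF assms(1-3), of p S T] * by simp
qed

subsection \<open>Three faults in dimension four\<close>

definition faulty_degree :: "'a set \<Rightarrow> 'a set set \<Rightarrow> 'a set \<Rightarrow> nat" where
  "faulty_degree I F v = card {i \<in> I. flip i v \<in> F}"

text \<open>
  The remaining small cases are settled by a depth-first search on words of bits, which encode
  vertices relative to \<open>c\<close>; a binary tree holds the visited words, and unary numbers (lists of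
  units) bound the recursion depth and the length still required.
\<close>

fun dec :: "'a set \<Rightarrow> 'a list \<Rightarrow> bool list \<Rightarrow> 'a set" where
  "dec c (d # ds) (b # bs) = (if b then flip d (dec c ds bs) else dec c ds bs)"
| "dec c _ _ = c"

fun nbrs :: "bool list \<Rightarrow> bool list list" where
  "nbrs [] = []"
| "nbrs (b # bs) = ((\<not> b) # bs) # map (Cons b) (nbrs bs)"

fun par :: "bool list \<Rightarrow> bool" where
  "par [] = False"
| "par (b # bs) = (b \<noteq> par bs)"

fun words :: "'a list \<Rightarrow> bool list list" where
  "words [] = [[]]"
| "words (x # xs) = map (Cons False) (words xs) @ map (Cons True) (words xs)"

lemma set_words: "set (words xs) = {bs. length bs = length xs}"
proof (induction xs)
  case (Cons x xs)
  then show ?case by (auto simp: length_Suc_conv image_iff)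
qed simp

lemma words_Cons: "\<exists>ws. words xs = replicate (length xs) False # ws"
  by (induction xs) auto

lemma set_words_tl: "set (words xs) = insert (replicate (length xs) False) (set (tl (words xs)))"
  using words_Cons[of xs] by auto

lemma length_nbrs: "w \<in> set (nbrs bs) \<Longrightarrow> length w = length bs"
  by (induction bs arbitrary: w rule: nbrs.induct) auto

lemma adj_flip_flip: "adj A B \<Longrightarrow> adj (flip d A) (flip d B)"
  unfolding adj_def by (metis flip_commute)

lemma adj_dec: "length bs = length ds \<Longrightarrow> w \<in> set (nbrs bs) \<Longrightarrow> adj (dec c ds bs) (dec c ds w)"
proof (induction ds arbitrary: bs w)
  case (Cons d ds)
  then obtain b bs' where bs: "bs = b # bs'" "length bs' = length ds" by (cases bs) auto
  consider "w = (\<not> b) # bs'" | w' where "w = b # w'" "w' \<in> set (nbrs bs')"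
    using Cons.prems(2) bs by auto
  then show ?case
  proof cases
    case 1
    then show ?thesis using bs by simp
  next
    case 2
    then show ?thesis using bs Cons.IH[of bs' w'] by (simp add: adj_flip_flip)
  qed
qed simp

lemma dec_image: "distinct ds \<Longrightarrow> finite c \<Longrightarrow> dec c ds ` {bs. length bs = length ds} = cube (set ds) c"
proof (induction ds)
  case Nil
  then show ?case by (simp add: cube_empty)
next
  case (Cons d ds)
  let ?B = "{bs :: bool list. length bs = length ds}"
  have "dec c (d # ds) ` {bs. length bs = length (d # ds)} = dec c ds ` ?B \<union> flip d ` dec c ds ` ?B"
  proof (intro equalityI subsetI)
    fix v assume "v \<in> dec c (d # ds) ` {bs. length bs = length (d # ds)}"
    then obtain b bs where "length bs = length ds" "v = dec c (d # ds) (b # bs)"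
      by (auto simp: length_Suc_conv)
    then show "v \<in> dec c ds ` ?B \<union> flip d ` dec c ds ` ?B" by (cases b) auto
  next
    fix v assume "v \<in> dec c ds ` ?B \<union> flip d ` dec c ds ` ?B"
    then consider bs where "length bs = length ds" "v = dec c (d # ds) (False # bs)"
      | bs where "length bs = length ds" "v = dec c (d # ds) (True # bs)" by auto
    then show "v \<in> dec c (d # ds) ` {bs. length bs = length (d # ds)}"
      by cases (rule image_eqI, assumption, simp)+
  qed
  also have "\<dots> = cube (set ds) c \<union> cube (set ds) (flip d c)"
    using Cons flip_image_cube[of d "set ds" c] by simp
  also have "\<dots> = cube (set (d # ds)) c"
    using cube_split(1)[of d "set (d # ds)" c] Cons.prems by simp
  finally show ?case .
qed

lemma inj_dec:
  assumes "distinct ds" "finite c"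
  shows "inj_on (dec c ds) {bs. length bs = length ds}"
proof (rule eq_card_imp_inj_on)
  have B: "card {bs :: bool list. length bs = length ds} = 2 ^ length ds"
    "finite {bs :: bool list. length bs = length ds}"
    using card_lists_length_eq[of "UNIV :: bool set" "length ds"]
      finite_lists_length_eq[of "UNIV :: bool set" "length ds"] by auto
  then show "finite {bs :: bool list. length bs = length ds}" by simp
  show "card (dec c ds ` {bs. length bs = length ds}) = card {bs :: bool list. length bs = length ds}"
    unfolding dec_image[OF assms] B(1) card_cube[OF finite_set assms(2)]
    using distinct_card[OF assms(1)] by simp
qed

lemma ev_dec: "finite c \<Longrightarrow> length bs = length ds \<Longrightarrow> ev (dec c ds bs) \<longleftrightarrow> ev c \<noteq> par bs"
proof (induction ds arbitrary: bs)
  case (Cons d ds)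
  then obtain b bs' where bs: "bs = b # bs'" "length bs' = length ds" by (cases bs) auto
  have fin: "finite (dec c ds bs)" for bs
    using Cons.prems(1) by (induction c ds bs rule: dec.induct) auto
  show ?case using Cons.IH[OF Cons.prems(1) bs(2)] ev_flip[OF fin[of bs'], of d] bs by auto
qed simp

section \<open>Depth-first search and its soundness\<close>

datatype vtree = Leaf bool | Branch vtree vtree

fun look :: "vtree \<Rightarrow> bool list \<Rightarrow> bool" where
  "look (Branch l r) (b # bs) = look (if b then r else l) bs"
| "look (Leaf b) [] = b"
| "look _ _ = False"

fun mark :: "vtree \<Rightarrow> bool list \<Rightarrow> vtree" where
  "mark (Branch l r) (b # bs) = (if b then Branch l (mark r bs) else Branch (mark l bs) r)"
| "mark _ _ = Leaf True"

fun full :: "'a list \<Rightarrow> vtree" where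
  "full [] = Leaf False"
| "full (x # xs) = Branch (full xs) (full xs)"

fun depth :: "nat \<Rightarrow> vtree \<Rightarrow> bool" where
  "depth 0 (Leaf b) = True"
| "depth (Suc n) (Branch l r) = (depth n l \<and> depth n r)"
| "depth _ _ = False"

lemma depth_full: "depth (length xs) (full xs)"
  by (induction xs) auto

lemma depth_mark: "depth (length bs) t \<Longrightarrow> depth (length bs) (mark t bs)"
proof (induction bs arbitrary: t)
  case Nil
  then show ?case by (cases t) auto
next
  case (Cons b bs)
  then show ?case by (cases t) auto
qed

lemma look_mark: "depth (length bs) t \<Longrightarrow> length w = length bs \<Longrightarrow> look (mark t bs) w \<longleftrightarrow> w = bs \<or> look t w"
proof (induction bs arbitrary: t w)
  case Nil
  then show ?case by (cases t) auto
next
  case (Cons b bs)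
  then obtain l r where t: "t = Branch l r" by (cases t) auto
  obtain a w' where w: "w = a # w'" "length w' = length bs" using Cons.prems(2) by (cases w) auto
  show ?case using Cons.IH[of l w'] Cons.IH[of r w'] Cons.prems t w by (cases a; cases b) auto
qed

text \<open>A conditional makes evaluation stop at the first success.\<close>

primrec some :: "('a \<Rightarrow> bool) \<Rightarrow> 'a list \<Rightarrow> bool" where
  "some P [] = False"
| "some P (x # xs) = (if P x then True else some P xs)"

lemma some_iff: "some P xs \<longleftrightarrow> (\<exists>x\<in>set xs. P x)"
  by (induction xs) auto

text \<open>The end word itself counts as a vertex, so on reaching it at most one may still be
  required. As \<open>tl\<close> stays at the empty list, paths longer than required are accepted;
  exhausted fuel counts as failure.\<close>

primrec dfs :: "unit list \<Rightarrow> unit list \<Rightarrow> bool list \<Rightarrow> vtree \<Rightarrow> bool list \<Rightarrow> bool" where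
  "dfs [] k t used v = False"
| "dfs (x # fuel) k t used v =
     (if look used v then False else if v = t then tl k = []
      else some (dfs fuel (tl k) t (mark used v)) (nbrs v))"

lemma dfs_sound:
  assumes ds: "distinct ds" "finite c"
  shows "dfs fuel k t used v \<Longrightarrow> depth (length ds) used \<Longrightarrow> length v = length ds \<Longrightarrow>
    \<exists>C \<subseteq> {bs. length bs = length ds}. path_on (dec c ds v) (dec c ds t) (dec c ds ` C) \<and> v \<in> C \<and> t \<in> C \<and>
      (\<forall>w\<in>C. \<not> look used w) \<and> length k \<le> card C"
proof (induction fuel arbitrary: k used v)
  case (Cons x fuel)
  have nl: "\<not> look used v" using Cons.prems(1) by (auto split: if_splits)
  show ?case
  proof (cases "v = t")
    case True
    then have "tl k = []" using Cons.prems(1) nl by simp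
    then have "length k \<le> 1" by (cases k) auto
    then show ?thesis
      using True nl Cons.prems(3) by (intro exI[of _ "{v}"]) (auto intro: path_on.single)
  next
    case False
    then obtain w where w: "w \<in> set (nbrs v)" "dfs fuel (tl k) t (mark used v) w"
      using Cons.prems(1) nl by (auto simp: some_iff)
    have lw: "length w = length ds" using length_nbrs[OF w(1)] Cons.prems(3) by simp
    have dm: "depth (length ds) (mark used v)" using depth_mark[of v used] Cons.prems(2,3) by simp
    obtain C where C: "C \<subseteq> {bs. length bs = length ds}" "path_on (dec c ds w) (dec c ds t) (dec c ds ` C)"
      "w \<in> C" "t \<in> C" "\<forall>u\<in>C. \<not> look (mark used v) u" "length (tl k) \<le> card C"
      using Cons.IH[OF w(2) dm lw] by blast
    have nlC: "u \<noteq> v \<and> \<not> look used u" if "u \<in> C" for u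
      using C(1,5) that look_mark[of v used u] Cons.prems(2,3) by auto
    have fC: "finite C"
      using C(1) finite_lists_length_eq[of "UNIV :: bool set" "length ds"] by (auto intro: finite_subset)
    have "dec c ds v \<notin> dec c ds ` C"
    proof
      assume "dec c ds v \<in> dec c ds ` C"
      then obtain u where u: "u \<in> C" "dec c ds v = dec c ds u" by blast
      then have "v = u" using inj_onD[OF inj_dec[OF ds] u(2)] C(1) Cons.prems(3) by auto
      then show False using nlC u by blast
    qed
    then have "path_on (dec c ds v) (dec c ds t) (insert (dec c ds v) (dec c ds ` C))"
      using path_on.step[OF C(2) adj_dec[OF Cons.prems(3) w(1)]] by blast
    moreover have "v \<notin> C" using nlC by blast
    then have "length k \<le> card (insert v C)"
      using C(6) fC by (cases k) auto
    ultimately show ?thesis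
      using C nl nlC Cons.prems(3) by (intro exI[of _ "insert v C"]) auto
  qed
qed simp

primrec marks :: "bool list list \<Rightarrow> vtree \<Rightarrow> vtree" where
  "marks [] u = u"
| "marks (w # ws) u = mark (marks ws u) w"

lemma depth_marks: "\<forall>w\<in>set ws. length w = n \<Longrightarrow> depth n u \<Longrightarrow> depth n (marks ws u)"
  by (induction ws) (auto simp: depth_mark)

lemma look_marks:
  "\<forall>w\<in>set ws. length w = n \<Longrightarrow> depth n u \<Longrightarrow> length x = n \<Longrightarrow> look (marks ws u) x \<longleftrightarrow> x \<in> set ws \<or> look u x"
  by (induction ws) (auto simp: look_mark depth_marks)

lemma dfs_avoid:
  assumes ds: "distinct ds" "finite c" and len: "length us = length ds" "length s = length ds"
    and ws: "\<forall>w\<in>set ws. length w = length ds"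
    and run: "dfs fuel k t (marks ws (full us)) s"
  shows "\<exists>C \<subseteq> cube (set ds) c. path_on (dec c ds s) (dec c ds t) C \<and> length k \<le> card C \<and>
    (\<forall>v\<in>C. \<forall>w\<in>set ws. v \<noteq> dec c ds w)"
proof -
  let ?B = "{bs :: bool list. length bs = length ds}"
  have d: "depth (length ds) (full us)" using depth_full[of us] len by simp
  obtain C where C: "C \<subseteq> ?B" "path_on (dec c ds s) (dec c ds t) (dec c ds ` C)"
    "\<forall>w\<in>C. \<not> look (marks ws (full us)) w" "length k \<le> card C"
    using dfs_sound[OF ds run depth_marks[OF ws d] len(2)] by blast
  have "dec c ds v \<noteq> dec c ds w" if "v \<in> C" "w \<in> set ws" for v w
  proof
    assume "dec c ds v = dec c ds w"
    then have "v = w" using inj_onD[OF inj_dec[OF ds]] C(1) ws that by auto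
    then show False using look_marks[OF ws d, of w] C(3) that ws by auto
  qed
  moreover have "card (dec c ds ` C) = card C"
    using inj_dec[OF ds] C(1) by (meson card_image inj_on_subset)
  moreover have "dec c ds ` C \<subseteq> cube (set ds) c"
    using C(1) unfolding dec_image[OF ds, symmetric] by (rule image_mono)
  ultimately show ?thesis
    using C by (intro exI[of _ "dec c ds ` C"]) auto
qed

primrec all_pairs :: "('a \<Rightarrow> 'a \<Rightarrow> bool) \<Rightarrow> 'a list \<Rightarrow> bool" where
  "all_pairs P [] = True"
| "all_pairs P (x # xs) = (list_all (P x) xs \<and> all_pairs P xs)"

lemma all_pairsD: "all_pairs P xs \<Longrightarrow> x \<in> set xs \<Longrightarrow> y \<in> set xs \<Longrightarrow> x \<noteq> y \<Longrightarrow> P x y \<or> P y x"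
  by (induction xs) (auto simp: list_all_iff)

text \<open>The four-dimensional cube has \<open>16\<close> vertices, which bounds the recursion
  depth, and \<open>10 = 2 ^ 4 - 2 * 3\<close> is the length required with three faults.\<close>

primrec all_ends :: "bool list list \<Rightarrow> vtree \<Rightarrow> bool list \<Rightarrow> bool" where
  "all_ends [] used s = True"
| "all_ends (t # ts) used s =
    (if dfs (replicate 16 ()) (replicate 10 ()) t used s then all_ends ts used s else False)"

lemma all_ends_iff:
  "all_ends ts used s \<longleftrightarrow> (\<forall>t\<in>set ts. dfs (replicate 16 ()) (replicate 10 ()) t used s)"
  by (induction ts) auto

definition live :: "bool list \<Rightarrow> bool list \<Rightarrow> bool list \<Rightarrow> bool list \<Rightarrow> bool" where
  "live f g h v \<longleftrightarrow> v \<noteq> f \<and> v \<noteq> g \<and> v \<noteq> h \<and>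
     \<not> (f \<in> set (nbrs v) \<and> g \<in> set (nbrs v) \<and> h \<in> set (nbrs v))"

definition check :: "bool list list \<Rightarrow> bool list \<Rightarrow> bool list \<Rightarrow> bool list \<Rightarrow> bool" where
  "check vs f g h = list_all
     (all_ends (filter (\<lambda>v. par v \<and> live f g h v) vs) (marks [f, g, h] (full [(),(),(),()])))
     (filter (\<lambda>v. \<not> par v \<and> live f g h v) vs)"

text \<open>By translation, one of the three faults may be taken to be the origin.\<close>

lemma check_all: "all_pairs (check (words [(),(),(),()]) [False,False,False,False]) (tl (words [(),(),(),()]))"
  by code_simp

text \<open>This is the case \<open>n = 4\<close>, \<open>k = 1\<close>, \<open>f = 3\<close>, the
  only one below dimension five that the few-faults theorem does not cover.\<close>

lemma ex_path_dim_4: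
  assumes I: "finite I" "card I = 4" and F: "F \<subseteq> cube I z" "card F = 3"
    and st: "s \<in> cube I z - F" "t \<in> cube I z - F" "ev s \<noteq> ev t" "faulty_degree I F s \<le> 2" "faulty_degree I F t \<le> 2"
  shows "\<exists>C \<subseteq> cube I z - F. path_on s t C \<and> 10 \<le> card C"
proof -
  obtain c x y where Fc: "F = {c, x, y}" "c \<noteq> x" "c \<noteq> y" "x \<noteq> y"
    using F(2) by (auto simp: card_3_iff)
  have cI: "c \<in> cube I z" using Fc F by auto
  have fc: "finite c" using cube_finite_mem[OF cI] .
  have cube: "cube I c = cube I z" using cube_cong[OF cI] .
  obtain ds where ds: "distinct ds" "set ds = I" using finite_distinct_list[OF I(1)] by blast
  have len: "length ds = 4" using distinct_card[OF ds(1)] ds(2) I(2) by simp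
  let ?B = "{bs :: bool list. length bs = 4}" and ?d = "dec c ds"
  let ?ws = "words [(),(),(),()]"
  have img: "?d ` ?B = cube I z" using dec_image[OF ds(1) fc] ds(2) len cube by simp
  have inj: "inj_on ?d ?B" using inj_dec[OF ds(1) fc] len by simp
  have ws: "set ?ws = ?B" by (simp add: set_words numeral_eq_Suc del: words.simps)
  let ?f = "[False,False,False,False]"
  obtain d1 d2 d3 d4 where "ds = [d1, d2, d3, d4]"
    using len by (auto simp: length_Suc_conv numeral_eq_Suc)
  then have f: "?d ?f = c" by simp
  have code: "\<exists>b\<in>?B. ?d b = v" if "v \<in> cube I z" for v
  proof -
    have "v \<in> ?d ` ?B" using that by (simp only: img)
    then obtain b where "v = ?d b" "b \<in> ?B" by (rule imageE)
    then show ?thesis by blast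
  qed
  obtain g where g: "g \<in> ?B" "?d g = x" using code[of x] Fc F by auto
  obtain h where h: "h \<in> ?B" "?d h = y" using code[of y] Fc F by auto
  have wtl: "set ?ws = insert ?f (set (tl ?ws))" using set_words_tl[of "[(),(),(),()]"] by simp
  have tl: "b \<in> set (tl ?ws)" if "b \<in> ?B" "?d b \<noteq> c" for b
  proof -
    have "b \<in> insert ?f (set (tl ?ws))" using that(1) by (simp only: ws wtl[symmetric])
    moreover have "b \<noteq> ?f" using that(2) f by auto
    ultimately show ?thesis by (simp only: insert_iff simp_thms)
  qed
  have tl: "g \<in> set (tl ?ws)" "h \<in> set (tl ?ws)" "g \<noteq> h"
  proof -
    show "g \<in> set (tl ?ws)" by (rule tl[OF g(1)]) (use g(2) Fc(2) in simp)
    show "h \<in> set (tl ?ws)" by (rule tl[OF h(1)]) (use h(2) Fc(3) in simp)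
    show "g \<noteq> h" using g(2) h(2) Fc(4) by blast
  qed
  have main: "\<exists>C \<subseteq> cube I z - F. path_on s t C \<and> 10 \<le> card C"
    if gh: "check ?ws ?f g h" "g \<in> ?B" "h \<in> ?B" "F = {c, ?d g, ?d h}"
      and st: "s \<in> cube I z - F" "t \<in> cube I z - F" "ev s = ev c" "ev t \<noteq> ev c" "faulty_degree I F s \<le> 2" "faulty_degree I F t \<le> 2"
    for g h s t
  proof -
    obtain s' where s': "s' \<in> ?B" "?d s' = s" using code[of s] st by auto
    obtain t' where t': "t' \<in> ?B" "?d t' = t" using code[of t] st by auto
    have live: "live ?f g h v" if v: "v \<in> ?B" "?d v \<notin> F" "faulty_degree I F (?d v) \<le> 2" for v
    proof -
      have "\<not> (?f \<in> set (nbrs v) \<and> g \<in> set (nbrs v) \<and> h \<in> set (nbrs v))"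
      proof
        assume *: "?f \<in> set (nbrs v) \<and> g \<in> set (nbrs v) \<and> h \<in> set (nbrs v)"
        have lv: "length v = length ds" using v len by simp
        have "adj (?d v) w" if "w \<in> F" for w
          using adj_dec[OF lv, of ?f c] adj_dec[OF lv, of g c] adj_dec[OF lv, of h c] * that gh(4) f by auto
        moreover have "?d v \<in> cube I z" using v img by blast
        ultimately have "w \<in> (\<lambda>i. flip i (?d v)) ` {i \<in> I. flip i (?d v) \<in> F}" if "w \<in> F" for w
          using adj_cube_imp_flip[of "?d v" I z w] that F(1) by blast
        then have "F \<subseteq> (\<lambda>i. flip i (?d v)) ` {i \<in> I. flip i (?d v) \<in> F}" by blast
        then have "card F \<le> faulty_degree I F (?d v)"
          unfolding faulty_degree_def using I(1) by (intro surj_card_le) auto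
        then show False using v F(2) by simp
      qed
      then show ?thesis using v gh(4) f unfolding live_def by auto
    qed
    have ls: "length s' = length ds" "length t' = length ds" using s' t' len by auto
    have "\<not> par s'" "par t'"
      using ev_dec[OF fc ls(1)] ev_dec[OF fc ls(2)] s' t' st by auto
    moreover have "live ?f g h s'" "live ?f g h t'"
      using live s' t' st by auto
    moreover have "s' \<in> set ?ws" "t' \<in> set ?ws" using s' t' ws by auto
    ultimately have run: "dfs (replicate 16 ()) (replicate 10 ()) t' (marks [?f, g, h] (full [(),(),(),()])) s'"
      using gh(1) unfolding check_def list_all_iff all_ends_iff by (simp del: words.simps full.simps marks.simps)
    have "\<forall>w\<in>set [?f, g, h]. length w = length ds" using gh(2,3) len by simp
    from dfs_avoid[OF ds(1) fc _ ls(1) this run] obtain C where C: "C \<subseteq> cube (set ds) c" "path_on s t C"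
      "10 \<le> card C" "\<forall>v\<in>C. \<forall>w\<in>set [?f, g, h]. v \<noteq> ?d w"
      using s' t' len by auto
    have "C \<inter> F = {}" using C(4) gh(4) f by auto
    then show ?thesis using C ds(2) cube by (intro exI[of _ C]) auto
  qed
  have main2: "\<exists>C \<subseteq> cube I z - F. path_on s t C \<and> 10 \<le> card C"
    if "s \<in> cube I z - F" "t \<in> cube I z - F" "ev s = ev c" "ev t \<noteq> ev c" "faulty_degree I F s \<le> 2" "faulty_degree I F t \<le> 2" for s t
  proof -
    have F': "F = {c, ?d g, ?d h}" "F = {c, ?d h, ?d g}" using Fc(1) g(2) h(2) by auto
    \<comment> \<open>The computation ran over unordered pairs, so it is available for only one of
      the two orders of \<open>g\<close> and \<open>h\<close>.\<close>
    show ?thesis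
      using all_pairsD[OF check_all tl] main[OF _ g(1) h(1) F'(1) that] main[OF _ h(1) g(1) F'(2) that]
      by blast
  qed
  \<comment> \<open>The searches start at words with the parity of \<open>c\<close>; if
    \<open>s\<close> has the other parity, the path is found from \<open>t\<close> and
    reversed.\<close>
  show ?thesis
  proof (cases "ev s = ev c")
    case True
    then show ?thesis using main2[of s t] st by auto
  next
    case False
    then have "\<exists>C \<subseteq> cube I z - F. path_on t s C \<and> 10 \<le> card C"
      using main2[of t s] st by auto
    then show ?thesis using path_on_rev by blast
  qed
qed

subsection \<open>Long paths that avoid most of a ball\<close>

text \<open>The start word is exempt from the forbidden ones, since a fault-free terminal may lie
  next to the centre. The recursion depth \<open>32\<close> is the number of vertices in dimension
  five.\<close>

definition table_ok :: "unit list \<Rightarrow> bool list list \<Rightarrow> nat \<Rightarrow> bool list list \<Rightarrow> bool list list \<Rightarrow> bool" where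
  "table_ok us bad L ss ts \<longleftrightarrow> list_all (\<lambda>(s, t). par s \<noteq> par t \<and> length t = length us \<and>
     dfs (replicate 32 ()) (replicate L ()) t (marks (filter (\<lambda>w. w \<noteq> s) bad) (full us)) s) (zip ss ts)"

lemma table_path:
  assumes ds: "distinct ds" "finite c" and len: "length us = length ds" "length s = length ds"
    and bad: "\<forall>w\<in>set bad. length w = length ds"
    and ok: "table_ok us bad L ss ts" and s: "s \<in> set ss" "length ss = length ts"
  shows "\<exists>w C. C \<subseteq> cube (set ds) c \<and> path_on (dec c ds s) w C \<and> ev w \<noteq> ev (dec c ds s) \<and> L \<le> card C \<and>
    (\<forall>v\<in>C - {dec c ds s}. v \<notin> dec c ds ` set bad)"
proof -
  obtain m where m: "m < length ss" "ss ! m = s" using s(1) by (auto simp: in_set_conv_nth)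
  let ?t = "ts ! m"
  have "(s, ?t) \<in> set (zip ss ts)" using m s(2) by (auto simp: in_set_zip)
  then have t: "par s \<noteq> par ?t" "length ?t = length us"
    "dfs (replicate 32 ()) (replicate L ()) ?t (marks (filter (\<lambda>w. w \<noteq> s) bad) (full us)) s"
    using ok unfolding table_ok_def list_all_iff by auto
  have "\<forall>w\<in>set (filter (\<lambda>w. w \<noteq> s) bad). length w = length ds" using bad by auto
  from dfs_avoid[OF ds len this t(3)] obtain C where C: "C \<subseteq> cube (set ds) c"
    "path_on (dec c ds s) (dec c ds ?t) C" "L \<le> card C"
    "\<forall>v\<in>C. \<forall>w\<in>set (filter (\<lambda>w. w \<noteq> s) bad). v \<noteq> dec c ds w"
    by auto
  have "ev (dec c ds ?t) \<noteq> ev (dec c ds s)"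
    using ev_dec[OF ds(2), of s ds] ev_dec[OF ds(2), of ?t ds] t len by auto
  moreover have "\<forall>v\<in>C - {dec c ds s}. v \<notin> dec c ds ` set bad" using C(4) by auto
  ultimately show ?thesis using C by blast
qed

lemma dec_zeros: "dec c ds (replicate (length ds) False) = c"
  by (induction ds) auto

lemma dec_unit: "j \<in> set ds \<Longrightarrow> \<exists>w\<in>set (nbrs (replicate (length ds) False)). dec c ds w = flip j c"
  by (induction ds) (auto simp: dec_zeros)

text \<open>
  The last list of each table gives, for every start word, an end word for which the search succeeds
  quickly.
\<close>

lemma table_4: "table_ok [(),(),(),()] (replicate (length [(),(),(),()]) False # nbrs (replicate (length [(),(),(),()]) False)) 8
  (tl (words [(),(),(),()]))
  [[False,False,True,True], [False,False,True,True], [True,True,True,False], [False,False,True,True], 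
    [True,True,True,False], [True,True,False,True], [False,True,True,False], [False,False,True,True], 
    [True,True,True,False], [True,True,False,True], [False,True,True,False], [True,True,False,True], 
    [False,True,True,False], [False,True,False,True], [True,True,True,False]]"
  by code_simp

lemma table_5: "table_ok [(),(),(),(),()]
  (replicate (length [(),(),(),(),()]) False # nbrs (replicate (length [(),(),(),(),()]) False)) 20
  (tl (words [(),(),(),(),()]))
  [[True,True,True,True,False], [True,True,True,False,True], [True,False,True,True,False], 
    [True,True,True,False,True], [True,True,False,True,False], [True,True,False,False,True], 
    [False,False,True,True,False], [True,True,True,False,True], [True,False,True,True,False], 
    [True,False,False,True,True], [False,False,True,True,False], [True,False,True,False,True], 
    [False,False,True,True,False], [False,True,True,False,False], [True,False,True,True,False], 
    [True,True,True,False,True], [True,False,True,True,False], [True,False,True,False,True], 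
    [False,False,True,True,False], [True,False,True,False,True], [False,True,False,True,False], 
    [False,True,False,False,True], [True,False,True,True,False], [True,False,True,False,True], 
    [False,False,True,True,False], [False,False,True,False,True], [True,False,True,True,False], 
    [False,False,True,False,True], [True,True,False,True,False], [True,True,False,False,True], 
    [False,False,True,True,False]]"
  by code_simp

text \<open>The forbidden words are the centre, two of its neighbours and one vertex at distance two
  along the other two coordinates: the faults of a four-dimensional half when one fault differs from
  the centre in a pair of coordinates of that half.\<close>

lemma table_pair: "table_ok [(),(),(),()]
  [[False,False,False,False], [True,False,False,False], [False,True,False,False], [False,False,True,True]] 8
  [[False,False,False,True], [False,False,True,False], [False,True,False,True], [False,True,True,False], 
    [False,True,True,True], [True,False,False,True], [True,False,True,False], [True,False,True,True], 
    [True,True,False,False], [True,True,False,True], [True,True,True,False], [True,True,True,True]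
    ]
  [[True,False,True,False], [True,False,False,True], [True,True,True,False], [True,True,False,True], 
    [True,True,False,False], [True,True,True,False], [False,False,False,True], [False,True,True,False], 
    [False,True,True,True], [False,True,True,False], [False,True,False,True], [False,False,True,False]
    ]"
  by code_simp

text \<open>For \<open>k = 1\<close> there are \<open>2n - 5\<close> faults, of which at least
  \<open>2n - 6\<close> lie in the half of the centre \<open>c\<close>. So the lengths needed there
  are \<open>2 ^ 4 - 2 * 4 = 8\<close> for \<open>n = 5\<close> and
  \<open>2 ^ 5 - 2 * 6 = 20\<close> for \<open>n = 6\<close>. The end \<open>w\<close> also avoids
  the ball, so that its neighbour in the other half is fault-free.\<close>

lemma ex_path_avoiding_ball_aux:
  assumes J: "finite J" "card J = length us" and s: "s \<in> cube J c" "s \<noteq> c" and c: "finite c"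
    and ok: "table_ok us (replicate (length us) False # nbrs (replicate (length us) False)) L (tl (words us)) ts"
      "length (tl (words us)) = length ts"
  shows "\<exists>w C. C \<subseteq> cube J c \<and> path_on s w C \<and> ev w \<noteq> ev s \<and> L \<le> card C \<and>
    (\<forall>v\<in>C - {s}. v \<noteq> c \<and> (\<forall>j\<in>J. v \<noteq> flip j c))"
proof -
  obtain ds where ds: "distinct ds" "set ds = J" using finite_distinct_list[OF J(1)] by blast
  have len: "length us = length ds" using distinct_card[OF ds(1)] ds(2) J(2) by simp
  have "s \<in> dec c ds ` {bs. length bs = length ds}" using dec_image[OF ds(1) c] s(1) ds(2) by simp
  then obtain s' where s': "length s' = length ds" "dec c ds s' = s" by blast
  have "s' \<noteq> replicate (length us) False" using s' s(2) dec_zeros[of c ds] len by auto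
  then have mem: "s' \<in> set (tl (words us))"
    using set_words_tl[of us] s'(1) set_words[of us] len by auto
  have bad: "\<forall>w\<in>set (replicate (length us) False # nbrs (replicate (length us) False)). length w = length ds"
    using length_nbrs[of _ "replicate (length us) False"] len by auto
  obtain w C where wC: "C \<subseteq> cube J c" "path_on s w C" "ev w \<noteq> ev s" "L \<le> card C"
    and *: "\<forall>v\<in>C - {s}. v \<notin> dec c ds ` set (replicate (length us) False # nbrs (replicate (length us) False))"
    using table_path[OF ds(1) c len s'(1) bad ok(1) mem ok(2)] s'(2) ds(2) by auto
  have main: "v \<noteq> c \<and> (\<forall>j\<in>J. v \<noteq> flip j c)" if v: "v \<in> C - {s}" for v
  proof -
    have nv: "v \<notin> dec c ds ` set (replicate (length us) False # nbrs (replicate (length us) False))"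
      using * v by blast
    have "v \<noteq> c"
    proof
      assume "v = c"
      then have "v = dec c ds (replicate (length us) False)" using dec_zeros[of c ds] len by simp
      then show False using nv by simp
    qed
    moreover have "v \<noteq> flip j c" if "j \<in> J" for j
      using dec_unit[of j ds c] ds(2) len nv that by auto
    ultimately show ?thesis by blast
  qed
  show ?thesis by (intro exI[of _ w] exI[of _ C] conjI[OF wC(1)] conjI[OF wC(2)] conjI[OF wC(3)]
      conjI[OF wC(4)] ballI main)
qed

lemma ex_path_avoiding_ball_4:
  assumes "finite J" "card J = 4" "s \<in> cube J c" "s \<noteq> c" "finite c"
  shows "\<exists>w C. C \<subseteq> cube J c \<and> path_on s w C \<and> ev w \<noteq> ev s \<and> 8 \<le> card C \<and>
    (\<forall>v\<in>C - {s}. v \<noteq> c \<and> (\<forall>j\<in>J. v \<noteq> flip j c))"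
  by (rule ex_path_avoiding_ball_aux[OF assms(1) _ assms(3-5) table_4]) (simp_all add: assms(2))

lemma ex_path_avoiding_ball_5:
  assumes "finite J" "card J = 5" "s \<in> cube J c" "s \<noteq> c" "finite c"
  shows "\<exists>w C. C \<subseteq> cube J c \<and> path_on s w C \<and> ev w \<noteq> ev s \<and> 20 \<le> card C \<and>
    (\<forall>v\<in>C - {s}. v \<noteq> c \<and> (\<forall>j\<in>J. v \<noteq> flip j c))"
  by (rule ex_path_avoiding_ball_aux[OF assms(1) _ assms(3-5) table_5]) (simp_all add: assms(2))

lemma ex_path_avoiding_pair:
  assumes d: "distinct [a, b, d, e]" and s: "s \<in> cube {a, b, d, e} c" "finite c"
    and ns: "s \<notin> {c, flip a c, flip b c, flip d (flip e c)}"
  shows "\<exists>w C. C \<subseteq> cube {a, b, d, e} c \<and> path_on s w C \<and> ev w \<noteq> ev s \<and> 8 \<le> card C \<and>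
    C \<inter> {c, flip a c, flip b c, flip d (flip e c)} = {}"
proof -
  let ?ds = "[a, b, d, e]"
  let ?bad = "[[False,False,False,False], [True,False,False,False], [False,True,False,False], [False,False,True,True]]"
  have "s \<in> dec c ?ds ` {bs. length bs = length ?ds}" using dec_image[OF d s(2)] s(1) by simp
  then obtain s' where s': "length s' = length ?ds" "dec c ?ds s' = s" by blast
  have bad: "dec c ?ds ` set ?bad = {c, flip a c, flip b c, flip d (flip e c)}" by simp
  have "s' \<in> set (words ?ds)" using s'(1) set_words[of ?ds] by blast
  moreover have "s' \<notin> set ?bad" using s'(2) ns bad by blast
  ultimately have mem: "s' \<in> set [[False,False,False,True], [False,False,True,False], [False,True,False,True], [False,True,True,False], 
    [False,True,True,True], [True,False,False,True], [True,False,True,False], [True,False,True,True], 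
    [True,True,False,False], [True,True,False,True], [True,True,True,False], [True,True,True,True]
    ]"
    by auto
  obtain w C where C: "C \<subseteq> cube (set ?ds) c" "path_on s w C" "ev w \<noteq> ev s" "8 \<le> card C"
    "\<forall>v\<in>C - {s}. v \<notin> dec c ?ds ` set ?bad"
    using table_path[OF d s(2) _ s'(1) _ table_pair mem] s'(2) by auto
  have "C \<inter> {c, flip a c, flip b c, flip d (flip e c)} = {}"
    using C(5) ns unfolding bad by blast
  then show ?thesis using C by (intro exI[of _ w] exI[of _ C]) simp
qed

subsection \<open>Faulty neighbours\<close>

text \<open>
  Dead vertices cannot be inner vertices of a path. A half of the cube may acquire one even if the
  cube has none, so the induction has to tolerate them.
\<close>

definition dead :: "'a set \<Rightarrow> 'a set \<Rightarrow> 'a set set \<Rightarrow> 'a set set" where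
  "dead I z F = {v \<in> cube I z - F. card I < faulty_degree I F v + 2}"

lemma faulty_degree_image:
  "finite I \<Longrightarrow> faulty_degree I F v = card ((\<lambda>i. flip i v) ` {i \<in> I. flip i v \<in> F})"
  unfolding faulty_degree_def by (subst card_image) (auto simp: inj_on_def)

lemma flip_eq_flipD:
  assumes "flip i u = flip j v" "u \<noteq> v"
  shows "sdiff u v = {i, j}"
proof -
  have "i \<noteq> j" using assms by auto
  have "(x \<in> u) \<noteq> (x = i) \<longleftrightarrow> (x \<in> v) \<noteq> (x = j)" for x
    using assms(1) mem_flip[of x i u] mem_flip[of x j v] by simp
  then show ?thesis using \<open>i \<noteq> j\<close> unfolding sdiff_def by blast
qed

text \<open>Two distinct vertices have at most two common neighbours:
  \<open>flip i u = flip j v\<close> forces \<open>sdiff u v = {i, j}\<close>.\<close>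

lemma faulty_degree_add_le:
  assumes "finite I" "finite F" "u \<noteq> v"
  shows "faulty_degree I F u + faulty_degree I F v \<le> card F + 2"
proof -
  let ?N = "\<lambda>u. (\<lambda>i. flip i u) ` {i \<in> I. flip i u \<in> F}"
  have sub: "?N u \<union> ?N v \<subseteq> F" and fin: "finite (?N u)" "finite (?N v)" using assms(1) by auto
  have "card (?N u \<inter> ?N v) \<le> 2"
  proof (cases "?N u \<inter> ?N v = {}")
    case False
    then obtain i j where "flip i u = flip j v" by auto
    then have ij: "sdiff u v = {i, j}" by (rule flip_eq_flipD[OF _ assms(3)])
    have "?N u \<inter> ?N v \<subseteq> (\<lambda>i. flip i u) ` sdiff u v"
    proof
      fix w assume "w \<in> ?N u \<inter> ?N v"
      then obtain i' j' where w: "w = flip i' u" "w = flip j' v" by blast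
      then have "flip i' u = flip j' v" by simp
      then have "sdiff u v = {i', j'}" by (rule flip_eq_flipD[OF _ assms(3)])
      then show "w \<in> (\<lambda>i. flip i u) ` sdiff u v" using w(1) by blast
    qed
    then have "card (?N u \<inter> ?N v) \<le> card ((\<lambda>i. flip i u) ` sdiff u v)"
      unfolding ij by (rule card_mono[rotated]) simp
    also have "\<dots> \<le> card (sdiff u v)" unfolding ij by (rule card_image_le) simp
    also have "\<dots> \<le> 2" unfolding ij by (simp add: card_insert_if)
    finally show ?thesis .
  qed simp
  moreover have "card (?N u) + card (?N v) = card (?N u \<union> ?N v) + card (?N u \<inter> ?N v)"
    using card_Un_Int[OF fin] .
  moreover have "card (?N u \<union> ?N v) \<le> card F" using card_mono[OF assms(2) sub] .
  ultimately show ?thesis unfolding faulty_degree_image[OF assms(1)] by linarith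
qed

text \<open>Vertices of different parity have no common neighbour, so no fault is counted
  twice.\<close>

lemma faulty_degree_add_le_parity:
  assumes "finite I" "finite F" "ev u \<noteq> ev v" "finite u" "finite v"
  shows "faulty_degree I F u + faulty_degree I F v \<le> card F"
proof -
  let ?N = "\<lambda>u. (\<lambda>i. flip i u) ` {i \<in> I. flip i u \<in> F}"
  have sub: "?N u \<union> ?N v \<subseteq> F" and fin: "finite (?N u)" "finite (?N v)" using assms(1) by auto
  have "?N u \<inter> ?N v = {}"
  proof (rule ccontr)
    assume "?N u \<inter> ?N v \<noteq> {}"
    then obtain i j where "flip i u = flip j v" by auto
    then have "ev (flip i u) = ev (flip j v)" by simp
    then show False using assms(3-5) by (simp add: ev_flip)
  qed
  then have "card (?N u) + card (?N v) = card (?N u \<union> ?N v)"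
    using card_Un_disjoint[OF fin] by simp
  moreover have "card (?N u \<union> ?N v) \<le> card F" using card_mono[OF assms(2) sub] .
  ultimately show ?thesis unfolding faulty_degree_image[OF assms(1)] by linarith
qed

text \<open>Two dead vertices have at least \<open>2n - 2\<close> faulty neighbours in total, at
  most two of them common, which needs \<open>2n - 4\<close> faults.\<close>

lemma card_dead_le_1:
  assumes "finite I" "finite F" "card F + 4 < 2 * card I"
  shows "card (dead I z F) \<le> 1"
proof (rule ccontr)
  assume "\<not> card (dead I z F) \<le> 1"
  then have "2 \<le> card (dead I z F)" by linarith
  then obtain u v where uv: "u \<in> dead I z F" "v \<in> dead I z F" "u \<noteq> v" by (rule ex_two)
  have "card I < faulty_degree I F u + 2" "card I < faulty_degree I F v + 2"
    using uv(1,2) unfolding dead_def by auto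
  then show False using faulty_degree_add_le[OF assms(1,2) uv(3)] assms(3) by linarith
qed

text \<open>The induction hypothesis as a predicate, so that it can be assumed in a locale. The
  \<open>itself\<close> argument carries the type of the coordinates, which \<open>n\<close> does
  not determine.\<close>

definition solved_below :: "'a itself \<Rightarrow> nat \<Rightarrow> bool" where
  "solved_below _ n \<longleftrightarrow> (\<forall>(J :: 'a set) c G K. finite J \<longrightarrow> finite c \<longrightarrow> card J < n \<longrightarrow> G \<subseteq> cube J c \<longrightarrow>
     K + 2 \<le> card J \<longrightarrow> card G + 2 * K + 3 \<le> 2 * card J \<longrightarrow> solvable J c G K (dead J c G))"

lemma solved_belowD:
  fixes J :: "'a set"
  assumes "solved_below TYPE('a) n" "finite J" "finite c" "card J < n" "G \<subseteq> cube J c"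
    "K + 2 \<le> card J" "card G + 2 * K + 3 \<le> 2 * card J"
  shows "solvable J c G K (dead J c G)"
  using assms unfolding solved_below_def by simp

section \<open>Splitting in the presence of dead vertices\<close>

context halves
begin

lemma faulty_degree_half:
  assumes "v \<in> Q0"
  shows "faulty_degree I F v = faulty_degree J F0 v + (if flip i v \<in> F then 1 else 0)"
proof -
  have j: "flip j v \<in> F \<longleftrightarrow> flip j v \<in> F0" if "j \<in> J" for j
    using flip_mem_cube_iff[of v J z j] assms that unfolding F0_def Q0_def by blast
  have "{j \<in> I. flip j v \<in> F} = {j \<in> J. flip j v \<in> F0} \<union> (if flip i v \<in> F then {i} else {})"
    using j iI unfolding J_def by auto
  moreover have "finite {j \<in> J. flip j v \<in> F0}" "i \<notin> {j \<in> J. flip j v \<in> F0}" using fJ by auto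
  ultimately show ?thesis unfolding faulty_degree_def by simp
qed

text \<open>In its half a vertex loses only the neighbour along \<open>i\<close>. This is harmless
  if that neighbour is faulty or if there are two other fault-free ones.\<close>

lemma alive_half:
  assumes "v \<in> Q0" "faulty_degree I F v + 3 \<le> card I \<or> flip i v \<in> F \<and> faulty_degree I F v + 2 \<le> card I"
  shows "v \<notin> dead J z F0"
  using faulty_degree_half[OF assms(1)] assms(2) fJ(3) unfolding dead_def by (auto split: if_splits)

lemma ref_halves:
  assumes "X \<subseteq> cube I z"
  shows "X \<inter> Q0 = {x \<in> X. (i \<in> x) = (i \<in> z)}" "X \<inter> Q1 = {x \<in> X. (i \<in> x) \<noteq> (i \<in> z)}"
proof -
  have "x \<in> Q0 \<longleftrightarrow> (i \<in> x) = (i \<in> z)" "x \<in> Q1 \<longleftrightarrow> (i \<in> x) \<noteq> (i \<in> z)" if "x \<in> X" for x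
    using Q0_iff[of x] Q1_iff[of x] assms that by blast+
  then show "X \<inter> Q0 = {x \<in> X. (i \<in> x) = (i \<in> z)}" "X \<inter> Q1 = {x \<in> X. (i \<in> x) \<noteq> (i \<in> z)}" by blast+
qed

text \<open>The first half is solved by induction, with its dead vertices barred as terminals; the
  second has few faults. The \<open>1\<close> in \<open>le\<close> makes room for the only possible
  dead vertex.\<close>

lemma split_cond:
  assumes sb: "solved_below TYPE('a) (card I)" and tr: "terminals p (cube I z - F) S T"
    and alive: "\<And>v. v \<in> (S \<union> T) \<inter> Q0 \<Longrightarrow> v \<notin> dead J z F0"
    and n: "5 \<le> card I" and S: "1 \<le> card S"
    and K: "1 \<le> K" "K \<le> card S" "card (S \<inter> Q0) \<le> K" "card (T \<inter> Q0) \<le> K" "K + 3 \<le> card I"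
      "card F0 + 2 * K + 5 \<le> 2 * card I"
    and F1: "card F1 + card S + 2 \<le> card I"
    and le: "card F + card S + 1 \<le> 2 ^ (card J - 1)"
  shows "linkable I z F S T"
proof -
  note ST = terminalsD[OF tr] terminals_card[OF tr]
  have s0: "solvable J z F0 K (dead J z F0)"
    by (rule solved_belowD[OF sb fJ(1) finz]) (use fJ(3) K F01(3) in \<open>auto simp: Q0_def\<close>)
  have "finite (flip i z)" using finz by simp
  then have s1: "solvable J (flip i z) F1 (card S) {}"
    by (rule solvable_few_faults[OF fJ(1)]) (use fJ(3) F1 F01(4) in \<open>auto simp: Q1_def\<close>)
  have D: "card (dead J z F0) \<le> 1"
    by (rule card_dead_le_1[OF fJ(1) finF(2)]) (use K fJ(3) in linarith)
  have Dsub: "dead J z F0 \<subseteq> Q0" unfolding dead_def Q0_def by blast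
  have Dfin: "finite (dead J z F0)" using Dsub Q(3) by (rule finite_subset)
  have disj: "(S \<union> T) \<inter> (dead J z F0 \<union> {}) = {}" using alive Dsub by blast
  have ne: "J \<noteq> {}" using fJ n by auto
  have cc: "card (S \<inter> Q1) \<le> card S" "card (T \<inter> Q1) \<le> card S"
    using ST(5,9,10) by linarith+
  have le': "card F + card (dead J z F0) + card ({} :: 'a set set) + card S \<le> 2 ^ (card J - 1)"
    using le D by simp
  show ?thesis
    by (rule split[OF s0 s1 tr disj Dfin finite.emptyI ne S K(1) S K(3,4) cc le'])
qed

text \<open>The demoted source \<open>s\<close> may well be dead in the first half, because it is no
  terminal there. The smaller number \<open>card S - 1\<close> of paths is what lets the first half
  keep all the faults.\<close>

lemma shift_cond:
  assumes sb: "solved_below TYPE('a) (card I)" and tr: "terminals p (cube I z - F) S T" and s: "s \<in> S"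
    and sub: "S \<subseteq> Q0" "T \<inter> Q0 \<noteq> {}" "T \<inter> Q1 \<noteq> {}"
    and alive: "\<And>v. v \<in> S - {s} \<union> T \<inter> Q0 \<Longrightarrow> v \<notin> dead J z F0"
    and n: "5 \<le> card I" "card F0 + 2 * card S + 3 \<le> 2 * card I" "card F1 + card S + 2 \<le> card I"
    and s': "flip i s \<notin> F1"
    and nb: "\<And>q. q \<in> Q0 \<Longrightarrow> adj q s \<Longrightarrow> q \<notin> F \<Longrightarrow> q \<notin> T \<Longrightarrow> flip i q \<notin> F1"
    and le: "card F + card S + 1 \<le> 2 ^ (card J - 1)"
  shows "linkable I z F S T"
proof -
  note ST = terminalsD[OF tr] terminals_card[OF tr]
  have "1 \<le> card (T \<inter> Q0)" "1 \<le> card (T \<inter> Q1)"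
    using sub(2,3) ST(8) by (simp_all add: Suc_leI card_gt_0_iff)
  then have k2: "2 \<le> card S" using ST(5,10) by linarith
  have s0: "solvable J z F0 (card S - 1) (dead J z F0)"
    by (rule solved_belowD[OF sb fJ(1) finz]) (use fJ(3) n k2 F01(3) in \<open>auto simp: Q0_def\<close>)
  have ff: "finite (flip i z)" using finz by simp
  have s1: "solvable J (flip i z) F1 (card S - 1) {}"
    by (rule solvable_few_faults[OF fJ(1) ff]) (use fJ(3) n k2 F01(4) in \<open>auto simp: Q1_def\<close>)
  have "flip i s \<in> Q1" using s sub(1) flipQ(1) by blast
  then have s2: "solvable J (flip i z) (insert (flip i s) F1) (card S - 1) {}"
    by (intro solvable_few_faults[OF fJ(1) ff])
      (use fJ(3) n k2 F01(4) finF(3) s' in \<open>auto simp: Q1_def card_insert_if\<close>)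
  have D: "card (dead J z F0) \<le> 1"
    by (rule card_dead_le_1[OF fJ(1) finF(2)]) (use n k2 fJ(3) in linarith)
  have Dsub: "dead J z F0 \<subseteq> Q0" unfolding dead_def Q0_def by blast
  have Dfin: "finite (dead J z F0)" using Dsub Q(3) by (rule finite_subset)
  have disj: "(S - {s} \<union> T \<inter> Q0) \<inter> dead J z F0 = {}" using alive by blast
  have le': "card F + card (dead J z F0) + card S \<le> 2 ^ (card J - 1)" using le D by simp
  have le2: "card F1 + card S \<le> card J + 1" using n(3) fJ(3) by linarith
  show ?thesis
    by (rule shift[OF tr s sub s0 Dfin disj s1 s2 s' nb le' le2])
qed

text \<open>For a single pair the path through the first half may end at any \<open>w\<close> of the
  right parity with a fault-free neighbour across; the second half has few faults and leads on to
  \<open>t\<close>.\<close>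

lemma join_across:
  assumes C0: "path_on s w C0" "C0 \<subseteq> Q0 - F0" "ev w \<noteq> ev s" "flip i w \<notin> F1"
    and t: "t \<in> Q1 - F1" "ev t \<noteq> ev s"
    and le: "card F1 + 2 \<le> card J" "2 ^ card J \<le> card C0 + 2 * card F0"
  shows "linkable I z F {s} {t}"
proof -
  have w: "w \<in> Q0" "finite w" using path_on_ends[OF C0(1)] C0(2) finQ(1) by blast+
  have "ev (flip i w) = ev s" using C0(3) ev_flip[OF w(2), of i] by blast
  then have tr: "terminals (ev s) (Q1 - F1 - {}) {flip i w} {t}"
    using w(1) flipQ(1) C0(4) t unfolding terminals_def by simp
  have "finite (flip i z)" using finz by simp
  then have "solvable J (flip i z) F1 1 {}"
    by (rule solvable_few_faults[OF fJ(1)]) (use le F01(4) in \<open>auto simp: Q1_def\<close>)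
  from sol1D[OF this tr] obtain C1 where C1: "C1 \<subseteq> Q1 - F1" "linkage {flip i w} {t} C1"
    "2 ^ card J \<le> card C1 + 2 * card F1" by auto
  have "C0 \<inter> C1 = {}" using C0(2) C1(1) Q(2) by blast
  then have "path_on s t (C0 \<union> C1)" using path_on_join[OF C0(1) linkage_pair[OF C1(2)]] by simp
  then show ?thesis using combine[OF linkage_single C0(2) C1(1) le(2) C1(3)] by blast
qed

end

text \<open>A majority vote in every coordinate; outside \<open>I\<close> the faults are unanimous,
  so \<open>c\<close> lies in the cube.\<close>

lemma ex_center:
  assumes "finite I" "finite F" "F \<subseteq> cube I z" "F \<noteq> {}"
  shows "\<exists>c \<in> cube I z. \<forall>i. 2 * card {x \<in> F. (i \<in> x) \<noteq> (i \<in> c)} \<le> card F"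
proof -
  define c where "c = {j. card F < 2 * card {x \<in> F. j \<in> x}}"
  have pos: "0 < card F" using assms(2,4) by (simp add: card_gt_0_iff)
  have "c \<subseteq> \<Union>F"
  proof
    fix j assume "j \<in> c"
    then have "card {x \<in> F. j \<in> x} \<noteq> 0" unfolding c_def by auto
    then have "{x \<in> F. j \<in> x} \<noteq> {}" by (metis card.empty)
    then show "j \<in> \<Union>F" by blast
  qed
  moreover have "finite (\<Union>F)" using assms(2,3) cube_finite_mem by blast
  ultimately have "finite c" by (rule finite_subset)
  moreover have "j \<in> c \<longleftrightarrow> j \<in> z" if "j \<notin> I" for j
  proof -
    have "(j \<in> x) = (j \<in> z)" if "x \<in> F" for x using that assms(3) \<open>j \<notin> I\<close> unfolding cube_def by blast
    then have "{x \<in> F. j \<in> x} = (if j \<in> z then F else {})" by auto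
    then show ?thesis using pos unfolding c_def by simp
  qed
  ultimately have "c \<in> cube I z" unfolding cube_def by blast
  moreover have "2 * card {x \<in> F. (i \<in> x) \<noteq> (i \<in> c)} \<le> card F" for i
  proof -
    have part: "card {x \<in> F. i \<in> x} + card {x \<in> F. i \<notin> x} = card F"
    proof -
      have "F = {x \<in> F. i \<in> x} \<union> {x \<in> F. i \<notin> x}" by blast
      then have "card F = card ({x \<in> F. i \<in> x} \<union> {x \<in> F. i \<notin> x})" by (rule arg_cong)
      also have "\<dots> = card {x \<in> F. i \<in> x} + card {x \<in> F. i \<notin> x}"
        by (rule card_Un_disjoint) (use assms(2) in auto)
      finally show ?thesis by simp
    qed
    show ?thesis
    proof (cases "i \<in> c")
      case True
      then have "{x \<in> F. (i \<in> x) \<noteq> (i \<in> c)} = {x \<in> F. i \<notin> x}" by blast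
      then show ?thesis using part True unfolding c_def by simp
    next
      case False
      then have "{x \<in> F. (i \<in> x) \<noteq> (i \<in> c)} = {x \<in> F. i \<in> x}" by blast
      then show ?thesis using False unfolding c_def by simp
    qed
  qed
  ultimately show ?thesis by blast
qed

lemma sdiff_flip: "sdiff c (flip i v) = (if i \<in> sdiff c v then sdiff c v - {i} else insert i (sdiff c v))"
  unfolding sdiff_def set_eq_iff by (auto simp: mem_flip)

lemma sdiff_eq_iff: "sdiff c u = sdiff c v \<longleftrightarrow> u = v"
  unfolding sdiff_def set_eq_iff by blast

text \<open>
  If every coordinate in which \<open>S\<close> or \<open>T\<close> varies obstructs the demotion of a terminal, then \<open>T\<close>, and
  by symmetry \<open>S\<close>, consists of neighbours of the centre \<open>c\<close>, contradicting the parities.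
\<close>

lemma common_centre:
  assumes disj: "\<And>x y i. x \<in> F \<Longrightarrow> y \<in> F \<Longrightarrow> i \<in> sdiff c x \<Longrightarrow> i \<in> sdiff c y \<Longrightarrow> x = y"
    and fin: "\<And>v. v \<in> F \<union> S \<union> T \<Longrightarrow> finite v"
    and S: "s1 \<in> S" "s2 \<in> S" "s1 \<noteq> s2" and T: "t1 \<in> T" "t2 \<in> T" "t1 \<noteq> t2"
    and ev: "\<And>s t. s \<in> S \<Longrightarrow> t \<in> T \<Longrightarrow> ev s \<noteq> ev t"
    and varyT: "\<And>i t t'. t \<in> T \<Longrightarrow> t' \<in> T \<Longrightarrow> i \<in> sdiff t t' \<Longrightarrow>
       \<exists>y\<in>F. i \<in> sdiff c y \<and> (\<forall>s\<in>S. adj (flip i y) s)"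
    and varyS: "\<And>i s s'. s \<in> S \<Longrightarrow> s' \<in> S \<Longrightarrow> i \<in> sdiff s s' \<Longrightarrow>
       \<exists>y\<in>F. i \<in> sdiff c y \<and> (\<forall>t\<in>T. adj (flip i y) t)"
  shows "adj c t1"
proof -
  have evadj: "ev v = ev y" if "adj (flip i y) v" "y \<in> F" for i y v
    using ev_adj[OF that(1)] ev_flip[of y i] fin that(2) by auto
  have "sdiff t1 t2 \<noteq> {}" using T(3) by (simp add: sdiff_eq_empty_iff)
  then obtain i where "i \<in> sdiff t1 t2" by blast
  then obtain y where y: "y \<in> F" "\<forall>s\<in>S. adj (flip i y) s" using varyT[OF T(1,2)] by blast
  define u where "u = flip i y"
  have "adj u s1" "adj u s2" using y(2) S(1,2) by (simp_all add: u_def)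
  then obtain l1 l2 where l: "s1 = flip l1 u" "s2 = flip l2 u" unfolding adj_def by metis
  have "l1 \<noteq> l2" using l S(3) by blast
  \<comment> \<open>Both sources are neighbours of \<open>u\<close>, hence differ exactly in
    \<open>l1\<close> and \<open>l2\<close>, and \<open>varyS\<close> applies to both
    coordinates.\<close>
  have "flip l1 s1 = flip l2 s2" using l by simp
  then have sd: "sdiff s1 s2 = {l1, l2}" by (rule flip_eq_flipD[OF _ S(3)])
  obtain y1 where y1: "y1 \<in> F" "l1 \<in> sdiff c y1" "\<forall>t\<in>T. adj (flip l1 y1) t"
    using varyS[OF S(1,2), of l1] sd by blast
  obtain y2 where y2: "y2 \<in> F" "l2 \<in> sdiff c y2" "\<forall>t\<in>T. adj (flip l2 y2) t"
    using varyS[OF S(1,2), of l2] sd by blast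
  have evy: "ev y1 = ev t1" "ev y2 = ev t1" using evadj y1 y2 T(1) by blast+
  define z1 z2 where "z1 = flip l1 y1" "z2 = flip l2 y2"
  have z: "sdiff c z1 = sdiff c y1 - {l1}" "sdiff c z2 = sdiff c y2 - {l2}"
    using y1(2) y2(2) unfolding z1_z2_def by (simp_all add: sdiff_flip)
  \<comment> \<open>Otherwise the coordinate \<open>a\<close> leading from \<open>z1\<close> to
    \<open>t1\<close> occurs in \<open>y1\<close> or \<open>y2\<close>, faults with the parity of
    the sinks. But \<open>t1\<close> and \<open>t2\<close> differ in \<open>a\<close>, so
    \<open>varyT\<close> gives a fault using \<open>a\<close> with the parity of the sources, and by
    disjointness it is the same fault.\<close>
  have "z1 = z2"
  proof (rule ccontr)
    assume ne: "z1 \<noteq> z2"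
    have adjs: "adj z1 t1" "adj z1 t2" "adj z2 t1"
      using y1(3) y2(3) T(1,2) unfolding z1_z2_def by simp_all
    then obtain a b where ab: "t1 = flip a z1" "t2 = flip b z1" unfolding adj_def by metis
    obtain a' where a': "t1 = flip a' z2" using adjs(3) unfolding adj_def by metis
    have "flip a z1 = flip a' z2" using ab a' by simp
    then have "sdiff z1 z2 = {a, a'}" by (rule flip_eq_flipD[OF _ ne])
    then have "a \<in> sdiff c z1 \<or> a \<in> sdiff c z2" unfolding sdiff_def by blast
    then have a: "a \<in> sdiff c y1 \<or> a \<in> sdiff c y2" using z by blast
    have "flip a t1 = flip b t2" using ab by simp
    then have "sdiff t1 t2 = {a, b}" by (rule flip_eq_flipD[OF _ T(3)])
    then have "a \<in> sdiff t1 t2" by blast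
    then obtain x where x: "x \<in> F" "a \<in> sdiff c x" "\<forall>s\<in>S. adj (flip a x) s" using varyT[OF T(1,2)] by blast
    then have "ev x = ev s1" using evadj S(1) by blast
    moreover have "x = y1 \<or> x = y2" using disj a x(1,2) y1(1) y2(1) by blast
    ultimately have "ev s1 = ev t1" using evy by blast
    then show False using ev S(1) T(1) by blast
  qed
  have "y1 \<noteq> y2"
  proof
    assume "y1 = y2"
    then have "flip l1 y1 = flip l2 y1" using \<open>z1 = z2\<close> unfolding z1_z2_def by simp
    then show False using \<open>l1 \<noteq> l2\<close> by simp
  qed
  \<comment> \<open>Being both \<open>z1\<close> and \<open>z2\<close>, this vertex differs from
    \<open>c\<close> only in coordinates shared by the disjoint sets of \<open>y1\<close> and
    \<open>y2\<close>.\<close>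
  have "sdiff c z1 = {}"
  proof (rule ccontr)
    assume "sdiff c z1 \<noteq> {}"
    then obtain a where "a \<in> sdiff c z1" by blast
    then have "a \<in> sdiff c y1" "a \<in> sdiff c y2" using z \<open>z1 = z2\<close> by auto
    then show False using disj y1(1) y2(1) \<open>y1 \<noteq> y2\<close> by blast
  qed
  then have "c = z1" by (simp add: sdiff_eq_empty_iff)
  then show ?thesis using y1(3) T(1) unfolding z1_z2_def by blast
qed

lemma pow_bound:
  assumes "5 \<le> n"
  shows "2 * n \<le> 2 ^ (n - 2) + (3::nat)"
proof -
  have *: "2 * (m + 5) \<le> 2 ^ (m + 3) + (3::nat)" for m by (induction m) (auto simp: power_add)
  obtain m where "n = m + 5" using le_Suc_ex[OF assms] by auto
  then show ?thesis using *[of m] by (simp add: add.commute)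
qed

subsection \<open>A minimal counterexample\<close>

text \<open>\<open>alive\<close> grants every terminal two fault-free neighbours, and
  \<open>big\<close> says that the few-faults theorem does not apply.\<close>

locale conditional =
  fixes I z :: "'a set" and F S T :: "'a set set" and p :: bool
  assumes finI: "finite I" and finz: "finite z" and FI: "F \<subseteq> cube I z"
    and tr: "terminals p (cube I z - F) S T"
    and n5: "5 \<le> card I" and k1: "1 \<le> card S"
    and fk: "card F + 2 * card S + 3 \<le> 2 * card I" and big: "card I \<le> card S + card F"
    and alive: "\<And>v. v \<in> S \<union> T \<Longrightarrow> faulty_degree I F v + 2 \<le> card I"
    and sb: "solved_below TYPE('a) (card I)"
    and unsolved: "\<not> linkable I z F S T"
begin

lemmas ST = terminalsD[OF tr]

lemma swap: "conditional I z F T S (\<not> p)"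
proof (unfold_locales, fact finI, fact finz, fact FI)
  show "terminals (\<not> p) (cube I z - F) T S" by (rule terminals_sym[OF tr])
  show "5 \<le> card I" by (fact n5)
  show "1 \<le> card T" "card F + 2 * card T + 3 \<le> 2 * card I" "card I \<le> card T + card F"
    using k1 fk big ST(5) by simp_all
  show "faulty_degree I F v + 2 \<le> card I" if "v \<in> T \<union> S" for v using alive that by blast
  show "solved_below TYPE('a) (card I)" by (fact sb)
  show "\<not> linkable I z F T S" using unsolved linkable_sym by blast
qed

lemma fin: "finite F" "finite S" "finite T"
proof -
  have "finite (cube I z)" using finI finz by (rule finite_cube)
  then show "finite F" "finite S" "finite T" using FI ST(1,2) by (meson Diff_subset finite_subset)+
qed

lemma card_S_le: "card S + 3 \<le> card I" using big fk by linarith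

text \<open>The room needed to choose crossing vertices of one parity in a half; the second bound
  leaves space for one more fault.\<close>

lemma count_bound: "card F + card S + 1 \<le> 2 ^ (card I - 1 - 1)"
  "2 \<le> card S \<Longrightarrow> card F + card S + 2 \<le> 2 ^ (card I - 1 - 1)"
proof -
  have "2 * card I \<le> 2 ^ (card I - 1 - 1) + (3::nat)" using pow_bound[OF n5] by (simp only: diff_diff_left one_add_one)
  then show "card F + card S + 1 \<le> 2 ^ (card I - 1 - 1)"
    "2 \<le> card S \<Longrightarrow> card F + card S + 2 \<le> 2 ^ (card I - 1 - 1)"
    using fk k1 by linarith+
qed

lemma finv: "v \<in> F \<union> S \<union> T \<Longrightarrow> finite v"
  using FI ST(1,2) cube_finite_mem by blast

text \<open>\<open>N c i\<close> consists of the faults that the coordinate \<open>i\<close> separates from \<open>c\<close>.\<close>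

definition N :: "'a set \<Rightarrow> 'a \<Rightarrow> 'a set set" where
  "N c i = {x \<in> F. (i \<in> x) \<noteq> (i \<in> c)}"

text \<open>This is the hypothesis of \<open>alive_half\<close>: no terminal becomes dead in its
  half when the cube is split along \<open>i\<close>.\<close>

definition alive_at :: "'a \<Rightarrow> bool" where
  "alive_at i \<longleftrightarrow> (\<forall>v \<in> S \<union> T. faulty_degree I F v + 3 \<le> card I \<or> flip i v \<in> F)"

section \<open>Splits that fail in a minimal counterexample\<close>

lemma at_halves:
  assumes c: "c \<in> cube I z" and i: "i \<in> I"
  shows "halves I c i F" "halves.F1 I c i F = N c i" "card (halves.F0 I c i F) + card (N c i) = card F"
    "card (halves.J I i) = card I - 1"
    "S \<inter> halves.Q0 I c i = {v \<in> S. (i \<in> v) = (i \<in> c)}" "T \<inter> halves.Q0 I c i = {v \<in> T. (i \<in> v) = (i \<in> c)}"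
    "S \<inter> halves.Q1 I c i = {v \<in> S. (i \<in> v) \<noteq> (i \<in> c)}" "T \<inter> halves.Q1 I c i = {v \<in> T. (i \<in> v) \<noteq> (i \<in> c)}"
    "alive_at i \<Longrightarrow> v \<in> (S \<union> T) \<inter> halves.Q0 I c i \<Longrightarrow> v \<notin> dead (halves.J I i) c (halves.F0 I c i F)"
    "terminals p (cube I c - F) S T"
proof -
  show h: "halves I c i F" by (rule halves_ref[OF finI c i FI])
  interpret h: halves I c i F by (rule h)
  have sub: "F \<subseteq> cube I c" "S \<subseteq> cube I c" "T \<subseteq> cube I c" using FI ST(1,2) cube_cong[OF c] by auto
  show F1: "h.F1 = N c i" unfolding h.F1_def N_def by (rule h.ref_halves(2)[OF sub(1)])
  show "card h.F0 + card (N c i) = card F" using h.F01(5) unfolding F1 by simp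
  show "card h.J = card I - 1" using h.fJ(3) by simp
  show "S \<inter> h.Q0 = {v \<in> S. (i \<in> v) = (i \<in> c)}" "T \<inter> h.Q0 = {v \<in> T. (i \<in> v) = (i \<in> c)}"
    "S \<inter> h.Q1 = {v \<in> S. (i \<in> v) \<noteq> (i \<in> c)}" "T \<inter> h.Q1 = {v \<in> T. (i \<in> v) \<noteq> (i \<in> c)}"
    using h.ref_halves[OF sub(2)] h.ref_halves[OF sub(3)] by simp_all
  show "v \<notin> dead h.J c h.F0" if "alive_at i" "v \<in> (S \<union> T) \<inter> h.Q0"
    using that alive[of v] unfolding alive_at_def by (intro h.alive_half) auto
  show "terminals p (cube I c - F) S T" using tr cube_cong[OF c] by simp
qed

lemma card_agree:
  assumes "X \<subseteq> Y" "finite Y" "t \<in> Y" "t \<notin> X"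
  shows "card X \<le> card Y - 1"
proof -
  have "X \<subset> Y" using assms by blast
  then have "card X < card Y" by (rule psubset_card_mono[OF assms(2)])
  then show ?thesis by linarith
qed

text \<open>Were the inequality false, the larger side would meet the induction hypothesis with the
  same \<open>k\<close>, and the smaller one, with at most \<open>n - k - 2\<close> faults, would
  have few faults; the split would succeed.\<close>

lemma minor_bound:
  assumes c: "c \<in> cube I z" and i: "i \<in> I" and al: "alive_at i" and mi: "2 * card (N c i) \<le> card F"
  shows "2 * card I \<le> card F - card (N c i) + 2 * card S + 4"
proof (rule ccontr)
  assume neg: "\<not> ?thesis"
  interpret h: halves I c i F by (rule at_halves(1)[OF c i])
  note cd = at_halves[OF c i]
  have "card (S \<inter> h.Q0) \<le> card S" "card (T \<inter> h.Q0) \<le> card S"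
    using card_mono[OF fin(2), of "S \<inter> h.Q0"] card_mono[OF fin(3), of "T \<inter> h.Q0"] ST(5) by auto
  moreover have "card h.F0 + 2 * card S + 5 \<le> 2 * card I" using neg cd(3) by linarith
  moreover have "card h.F1 + card S + 2 \<le> card I" unfolding cd(2) using mi fk by linarith
  moreover have "card F + card S + 1 \<le> 2 ^ (card h.J - 1)" unfolding cd(4) by (rule count_bound)
  ultimately have "linkable I c F S T"
    by (intro h.split_cond[OF sb cd(10) cd(9)[OF al] n5 k1 k1 order_refl]) (use card_S_le in auto)
  then show False using unsolved linkable_cong[OF c] by blast
qed

text \<open>A source and a sink beyond the coordinate leave at most \<open>k - 1\<close> terminals
  of each kind on the side of \<open>c\<close>. One path fewer there makes up for its many
  faults.\<close>

lemma no_split: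
  assumes c: "c \<in> cube I z" and i: "i \<in> I" and al: "alive_at i" and mi: "card (N c i) \<le> 1"
    and s: "s \<in> S" "(i \<in> s) \<noteq> (i \<in> c)" and t: "t \<in> T" "(i \<in> t) \<noteq> (i \<in> c)" and k2: "2 \<le> card S"
  shows False
proof -
  interpret h: halves I c i F by (rule at_halves(1)[OF c i])
  note cd = at_halves[OF c i]
  have "card (S \<inter> h.Q0) \<le> card S - 1"
    unfolding cd(5) by (rule card_agree[OF _ fin(2) s(1)]) (use s(2) in auto)
  moreover have "card (T \<inter> h.Q0) \<le> card S - 1"
    unfolding cd(6) ST(5) by (rule card_agree[OF _ fin(3) t(1)]) (use t(2) in auto)
  moreover have "card h.F0 + 2 * (card S - 1) + 5 \<le> 2 * card I" using fk cd(3) k2 by linarith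
  moreover have "card h.F1 + card S + 2 \<le> card I" unfolding cd(2) using mi card_S_le by linarith
  moreover have "card F + card S + 1 \<le> 2 ^ (card h.J - 1)" unfolding cd(4) by (rule count_bound)
  moreover have "1 \<le> card S - 1" "card S - 1 \<le> card S" "card S - 1 + 3 \<le> card I" using k2 card_S_le by linarith+
  ultimately have "linkable I c F S T"
    by (intro h.split_cond[OF sb cd(10) cd(9)[OF al] n5 k1, of "card S - 1"])
  then show False using unsolved linkable_cong[OF c] by blast
qed

text \<open>When all sources are on the side of \<open>c\<close>, one of them can be demoted unless
  the path it sends across would enter the fault beyond. It crosses either at \<open>s\<close>
  itself or at a predecessor \<open>q\<close> of \<open>s\<close>, whence the last two
  hypotheses.\<close>

lemma no_shift:
  assumes c: "c \<in> cube I z" and i: "i \<in> I" and al: "alive_at i" and mi: "card (N c i) \<le> 1"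
    and S: "\<And>s. s \<in> S \<Longrightarrow> (i \<in> s) = (i \<in> c)" and t: "t0 \<in> T" "t1 \<in> T" "(i \<in> t0) \<noteq> (i \<in> t1)"
    and s: "s \<in> S" "flip i s \<notin> N c i"
    and nb: "\<And>q. adj q s \<Longrightarrow> q \<notin> F \<Longrightarrow> q \<notin> T \<Longrightarrow> flip i q \<notin> N c i"
  shows False
proof -
  interpret h: halves I c i F by (rule at_halves(1)[OF c i])
  note cd = at_halves[OF c i]
  have SQ: "S \<subseteq> h.Q0" using cd(5) S by blast
  have TQ: "T \<inter> h.Q0 \<noteq> {}" "T \<inter> h.Q1 \<noteq> {}" unfolding cd(6,8) using t by auto
  have "card h.F0 + 2 * card S + 3 \<le> 2 * card I" using fk cd(3) by linarith
  moreover have "card h.F1 + card S + 2 \<le> card I" unfolding cd(2) using mi card_S_le by linarith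
  moreover have "card F + card S + 1 \<le> 2 ^ (card h.J - 1)" unfolding cd(4) by (rule count_bound)
  ultimately have "linkable I c F S T"
    using s(2) nb SQ by (intro h.shift_cond[OF sb cd(10) s(1) SQ TQ cd(9)[OF al] n5]) (auto simp: cd(2))
  then show False using unsolved linkable_cong[OF c] by blast
qed

section \<open>Terminals with exactly two fault-free neighbours\<close>

lemma tight_unique:
  assumes "u \<in> S \<union> T" "v \<in> S \<union> T" "u \<noteq> v" "faulty_degree I F u + 2 = card I"
  shows "faulty_degree I F v + 3 \<le> card I"
proof (rule ccontr)
  assume "\<not> ?thesis"
  then have v: "faulty_degree I F v + 2 = card I" using alive[OF assms(2)] by linarith
  have same: "2 \<le> card X" if "u \<in> X" "v \<in> X" "finite X" for X
    using card_mono[OF that(3), of "{u, v}"] that assms(3) by simp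
  \<comment> \<open>Together \<open>u\<close> and \<open>v\<close> have \<open>2n - 4\<close> faulty
    neighbours. At most two are common, and only for equal parity; but then
    \<open>k \<ge> 2\<close>, which lowers the number of faults to at most
    \<open>2n - 7\<close>.\<close>
  show False
  proof (cases "ev u = ev v")
    case True
    then have "u \<in> S \<and> v \<in> S \<or> u \<in> T \<and> v \<in> T" using assms(1,2) ST(3,4) by blast
    then have "2 \<le> card S" using same[of S] same[of T] fin ST(5) by auto
    then show False using faulty_degree_add_le[OF finI fin(1) assms(3)] v assms(4) fk by linarith
  next
    case False
    then have "faulty_degree I F u + faulty_degree I F v \<le> card F"
      using faulty_degree_add_le_parity[OF finI fin(1)] finv assms(1,2) by blast
    then show False using v assms(4) fk k1 by linarith
  qed
qed

lemma tight_dims: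
  assumes "faulty_degree I F u + 2 = card I"
  shows "card {i \<in> I. flip i u \<in> F} = card I - 2" "card {i \<in> I. flip i u \<notin> F} = 2"
proof -
  show *: "card {i \<in> I. flip i u \<in> F} = card I - 2" using assms unfolding faulty_degree_def by simp
  have "{i \<in> I. flip i u \<in> F} \<union> {i \<in> I. flip i u \<notin> F} = I" by blast
  then have "card I = card ({i \<in> I. flip i u \<in> F} \<union> {i \<in> I. flip i u \<notin> F})" by simp
  also have "\<dots> = card {i \<in> I. flip i u \<in> F} + card {i \<in> I. flip i u \<notin> F}"
    by (rule card_Un_disjoint) (use finI in auto)
  finally show "card {i \<in> I. flip i u \<notin> F} = 2" using * n5 by linarith
qed

lemma tight_alive_at:
  assumes "u \<in> S \<union> T" "faulty_degree I F u + 2 = card I" "flip i u \<in> F"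
  shows "alive_at i"
  unfolding alive_at_def using tight_unique[OF assms(1) _ _ assms(2)] assms(3) by blast

lemma N_flip: "N c i \<union> N (flip i c) i = F" "N c i \<inter> N (flip i c) i = {}" "card (N c i) + card (N (flip i c) i) = card F"
proof -
  show *: "N c i \<union> N (flip i c) i = F" "N c i \<inter> N (flip i c) i = {}"
    unfolding N_def by (auto simp: mem_flip)
  then show "card (N c i) + card (N (flip i c) i) = card F"
    using card_Un_disjoint[of "N c i" "N (flip i c) i"] fin(1) by (metis finite_Un)
qed

lemma flip_cube: "c \<in> cube I z \<Longrightarrow> i \<in> I \<Longrightarrow> flip i c \<in> cube I z"
  by (simp add: flip_mem_cube_iff)

text \<open>If some terminal is tight, the coordinates leading to its faulty neighbours are usable,
  and one of them separates two of these neighbours. Otherwise every coordinate is usable.\<close>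

lemma ex_separating: "\<exists>i\<in>I. alive_at i \<and> (\<exists>x\<in>F. \<exists>y\<in>F. (i \<in> x) \<noteq> (i \<in> y))"
proof (cases "\<exists>u \<in> S \<union> T. faulty_degree I F u + 2 = card I")
  case True
  then obtain u where u: "u \<in> S \<union> T" "faulty_degree I F u + 2 = card I" by blast
  have "2 \<le> card {i \<in> I. flip i u \<in> F}" using tight_dims(1)[OF u(2)] n5 by linarith
  then obtain i j where ij: "i \<in> {i \<in> I. flip i u \<in> F}" "j \<in> {i \<in> I. flip i u \<in> F}" "i \<noteq> j"
    by (rule ex_two)
  then have "flip i u \<in> F" "flip j u \<in> F" "(i \<in> flip i u) \<noteq> (i \<in> flip j u)" by (simp_all add: mem_flip)
  then show ?thesis using tight_alive_at[OF u] ij(1) by blast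
next
  case False
  then have al: "alive_at i" for i
    unfolding alive_at_def using alive by (metis Suc_leI add_Suc_right le_neq_implies_less numeral_2_eq_2 numeral_3_eq_3)
  have "2 \<le> card F" using big card_S_le by linarith
  then obtain x y where xy: "x \<in> F" "y \<in> F" "x \<noteq> y" by (rule ex_two)
  then obtain i where "i \<in> I" "(i \<in> x) \<noteq> (i \<in> y)" using ex_dim[of x I z y] FI by blast
  then show ?thesis using al xy by blast
qed

text \<open>A usable coordinate that separates two faults has a smaller side with at least one
  fault, so \<open>minor_bound\<close> leaves no slack in \<open>fk\<close>. The base point is moved
  across if necessary to make \<open>N\<close> the smaller side.\<close>

lemma card_F_exact: "card F + 2 * card S + 3 = 2 * card I"
proof -
  obtain i x y where i: "i \<in> I" "alive_at i" "x \<in> F" "y \<in> F" "(i \<in> x) \<noteq> (i \<in> y)"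
    using ex_separating by blast
  have x: "x \<in> cube I z" using i FI by blast
  have "y \<in> N x i" "x \<in> N (flip i x) i" using i unfolding N_def by (auto simp: mem_flip)
  then have pos: "1 \<le> card (N x i)" "1 \<le> card (N (flip i x) i)"
    using fin(1) finite_subset[of "N x i" F] finite_subset[of "N (flip i x) i" F] N_def
    by (auto simp: Suc_le_eq card_gt_0_iff)
  consider "2 * card (N x i) \<le> card F" | "2 * card (N (flip i x) i) \<le> card F"
    using N_flip(3)[of x i] by linarith
  then show ?thesis
  proof cases
    case 1
    then show ?thesis using minor_bound[OF x i(1,2) 1] pos fk by linarith
  next
    case 2
    then show ?thesis using minor_bound[OF flip_cube[OF x i(1)] i(1,2) 2] pos fk by linarith
  qed
qed

lemma N_le_1:
  assumes c: "c \<in> cube I z" and i: "i \<in> I" and al: "alive_at i" and mi: "2 * card (N c i) \<le> card F"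
  shows "card (N c i) \<le> 1"
  using minor_bound[OF assms] card_F_exact mi by linarith

text \<open>The other \<open>n - 3 \<ge> 2\<close> faulty neighbours of \<open>u\<close> lie on the
  side of \<open>u\<close>. That side is therefore not the smaller one, and the opposite side has a
  single fault.\<close>

lemma tight_N:
  assumes u: "u \<in> S \<union> T" "faulty_degree I F u + 2 = card I" and l: "l \<in> I" "flip l u \<in> F"
  shows "N u l = {flip l u}"
proof -
  let ?L = "{i \<in> I. flip i u \<in> F}"
  have uc: "u \<in> cube I z" using u(1) ST(1,2) by blast
  have al: "alive_at l" by (rule tight_alive_at[OF u l(2)])
  have "(\<lambda>j. flip j u) ` (?L - {l}) \<subseteq> N (flip l u) l" unfolding N_def by (auto simp: mem_flip)
  then have "card ((\<lambda>j. flip j u) ` (?L - {l})) \<le> card (N (flip l u) l)"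
    using fin(1) unfolding N_def by (intro card_mono) auto
  moreover have "card ((\<lambda>j. flip j u) ` (?L - {l})) = card (?L - {l})"
    by (rule card_image) (simp add: inj_on_def)
  moreover have "card (?L - {l}) = card I - 3" using l finI tight_dims(1)[OF u(2)] by simp
  ultimately have c2: "2 \<le> card (N (flip l u) l)" using n5 by linarith
  have "2 * card (N u l) \<le> card F"
  proof (rule ccontr)
    assume "\<not> 2 * card (N u l) \<le> card F"
    then have "2 * card (N (flip l u) l) \<le> card F" using N_flip(3)[of u l] by linarith
    then show False using N_le_1[OF flip_cube[OF uc l(1)] l(1) al] c2 by linarith
  qed
  then have "card (N u l) \<le> 1" by (rule N_le_1[OF uc l(1) al])
  moreover have "flip l u \<in> N u l" using l(2) unfolding N_def by (simp add: mem_flip)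
  moreover have "finite (N u l)" using fin(1) unfolding N_def by simp
  ultimately show ?thesis by (metis One_nat_def card_le_Suc0_iff_eq is_singletonI' is_singleton_def singletonD empty_iff)
qed

text \<open>
  A terminal \<open>u\<close> with only two fault-free neighbours is the centre of the fault set. Either a
  coordinate in which \<open>T\<close> varies leads from \<open>u\<close> to a fault, and one splits along it; or one splits
  along a coordinate leading to a fault-free neighbour and lets the path from \<open>u\<close> cross at once.
\<close>

lemma no_tight_source:
  assumes u: "u \<in> S" "faulty_degree I F u + 2 = card I"
  shows False
proof -
  let ?L = "{l \<in> I. flip l u \<in> F}" and ?E = "{l \<in> I. flip l u \<notin> F}"
  have uc: "u \<in> cube I z" "u \<notin> F" "ev u = p" using u(1) ST(1,3) by blast+
  have uST: "u \<in> S \<union> T" using u(1) by blast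
  note NL = tight_N[OF uST u(2)]
  note alL = tight_alive_at[OF uST u(2)]
  have cL: "card ?L = card I - 2" "card ?E = 2" using tight_dims[OF u(2)] by blast+
  have finE: "finite ?E" using finI by simp
  \<comment> \<open>The faults not adjacent to \<open>u\<close>. By \<open>tight_N\<close> they
    agree with \<open>u\<close> in the coordinates of \<open>?L\<close>, hence differ from it
    exactly in the two of \<open>?E\<close>, so there is at most one.\<close>
  define R where "R = F - (\<lambda>l. flip l u) ` ?L"
  have Rsd: "sdiff u x = ?E" if "x \<in> R" for x
  proof -
    have xF: "x \<in> F" "x \<notin> (\<lambda>l. flip l u) ` ?L" using that unfolding R_def by blast+
    have sub: "sdiff u x \<subseteq> ?E"
    proof
      fix l assume l: "l \<in> sdiff u x"
      have lI: "l \<in> I" using sdiff_cube[of u I z x] uc xF FI l by blast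
      have "flip l u \<notin> F"
      proof
        assume lF: "flip l u \<in> F"
        have "x \<in> N u l" using l xF unfolding N_def by (auto simp: mem_sdiff)
        then have "x = flip l u" using NL[OF lI lF] by simp
        then show False using xF lI lF by blast
      qed
      then show "l \<in> ?E" using lI by simp
    qed
    have "card (sdiff u x) \<noteq> 0"
    proof
      assume "card (sdiff u x) = 0"
      then have "sdiff u x = {}" using finite_subset[OF sub finE] by simp
      then show False using uc(2) xF(1) by (simp add: sdiff_eq_empty_iff)
    qed
    moreover have "card (sdiff u x) \<noteq> 1"
    proof
      assume "card (sdiff u x) = 1"
      then obtain j where j: "sdiff u x = {j}" by (rule card_1_singletonE)
      then have "x = flip j u" by (rule sdiff_singleton)
      then show False using j sub xF(1) by auto
    qed
    moreover have "card (sdiff u x) \<le> 2" using card_mono[OF finE sub] cL(2) by simp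
    ultimately have "card (sdiff u x) = card ?E" unfolding cL(2) by linarith
    then show ?thesis by (rule card_subset_eq[OF finE sub])
  qed
  have "card R \<le> 1"
  proof (rule ccontr)
    assume "\<not> card R \<le> 1"
    then have "2 \<le> card R" by linarith
    then obtain x y where xy: "x \<in> R" "y \<in> R" "x \<noteq> y" by (rule ex_two)
    then have "sdiff u x = sdiff u y" using Rsd by simp
    then show False using xy(3) by (simp add: sdiff_eq_iff)
  qed
  have cF: "card F = card I - 2 + card R"
  proof -
    have sub: "(\<lambda>l. flip l u) ` ?L \<subseteq> F" by blast
    have "card R = card F - card ((\<lambda>l. flip l u) ` ?L)"
      unfolding R_def by (rule card_Diff_subset[OF finite_subset[OF sub fin(1)] sub])
    moreover have "card ((\<lambda>l. flip l u) ` ?L) \<le> card F" by (rule card_mono[OF fin(1) sub])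
    moreover have "card ((\<lambda>l. flip l u) ` ?L) = card ?L" by (rule card_image) (simp add: inj_on_def)
    ultimately show ?thesis using cL(1) by linarith
  qed
  \<comment> \<open>From \<open>f \<le> n - 1\<close> and \<open>f = 2n - 2k - 3\<close> follows
    \<open>2k \<ge> n - 2 \<ge> 3\<close>.\<close>
  have k2: "2 \<le> card S" using card_F_exact cF \<open>card R \<le> 1\<close> n5 k1 by linarith
  have "2 \<le> card T" using k2 ST(5) by simp
  then obtain t t' where tt: "t \<in> T" "t' \<in> T" "t \<noteq> t'" by (rule ex_two)
  have "t \<in> cube I z" "t' \<in> cube I z" using tt(1,2) ST(2) by blast+
  then obtain i where i: "i \<in> I" "(i \<in> t) \<noteq> (i \<in> t')" using ex_dim tt(3) by meson
  obtain t1 where t1: "t1 \<in> T" "(i \<in> t1) \<noteq> (i \<in> u)" using tt i(2) by metis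
  show False
  proof (cases "flip i u \<in> F")
    case True
    note N = NL[OF i(1) True]
    have c1: "card (N u i) \<le> 1" unfolding N by simp
    show False
    proof (cases "\<exists>s\<in>S. (i \<in> s) \<noteq> (i \<in> u)")
      case True
      then show False using no_split[OF uc(1) i(1) alL c1 _ _ t1 k2] \<open>flip i u \<in> F\<close> by blast
    next
      case nS: False
      have "S \<noteq> {u}" using k2 by auto
      then obtain s where s: "s \<in> S" "s \<noteq> u" using u(1) by blast
      have s1: "flip i s \<notin> N u i" unfolding N using s(2) by simp
      show False
      proof (rule no_shift[OF uc(1) i(1) alL[OF True] c1 _ tt(1,2) i(2) s(1) s1])
        show "(i \<in> s) = (i \<in> u)" if "s \<in> S" for s using nS that by blast
        show "flip i q \<notin> N u i" if q: "adj q s" for q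
        proof
          assume "flip i q \<in> N u i"
          then have "q = u" unfolding N by simp
          then have "ev s = (\<not> ev u)" using ev_adj[OF q] finv u(1) by blast
          then show False using ST(3) s(1) u(1) by blast
        qed
      qed
    qed
  next
    case nF: False
    \<comment> \<open>Declaring \<open>?v\<close> faulty leaves \<open>u\<close> a single usable
      neighbour. Hence no linkage for other terminals can visit \<open>u\<close>, and
      \<open>u\<close> and \<open>?v\<close> are free to form the start of a path.\<close>
    let ?v = "flip i u" and ?F = "insert (flip i u) F"
    have vc: "?v \<in> cube I z" by (rule flip_cube[OF uc(1) i(1)])
    have cv: "cube I u = cube I z" by (rule cube_cong[OF uc(1)])
    have fu: "finite u" using finv u(1) by blast
    have FI': "?F \<subseteq> cube I z" using FI vc by blast
    interpret h: halves I u i F by (rule halves_ref[OF finI uc(1) i(1) FI])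
    interpret h': halves I u i ?F by (rule halves_ref[OF finI uc(1) i(1) FI'])
    note cd = at_halves[OF uc(1) i(1)]
    have uQ: "u \<in> h.Q0" unfolding h.Q0_def by (rule cube_self[OF fu])
    have vQ: "?v \<in> h.Q1" "?v \<notin> h.Q0" using uQ h.flipQ(1) h.Q(2) by blast+
    have F0: "h'.F0 = h.F0" unfolding h'.F0_def h.F0_def using vQ by blast
    have F1: "h'.F1 = insert ?v (N u i)" unfolding h'.F1_def cd(2)[symmetric] h.F1_def using vQ by blast
    have cF': "card ?F = card F + 1" using nF fin(1) by simp
    have NR: "N u i \<subseteq> R"
    proof
      fix x assume x: "x \<in> N u i"
      have "x \<noteq> flip l u" if "l \<in> ?L" for l
        using x that nF unfolding N_def by (auto simp: mem_flip)
      then show "x \<in> R" using x unfolding R_def N_def by blast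
    qed
    have finR: "finite R" unfolding R_def using fin(1) by simp
    have cN: "card (N u i) \<le> card R" by (rule card_mono[OF finR NR])
    \<comment> \<open>The exact count gives \<open>n = 2k + 1 + card R\<close>, and
      \<open>k \<ge> 2\<close>.\<close>
    have room: "card (N u i) + card S + 3 \<le> card I"
      using cN \<open>card R \<le> 1\<close> cF card_F_exact k2 card_S_le by linarith
    have cF1: "card h'.F1 \<le> card (N u i) + 1" unfolding F1 by (rule card_insert_le_m1) simp_all
    have deadS: "w \<notin> dead h'.J u h'.F0" if "w \<in> S \<union> T" "w \<in> h.Q0" "w \<noteq> u" for w
      unfolding F0 using h.alive_half[OF that(2)] tight_unique[OF uST that(1) _ u(2)] that(3) by blast
    have SQ: "card (S \<inter> h.Q0 - {u}) \<le> card S - 1"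
      by (rule card_agree[OF _ fin(2) u(1)]) auto
    have TQ: "card (T \<inter> h.Q0) \<le> card S - 1"
      unfolding cd(6) ST(5) by (rule card_agree[OF _ fin(3) t1(1)]) (use t1(2) in auto)
    have nd: "u \<notin> C" if C: "C \<subseteq> cube I u - ?F" "linkage S' T' C" "u \<notin> S'" "u \<notin> T'" for C S' T'
    proof
      assume "u \<in> C"
      then obtain x y where xy: "x \<in> C" "y \<in> C" "x \<noteq> y" "adj u x" "adj u y"
        using linkage_two_neighbours[OF C(2) _ C(3,4)] by blast
      have *: "\<exists>a \<in> ?E - {i}. w = flip a u" if w: "w \<in> C" "adj u w" for w
      proof -
        have wc: "w \<in> cube I z" "w \<notin> F" "w \<noteq> ?v" using w(1) C(1) cv by blast+
        then obtain a where "a \<in> I" "w = flip a u" using adj_cube_imp_flip[OF uc(1)] w(2) by blast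
        then show ?thesis using wc by blast
      qed
      obtain a b where ab: "a \<in> ?E - {i}" "x = flip a u" "b \<in> ?E - {i}" "y = flip b u"
        using *[OF xy(1,4)] *[OF xy(2,5)] by blast
      have "card (?E - {i}) = 1" using cL(2) finE i(1) nF by simp
      then have "a = b" using ab(1,3) by (metis card_1_singletonE singletonD)
      then show False using ab xy(3) by simp
    qed
    have conds: "1 \<le> card S - 1" "card S - 1 + 3 \<le> card I"
      "card h'.F0 + 2 * (card S - 1) + 5 \<le> 2 * card I"
      using k2 card_S_le fk cd(3) unfolding F0 by linarith+
    have J': "card h'.J = card I - 1" using h'.fJ(3) by simp
    have le': "card ?F + card S + 1 \<le> 2 ^ (card h'.J - 1)"
      unfolding J' cF' using count_bound(2)[OF k2] by linarith
    have ev': "ev ?v = (\<not> p)" using ev_flip[OF fu] uc(3) by blast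
    have step_v: "adj u ?v" by simp
    \<comment> \<open>The vertices \<open>u\<close> and \<open>?v\<close> make up for the two that
      the additional fault costs.\<close>
    have finish: False
      if C: "C \<subseteq> cube I u - ?F" "2 ^ card I \<le> card C + 2 * card ?F" "u \<notin> C"
        and l: "linkage S T ({u, ?v} \<union> C)" for C
    proof -
      have "finite C" using linkage_subset[OF l] by simp
      moreover have "?v \<notin> C" using C(1) by blast
      ultimately have "card ({u, ?v} \<union> C) = card C + 2" using C(3) by simp
      moreover have "{u, ?v} \<union> C \<subseteq> cube I u - F" using C(1) uc vc nF cv by blast
      ultimately have "linkable I u F S T" unfolding linkable_def using l C(2) cF' by (intro exI[of _ "{u, ?v} \<union> C"]) simp
      then show False using unsolved linkable_cong[OF uc(1)] by blast
    qed
    show False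
    proof (cases "?v \<in> T")
      case True
      have tr': "terminals p (cube I u - ?F) (S - {u}) (T - {?v})"
        using tr True u(1) fin ST(5) ev' cv unfolding terminals_def by auto
      have c1: "card (S - {u}) = card S - 1" using fin(2) u(1) by simp
      have c2: "card (T - {?v}) = card S - 1" using fin(3) True ST(5) by simp
      have "linkable I u ?F (S - {u}) (T - {?v})"
      proof (rule h'.split_cond[OF sb tr' _ n5 _ conds(1) _ _ _ conds(2,3)])
        show "w \<notin> dead h'.J u h'.F0" if "w \<in> (S - {u} \<union> (T - {?v})) \<inter> h'.Q0" for w
          using deadS[of w] that uc(3) ST(4) u(1) by blast
        show "card ((S - {u}) \<inter> h'.Q0) \<le> card S - 1"
        proof -
          have "(S - {u}) \<inter> h'.Q0 = S \<inter> h.Q0 - {u}" by blast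
          then show ?thesis using SQ by simp
        qed
        show "card ((T - {?v}) \<inter> h'.Q0) \<le> card S - 1"
          using card_mono[of "T - {?v}" "(T - {?v}) \<inter> h'.Q0"] fin(3) c2 by simp
        show "card h'.F1 + card (S - {u}) + 2 \<le> card I" unfolding c1 using cF1 room k2 by linarith
        show "card ?F + card (S - {u}) + 1 \<le> 2 ^ (card h'.J - 1)" unfolding c1 using le' by linarith
      qed (use c1 conds(1) in auto)
      then obtain C where C: "C \<subseteq> cube I u - ?F" "linkage (S - {u}) (T - {?v}) C" "2 ^ card I \<le> card C + 2 * card ?F"
        unfolding linkable_def by blast
      have uC: "u \<notin> C" using nd[OF C(1,2)] ST(6) u(1) by blast
      have vC: "?v \<notin> C" using C(1) by blast
      have "path_on u ?v {u, ?v}" using path_on.step[OF path_on.single[of ?v] step_v] by simp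
      from linkage.add[OF this C(2)] have "linkage (insert u (S - {u})) (insert ?v (T - {?v})) ({u, ?v} \<union> C)"
        using uC vC by blast
      then have "linkage S T ({u, ?v} \<union> C)" using u(1) True by (simp add: insert_absorb)
      then show False by (rule finish[OF C(1,3) uC])
    next
      case vT: False
      \<comment> \<open>The path from \<open>u\<close> goes through \<open>?v\<close> to a further
        neighbour of \<open>?v\<close> in the second half, which replaces \<open>u\<close> as a
        source.\<close>
      have "\<not> (\<lambda>j. flip j ?v) ` (I - {i}) \<subseteq> N u i \<union> (S - {u})"
      proof
        assume sub: "(\<lambda>j. flip j ?v) ` (I - {i}) \<subseteq> N u i \<union> (S - {u})"
        have "finite (N u i \<union> (S - {u}))" using fin unfolding N_def by simp
        then have "card ((\<lambda>j. flip j ?v) ` (I - {i})) \<le> card (N u i \<union> (S - {u}))"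
          using sub by (rule card_mono)
        moreover have "card ((\<lambda>j. flip j ?v) ` (I - {i})) = card I - 1"
          using i(1) finI by (subst card_image) (auto simp: inj_on_def)
        moreover have "card (N u i \<union> (S - {u})) \<le> card (N u i) + (card S - 1)"
          using card_Un_le[of "N u i" "S - {u}"] fin(2) u(1) by simp
        ultimately show False using room by linarith
      qed
      then obtain w where w: "w \<in> (\<lambda>j. flip j ?v) ` (I - {i})" "w \<notin> N u i \<union> (S - {u})" by blast
      obtain j where j0: "j \<in> I - {i}" "w = flip j ?v" using w(1) by (rule imageE)
      have j: "j \<in> I" "j \<noteq> i" "flip j ?v \<notin> N u i" "flip j ?v \<notin> S - {u}"
        using w(2) j0 by auto
      let ?r = "flip j ?v"
      have r1: "(i \<in> ?r) \<noteq> (i \<in> u)" using j(2) by (simp add: mem_flip)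
      have rc: "?r \<in> cube I z" by (rule flip_cube[OF vc j(1)])
      have rF: "?r \<notin> F" using j(3) r1 unfolding N_def by blast
      have ru: "?r \<noteq> u" using r1 by blast
      have rS: "?r \<notin> S" using j(4) ru by blast
      have rev: "ev ?r = p" using ev_flip[of ?v j] ev' fu by simp
      have rQ: "?r \<notin> h.Q0" using h.Q0_iff[of ?r] rc cv r1 by blast
      let ?S = "insert ?r (S - {u})"
      have "card ?S = Suc (card (S - {u}))" by (rule card_insert_disjoint) (use fin(2) rS in auto)
      then have c1: "card ?S = card S" using card_Suc_Diff1[OF fin(2) u(1)] by simp
      have tr': "terminals p (cube I u - ?F) ?S T"
        using tr vT rc rF rev ev' cv c1 unfolding terminals_def by auto
      have "?S \<inter> h.Q0 = (S - {u}) \<inter> h.Q0" using rQ by simp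
      also have "\<dots> = S \<inter> h.Q0 - {u}" by blast
      finally have SQ': "?S \<inter> h.Q0 = S \<inter> h.Q0 - {u}" .
      have "linkable I u ?F ?S T"
      proof (rule h'.split_cond[OF sb tr' _ n5 _ conds(1) _ _ TQ conds(2,3)])
        show "w \<notin> dead h'.J u h'.F0" if "w \<in> (?S \<union> T) \<inter> h'.Q0" for w
        proof -
          have "w \<noteq> ?r" using that rQ by blast
          moreover have "u \<notin> T" using ST(6) u(1) by blast
          ultimately show ?thesis using deadS[of w] that ru by blast
        qed
        show "card (?S \<inter> h'.Q0) \<le> card S - 1" unfolding SQ' by (rule SQ)
        show "card h'.F1 + card ?S + 2 \<le> card I" unfolding c1 using cF1 room by linarith
        show "card ?F + card ?S + 1 \<le> 2 ^ (card h'.J - 1)" unfolding c1 by (rule le')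
        show "1 \<le> card ?S" "card S - 1 \<le> card ?S" unfolding c1 using k1 by simp_all
      qed
      then obtain C where C: "C \<subseteq> cube I u - ?F" "linkage ?S T C" "2 ^ card I \<le> card C + 2 * card ?F"
        unfolding linkable_def by blast
      have uS: "u \<notin> ?S" "u \<notin> T" using ru ST(6) u(1) by blast+
      have uC: "u \<notin> C" by (rule nd[OF C(1,2) uS])
      have vC: "?v \<notin> C" using C(1) by blast
      obtain t A B where tA: "path_on ?r t A" "linkage (?S - {?r}) (T - {t}) B" "A \<inter> B = {}" "A \<union> B = C" "t \<in> T"
        using linkage_extract_source[OF C(2), of ?r] by blast
      have SS: "?S - {?r} = S - {u}" using rS by blast
      have "adj ?v ?r" by simp
      have "path_on ?v t (insert ?v A)" using path_on.step[OF tA(1) \<open>adj ?v ?r\<close>] vC tA(4) by blast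
      moreover have "u \<notin> insert ?v A" using uC tA(4) by auto
      ultimately have "path_on u t (insert u (insert ?v A))" by (rule path_on.step[OF _ step_v])
      from linkage.add[OF this tA(2)[unfolded SS]]
      have "linkage (insert u (S - {u})) (insert t (T - {t})) (insert u (insert ?v A) \<union> B)"
        using tA(3,4) uC vC by blast
      then have "linkage S T ({u, ?v} \<union> C)"
        using u(1) tA(4,5) by (simp add: insert_absorb)
      then show False by (rule finish[OF C(1,3) uC])
    qed
  qed
qed

lemma no_tight:
  assumes "v \<in> S \<union> T"
  shows "faulty_degree I F v + 3 \<le> card I"
proof (rule ccontr)
  assume "\<not> ?thesis"
  then have v: "faulty_degree I F v + 2 = card I" using alive[OF assms] by linarith
  interpret sw: conditional I z F T S "\<not> p" by (rule swap)
  show False using assms no_tight_source[OF _ v] sw.no_tight_source[OF _ v] by blast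
qed

section \<open>The centre of the fault set and the case of several paths\<close>

lemma all_alive: "alive_at i"
  unfolding alive_at_def using no_tight by blast

lemma N_disjoint:
  assumes "card (N c i) \<le> 1" "x \<in> F" "y \<in> F" "i \<in> sdiff c x" "i \<in> sdiff c y"
  shows "x = y"
proof -
  have "x \<in> N c i" "y \<in> N c i" using assms(2-5) unfolding N_def sdiff_def by auto
  moreover have "finite (N c i)" using fin(1) unfolding N_def by simp
  ultimately show ?thesis using assms(1) by (metis One_nat_def card_le_Suc0_iff_eq)
qed

lemma ex_majority: "\<exists>c\<in>cube I z. \<forall>i. card (N c i) \<le> 1"
proof -
  have "F \<noteq> {}" using big card_S_le by auto
  then obtain c where c: "c \<in> cube I z" and mi: "\<And>i. 2 * card (N c i) \<le> card F"
    using ex_center[OF finI fin(1) FI] unfolding N_def by blast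
  have "card (N c i) \<le> 1" for i
  proof (cases "i \<in> I")
    case True
    then show ?thesis using N_le_1[OF c _ all_alive mi] by blast
  next
    case False
    then have "N c i = {}" using c FI unfolding N_def cube_def by blast
    then show ?thesis by simp
  qed
  then show ?thesis using c by blast
qed

text \<open>By \<open>no_split\<close> all sources are on the side of \<open>c\<close>, and by
  \<open>no_shift\<close> each of them is obstructed by the one fault \<open>y\<close> beyond: it
  equals \<open>flip i y\<close> or is adjacent to it. Equality is impossible, since another source
  would then be adjacent to a source.\<close>

lemma vary_sink:
  assumes c: "c \<in> cube I z" and mi: "\<And>i. card (N c i) \<le> 1" and k2: "2 \<le> card S"
    and t: "t \<in> T" "t' \<in> T" "i \<in> sdiff t t'"
  shows "\<exists>y\<in>F. i \<in> sdiff c y \<and> (\<forall>s\<in>S. adj (flip i y) s)"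
proof (rule ccontr)
  assume bad: "\<not> ?thesis"
  have "t \<in> cube I z" "t' \<in> cube I z" using t(1,2) ST(2) by blast+
  then have i: "i \<in> I" using sdiff_cube t(3) by blast
  have it: "(i \<in> t) \<noteq> (i \<in> t')" by (rule iffD1[OF mem_sdiff t(3)])
  obtain t1 where t1: "t1 \<in> T" "(i \<in> t1) \<noteq> (i \<in> c)" using t(1,2) it by metis
  have nS: "(i \<in> s) = (i \<in> c)" if "s \<in> S" for s
    using no_split[OF c i all_alive mi that _ t1 k2] by blast
  obtain s1 s2 where s12: "s1 \<in> S" "s2 \<in> S" "s1 \<noteq> s2" using k2 by (rule ex_two)
  have fail: "flip i s \<in> N c i \<or> (\<exists>q. adj q s \<and> flip i q \<in> N c i)" if "s \<in> S" for s
    using no_shift[OF c i all_alive mi nS t(1,2) it that] by blast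
  then have "N c i \<noteq> {}" using s12(1) by blast
  then obtain y where "y \<in> N c i" by blast
  moreover have "finite (N c i)" using fin(1) unfolding N_def by simp
  ultimately have Ny: "x = y" if "x \<in> N c i" for x
    using mi[of i] that by (metis One_nat_def card_le_Suc0_iff_eq)
  have y: "y \<in> F" "i \<in> sdiff c y" using \<open>y \<in> N c i\<close> unfolding N_def sdiff_def by auto
  have sy: "s = flip i y \<or> adj (flip i y) s" if s: "s \<in> S" for s
    using fail[OF s]
  proof
    assume "flip i s \<in> N c i"
    then have "flip i s = y" by (rule Ny)
    then show ?thesis using flip_flip by metis
  next
    assume "\<exists>q. adj q s \<and> flip i q \<in> N c i"
    then obtain q where q: "adj q s" "flip i q = y" using Ny by blast
    then show ?thesis using flip_flip[of i q] by simp
  qed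
  have ne: "s \<noteq> flip i y" if s: "s \<in> S" for s
  proof
    assume e: "s = flip i y"
    obtain s' where s': "s' \<in> S" "s' \<noteq> s" using s12 by metis
    then have "adj s s'" using sy[of s'] e by blast
    then have "ev s' = (\<not> ev s)" using ev_adj finv s by blast
    then show False using ST(3) s s'(1) by blast
  qed
  then show False using bad y sy by blast
qed

lemma single_source: "card S = 1"
proof (rule ccontr)
  assume "card S \<noteq> 1"
  then have k2: "2 \<le> card S" using k1 by linarith
  interpret sw: conditional I z F T S "\<not> p" by (rule swap)
  have k2': "2 \<le> card T" using k2 ST(5) by simp
  obtain c where c: "c \<in> cube I z" and c1: "\<And>i. card (N c i) \<le> 1" using ex_majority by blast
  have c1': "card (sw.N c i) \<le> 1" for i using c1 unfolding N_def sw.N_def .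
  have disj: "x = y" if "x \<in> F" "y \<in> F" "i \<in> sdiff c x" "i \<in> sdiff c y" for x y i
    by (rule N_disjoint[OF c1 that])
  obtain s1 s2 where s: "s1 \<in> S" "s2 \<in> S" "s1 \<noteq> s2" using k2 by (rule ex_two)
  obtain t1 t2 where t: "t1 \<in> T" "t2 \<in> T" "t1 \<noteq> t2" using k2' by (rule ex_two)
  have ev: "ev s \<noteq> ev t" if "s \<in> S" "t \<in> T" for s t using ST(3)[OF that(1)] ST(4)[OF that(2)] by blast
  have "adj c t1"
    by (rule common_centre[OF disj finv s t ev vary_sink[OF c c1 k2] sw.vary_sink[OF c c1' k2']])
  moreover have "adj c s1"
  proof (rule common_centre[OF disj _ t s _ sw.vary_sink[OF c c1' k2'] vary_sink[OF c c1 k2]])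
    show "finite v" if "v \<in> F \<union> T \<union> S" for v using finv that by blast
    show "ev a \<noteq> ev b" if "a \<in> T" "b \<in> S" for a b using ev that by blast
  qed
  ultimately have "ev t1 = (\<not> ev c)" "ev s1 = (\<not> ev c)" using ev_adj cube_finite_mem[OF c] by blast+
  then show False using ev s(1) t(1) by blast
qed

text \<open>
  By counting coordinates, the dimension is at most six and the faults are, relative to \<open>c\<close>,
  singletons, possibly the empty set, and (in dimension five) at most one pair.
\<close>

lemma separated_False:
  assumes st: "S = {s}" "T = {t}" and c: "c \<in> cube I z" and c1: "\<And>i. card (N c i) \<le> 1"
    and i: "i \<in> I" "(i \<in> s) = (i \<in> c)" "(i \<in> t) \<noteq> (i \<in> c)"
  shows False
proof -
  have cF: "card F + 5 = 2 * card I" using card_F_exact st(1) by simp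
  have fc: "finite c" using cube_finite_mem[OF c] .
  interpret h: halves I c i F by (rule halves_ref[OF finI c i(1) FI])
  note cd = at_halves[OF c i(1)]
  have cF0: "card F \<le> card h.F0 + 1" using cd(3) c1[of i] by linarith
  have scube: "s \<in> cube I z" "t \<in> cube I z" "s \<notin> F" "t \<notin> F" using st ST(1,2) by blast+
  have evst: "ev t \<noteq> ev s" using ST(3)[of s] ST(4)[of t] st by simp
  have sQ: "s \<in> h.Q0" using h.Q0_iff[of s] scube(1) cube_cong[OF c] i(2) by blast
  have tQ: "t \<in> h.Q1 - h.F1" using h.Q1_iff[of t] scube cube_cong[OF c] i(3) h.F1_def by blast
  have F0i: "(i \<in> x) = (i \<in> c)" "x \<in> F" if "x \<in> h.F0" for x
    using that h.ref_halves(1)[of F] h.FI unfolding h.F0_def by blast+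
  \<comment> \<open>It is enough to find a long path from \<open>s\<close> in the half of
    \<open>c\<close> whose end has a fault-free neighbour across.\<close>
  have finish: False
    if w: "path_on s w C" "C \<subseteq> h.Q0" "C \<inter> h.F0 = {}" "ev w \<noteq> ev s" "flip i w \<notin> N c i"
      "2 ^ (card I - 1) \<le> card C + 2 * card h.F0" for w C
  proof -
    have "linkable I c F {s} {t}"
      by (rule h.join_across[OF w(1) _ w(4) _ tQ evst])
        (use w cd(2,4) c1[of i] n5 in auto)
    then show False using unsolved linkable_cong[OF c] st by simp
  qed
  have disj: "x = y" if "x \<in> F" "y \<in> F" "l \<in> sdiff c x" "l \<in> sdiff c y" for x y l
    by (rule N_disjoint[OF c1 that])
  let ?G = "F - {c}"
  have finG: "finite ?G" using fin(1) by simp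
  have sdI: "sdiff c x \<subseteq> I" if "x \<in> ?G" for x using sdiff_cube[OF c] FI that by blast
  have sd1: "1 \<le> card (sdiff c x)" if "x \<in> ?G" for x
  proof -
    have "sdiff c x \<noteq> {}" using that by (auto simp: sdiff_eq_empty_iff)
    then show ?thesis using finite_subset[OF sdI[OF that] finI] by (simp add: Suc_leI card_gt_0_iff)
  qed
  have sum: "(\<Sum>x\<in>?G. card (sdiff c x)) \<le> card I"
  proof -
    have "(\<Sum>x\<in>?G. card (sdiff c x)) = card (\<Union>x\<in>?G. sdiff c x)"
    proof (rule card_UN_disjoint[symmetric, OF finG])
      show "\<forall>x\<in>?G. finite (sdiff c x)" using sdI finI by (meson finite_subset)
      show "\<forall>x\<in>?G. \<forall>y\<in>?G. x \<noteq> y \<longrightarrow> sdiff c x \<inter> sdiff c y = {}" using disj by blast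
    qed
    also have "\<dots> \<le> card I" by (rule card_mono[OF finI]) (use sdI in blast)
    finally show ?thesis .
  qed
  have cG: "card F \<le> card ?G + 1" using diff_card_le_card_Diff[of "{c}" F] by simp
  have single: "\<exists>j\<in>I. x = flip j c" if x: "x \<in> ?G" "card (sdiff c x) = 1" for x
  proof -
    obtain j where "sdiff c x = {j}" using x(2) by (rule card_1_singletonE)
    then show ?thesis using sdI[OF x(1)] sdiff_singleton[of c x j] by blast
  qed
  have J: "finite h.J" "card h.J = card I - 1" using h.fJ(1) cd(4) by simp_all
  have ball: False
    if ne: "s \<noteq> c" and F0: "\<And>x. x \<in> h.F0 \<Longrightarrow> x = c \<or> (\<exists>j\<in>h.J. x = flip j c)"
      and F1: "\<And>w. flip i w \<in> N c i \<Longrightarrow> w = c \<or> (\<exists>j\<in>h.J. w = flip j c)" and n6: "card I \<le> 6"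
  proof -
    have "\<exists>w C. C \<subseteq> cube h.J c \<and> path_on s w C \<and> ev w \<noteq> ev s \<and> 2 ^ (card I - 1) \<le> card C + 2 * card h.F0 \<and>
      (\<forall>v\<in>C - {s}. v \<noteq> c \<and> (\<forall>j\<in>h.J. v \<noteq> flip j c))"
    proof (cases "card I = 5")
      case True
      have "card h.J = 4" using True J by simp
      from ex_path_avoiding_ball_4[OF J(1) this sQ[unfolded h.Q0_def] ne fc]
      obtain w C where wC: "C \<subseteq> cube h.J c" "path_on s w C" "ev w \<noteq> ev s" "8 \<le> card C"
        "\<forall>v\<in>C - {s}. v \<noteq> c \<and> (\<forall>j\<in>h.J. v \<noteq> flip j c)" by blast
      have "2 ^ (card I - 1) \<le> card C + 2 * card h.F0" using True wC(4) cF cF0 by simp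
      then show ?thesis using wC by blast
    next
      case False
      then have n: "card I = 6" using n5 n6 by linarith
      have "card h.J = 5" using n J by simp
      from ex_path_avoiding_ball_5[OF J(1) this sQ[unfolded h.Q0_def] ne fc]
      obtain w C where wC: "C \<subseteq> cube h.J c" "path_on s w C" "ev w \<noteq> ev s" "20 \<le> card C"
        "\<forall>v\<in>C - {s}. v \<noteq> c \<and> (\<forall>j\<in>h.J. v \<noteq> flip j c)" by blast
      have "2 ^ (card I - 1) \<le> card C + 2 * card h.F0" using n wC(4) cF cF0 by simp
      then show ?thesis using wC by blast
    qed
    then obtain w C where wC: "C \<subseteq> cube h.J c" "path_on s w C" "ev w \<noteq> ev s"
      "2 ^ (card I - 1) \<le> card C + 2 * card h.F0"
      and av: "\<forall>v\<in>C - {s}. v \<noteq> c \<and> (\<forall>j\<in>h.J. v \<noteq> flip j c)" by blast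
    have "C \<inter> h.F0 = {}"
    proof (rule ccontr)
      assume "C \<inter> h.F0 \<noteq> {}"
      then obtain v where v: "v \<in> C" "v \<in> h.F0" by blast
      then have "v \<noteq> s" using F0i(2) scube(3) by blast
      then show False using F0[OF v(2)] av v(1) by blast
    qed
    moreover have "flip i w \<notin> N c i"
    proof
      assume "flip i w \<in> N c i"
      then have "w = c \<or> (\<exists>j\<in>h.J. w = flip j c)" by (rule F1)
      moreover have "w \<in> C - {s}" using path_on_ends[OF wC(2)] wC(3) by blast
      ultimately show False using av by blast
    qed
    ultimately show False using finish[of w C] wC unfolding h.Q0_def by blast
  qed
  have jJ: "j \<in> h.J" if "j \<in> I" "j \<noteq> i" for j using that unfolding h.J_def by blast
  show False
  proof (cases "\<forall>x\<in>?G. card (sdiff c x) = 1")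
    case True
    then have "card ?G \<le> card I" using sum by simp
    \<comment> \<open>There are \<open>2n - 5\<close> faults, but at most one for each coordinate
      and the centre.\<close>
    then have n6: "card I \<le> 6" using cG cF by linarith
    have xs: "x = c \<or> (\<exists>j\<in>I. x = flip j c)" if "x \<in> F" for x
      using single[of x] True that by blast
    \<comment> \<open>Otherwise all \<open>2n - 5\<close> faults would be neighbours of the terminal
      \<open>s\<close>, which has at most \<open>n - 3\<close> faulty ones.\<close>
    have "s \<noteq> c"
    proof
      assume sc: "s = c"
      have "F \<subseteq> (\<lambda>j. flip j c) ` {j \<in> I. flip j c \<in> F}" using xs scube(3) sc by blast
      then have "card F \<le> faulty_degree I F c"
        unfolding faulty_degree_image[OF finI] by (rule card_mono[rotated]) (use finI in simp)
      moreover have "faulty_degree I F c + 3 \<le> card I" using no_tight[of c] st sc by blast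
      ultimately show False using cF n5 by linarith
    qed
    then show False
    proof (rule ball[OF _ _ _ n6])
      show "x = c \<or> (\<exists>j\<in>h.J. x = flip j c)" if x: "x \<in> h.F0" for x
      proof (cases "x = c")
        case False
        then obtain j where j: "j \<in> I" "x = flip j c" using xs F0i(2)[OF x] by blast
        then have "j \<noteq> i" using F0i(1)[OF x] by (auto simp: mem_flip)
        then show ?thesis using j jJ by blast
      qed simp
      show "w = c \<or> (\<exists>j\<in>h.J. w = flip j c)" if w: "flip i w \<in> N c i" for w
      proof -
        have wF: "flip i w \<in> F" "(i \<in> flip i w) \<noteq> (i \<in> c)" using w unfolding N_def by auto
        then obtain j where j: "j \<in> I" "flip i w = flip j c" using xs by blast
        then have "j = i" using wF(2) by (auto simp: mem_flip)
        then show ?thesis using j(2) by simp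
      qed
    qed
  next
    case False
    then obtain P where P: "P \<in> ?G" "card (sdiff c P) \<noteq> 1" by blast
    have P2: "2 \<le> card (sdiff c P)" using sd1[OF P(1)] P(2) by linarith
    have s1: "(\<Sum>x\<in>?G. card (sdiff c x)) = card (sdiff c P) + (\<Sum>x\<in>?G - {P}. card (sdiff c x))"
      by (rule sum.remove[OF finG P(1)])
    have "(\<Sum>x\<in>?G - {P}. 1) \<le> (\<Sum>x\<in>?G - {P}. card (sdiff c x))"
      by (rule sum_mono) (use sd1 in blast)
    then have s2: "card ?G - 1 \<le> (\<Sum>x\<in>?G - {P}. card (sdiff c x))" using P(1) finG by simp
    \<comment> \<open>The sizes add up to at least \<open>card ?G + 1 \<ge> 2n - 5\<close> and at
      most \<open>n\<close>. At \<open>n = 5\<close> all these estimates are equalities, which fixes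
      the shape of \<open>F\<close>.\<close>
    have n: "card I = 5" using s1 s2 sum P2 cG cF n5 by linarith
    have G4: "card ?G = 4" "card (sdiff c P) = 2" using s1 s2 sum P2 cG cF n by linarith+
    have others: "card (sdiff c x) = 1" if x: "x \<in> ?G" "x \<noteq> P" for x
    proof (rule ccontr)
      assume "card (sdiff c x) \<noteq> 1"
      then have x2: "2 \<le> card (sdiff c x)" using sd1[OF x(1)] by linarith
      have xP: "x \<in> ?G - {P}" using x by blast
      have s3: "(\<Sum>x\<in>?G - {P}. card (sdiff c x)) = card (sdiff c x) + (\<Sum>x\<in>?G - {P} - {x}. card (sdiff c x))"
        by (rule sum.remove[OF _ xP]) (use finG in simp)
      have "(\<Sum>x\<in>?G - {P} - {x}. 1) \<le> (\<Sum>x\<in>?G - {P} - {x}. card (sdiff c x))"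
        by (rule sum_mono) (use sd1 in blast)
      moreover have "card (?G - {P} - {x}) = 2" using G4(1) P(1) x finG by simp
      ultimately show False using s1 s3 sum x2 P2 n by simp
    qed
    have cinF: "c \<in> F"
    proof (rule ccontr)
      assume "c \<notin> F"
      then have "?G = F" by blast
      then show False using G4(1) cF n by simp
    qed
    have xs: "x = c \<or> x = P \<or> (\<exists>j\<in>I. x = flip j c)" if "x \<in> F" for x
      using single[of x] others[of x] that by blast
    have PF: "P \<in> F" "P \<noteq> c" using P(1) by blast+
    obtain d e where de: "sdiff c P = {d, e}" "d \<noteq> e" using G4(2) by (auto simp: card_2_iff)
    have deI: "d \<in> I" "e \<in> I" using sdI[OF P(1)] de(1) by blast+
    have Pde: "P = flip d (flip e c)"
    proof -
      have "sdiff c c = {}" by (simp add: sdiff_eq_empty_iff)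
      then have "sdiff c (flip d (flip e c)) = sdiff c P" using de by (simp add: sdiff_flip)
      then show ?thesis by (simp add: sdiff_eq_iff)
    qed
    have sc: "s \<noteq> c" using cinF scube(3) by blast
    show False
    proof (cases "i \<in> sdiff c P")
      \<comment> \<open>Here \<open>P\<close> is the only fault beyond the coordinate, and its
        neighbour across is adjacent to \<open>c\<close>. So avoiding the ball still makes the
        crossing safe.\<close>
      case True
      have PN: "P \<in> N c i" using True PF(1) unfolding N_def sdiff_def by auto
      have iP: "(i \<in> P) \<noteq> (i \<in> c)" using PN unfolding N_def by blast
      show False
      proof (rule ball[OF sc])
        show "x = c \<or> (\<exists>j\<in>h.J. x = flip j c)" if x: "x \<in> h.F0" for x
        proof (cases "x = c")
          case False
          moreover have "x \<noteq> P" using F0i(1)[OF x] iP by blast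
          ultimately obtain j where j: "j \<in> I" "x = flip j c" using xs F0i(2)[OF x] by blast
          then have "j \<noteq> i" using F0i(1)[OF x] by (auto simp: mem_flip)
          then show ?thesis using j jJ by blast
        qed simp
        show "w = c \<or> (\<exists>j\<in>h.J. w = flip j c)" if w: "flip i w \<in> N c i" for w
        proof -
          have "finite (N c i)" using fin(1) unfolding N_def by simp
          then have "flip i w = P" using c1[of i] w PN by (metis One_nat_def card_le_Suc0_iff_eq)
          then have w': "w = flip i P" using flip_flip by metis
          have "i = d \<or> i = e" using True de(1) by blast
          then show ?thesis
          proof
            assume "i = d"
            then show ?thesis using w' Pde de(2) deI(2) jJ[of e] by auto
          next
            assume "i = e"
            then show ?thesis using w' Pde de(2) deI(1) jJ[of d] flip_commute[of d e c] by auto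
          qed
        qed
        show "card I \<le> 6" using n by simp
      qed
    next
      case iP: False
      have deJ: "d \<in> h.J" "e \<in> h.J" using jJ deI iP de(1) by blast+
      have "card (h.J - {d, e}) = 2" using J n deJ de(2) by simp
      then obtain a b where ab: "h.J - {d, e} = {a, b}" "a \<noteq> b" by (auto simp: card_2_iff)
      have Jab: "h.J = {a, b, d, e}" using ab(1) deJ by blast
      have dist: "distinct [a, b, d, e]" using ab de(2) by auto
      let ?B = "{c, flip a c, flip b c, flip d (flip e c)}"
      have F0B: "h.F0 \<subseteq> ?B"
      proof
        fix x assume x: "x \<in> h.F0"
        show "x \<in> ?B"
        proof (cases "x = c \<or> x = P")
          case False
          then obtain j where j: "j \<in> I" "x = flip j c" using xs F0i(2)[OF x] by blast
          then have "j \<noteq> i" using F0i(1)[OF x] by (auto simp: mem_flip)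
          then have "j \<in> h.J" using jJ j(1) by blast
          moreover have "j \<notin> {d, e}"
          proof
            assume "j \<in> {d, e}"
            then have "j \<in> sdiff c P" using de(1) by blast
            moreover have "j \<in> sdiff c x" unfolding j(2) by (simp add: mem_sdiff mem_flip)
            ultimately have "x = P" using disj[OF F0i(2)[OF x] PF(1)] by blast
            then show False using False by blast
          qed
          ultimately have "j = a \<or> j = b" using ab(1) by blast
          then show ?thesis using j(2) by auto
        qed (use Pde in blast)
      qed
      \<comment> \<open>Since at least four of the five faults lie in this half, \<open>?B\<close>
        consists of faults only, and the terminal \<open>s\<close> is not in it.\<close>
      have "card ?B \<le> 4" by (simp add: card_insert_if)
      then have "?B = h.F0" using card_seteq[OF _ F0B] cF cF0 n by simp
      then have sB: "s \<notin> ?B" using F0i(2) scube(3) by blast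
      obtain w C where wC: "C \<subseteq> cube h.J c" "path_on s w C" "ev w \<noteq> ev s" "8 \<le> card C" "C \<inter> ?B = {}"
        using ex_path_avoiding_pair[OF dist _ fc sB] sQ unfolding h.Q0_def Jab by blast
      have "C \<inter> h.F0 = {}" using wC(5) F0B by blast
      moreover have "flip i w \<notin> N c i"
      proof
        assume w: "flip i w \<in> N c i"
        have wF: "flip i w \<in> F" "(i \<in> flip i w) \<noteq> (i \<in> c)" using w unfolding N_def by auto
        moreover have "(i \<in> P) = (i \<in> c)" using iP unfolding sdiff_def by blast
        ultimately obtain j where j: "j \<in> I" "flip i w = flip j c" using xs[of "flip i w"] by metis
        then have "j = i" using wF(2) by (auto simp: mem_flip)
        then have "w = c" using j(2) by simp
        then show False using wC(5) path_on_ends[OF wC(2)] by blast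
      qed
      moreover have "2 ^ (card I - 1) \<le> card C + 2 * card h.F0" using n wC(4) cF cF0 by simp
      ultimately show False using finish[OF wC(2) wC(1)[folded h.Q0_def] _ wC(3)] by blast
    qed
  qed
qed

lemma contradiction: False
proof -
  obtain s where s: "S = {s}" using single_source by (rule card_1_singletonE)
  obtain t where t: "T = {t}" using single_source[unfolded ST(5)] by (rule card_1_singletonE)
  have st: "s \<in> cube I z" "t \<in> cube I z" "s \<noteq> t" using s t ST(1,2,6) by auto
  obtain i where i: "i \<in> I" "(i \<in> s) \<noteq> (i \<in> t)" using ex_dim[OF st] .
  obtain c where c: "c \<in> cube I z" and c1: "\<And>i. card (N c i) \<le> 1" using ex_majority by blast
  \<comment> \<open>The terminal on the side of \<open>c\<close> is taken as the source; if it is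
    \<open>t\<close>, sources and sinks are exchanged.\<close>
  show False
  proof (cases "(i \<in> s) = (i \<in> c)")
    case True
    then show False using separated_False[OF s t c c1 i(1) True] i(2) by blast
  next
    case False
    interpret sw: conditional I z F T S "\<not> p" by (rule swap)
    have c1': "card (sw.N c i) \<le> 1" for i using c1 unfolding N_def sw.N_def .
    have "(i \<in> t) = (i \<in> c)" using False i(2) by blast
    then show False using sw.separated_False[OF t s c c1' i(1)] False by blast
  qed
qed

end

theorem linkable_conditional:
  fixes I :: "'a set"
  assumes "finite I" "finite z" "F \<subseteq> cube I z" "terminals p (cube I z - F) S T"
    "\<And>v. v \<in> S \<union> T \<Longrightarrow> faulty_degree I F v + 2 \<le> card I" "1 \<le> card S" "card S + 2 \<le> card I"
    "card F + 2 * card S + 3 \<le> 2 * card I"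
  shows "linkable I z F S T"
  using assms
proof (induction "card I" arbitrary: I z F S T p rule: less_induct)
  case less
  note prems = less.prems
  note ST = terminalsD[OF prems(4)]
  have sb: "solved_below TYPE('a) (card I)"
    unfolding solved_below_def solvable_def
  proof (intro allI impI)
    fix J c :: "'a set" and G K p S T
    assume *: "finite J" "finite c" "card J < card I" "G \<subseteq> cube J c" "K + 2 \<le> card J"
      "card G + 2 * K + 3 \<le> 2 * card J" "terminals p (cube J c - G - dead J c G) S T" "1 \<le> card S" "card S \<le> K"
    have tr: "terminals p (cube J c - G) S T" using *(7) unfolding terminals_def by blast
    have al: "faulty_degree J G v + 2 \<le> card J" if "v \<in> S \<union> T" for v
    proof -
      have "v \<in> cube J c - G" "v \<notin> dead J c G" using terminalsD(1,2)[OF *(7)] that by blast+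
      then show ?thesis unfolding dead_def by simp
    qed
    have k: "card S + 2 \<le> card J" "card G + 2 * card S + 3 \<le> 2 * card J" using *(5,6,9) by linarith+
    show "linkable J c G S T" by (rule less.hyps[OF *(3,1,2,4) tr al *(8) k])
  qed
  show ?case
  proof (cases "card S + card F + 1 \<le> card I")
    case True
    then show ?thesis using linkable_few_faults[OF prems(1-4,6)] by blast
  next
    case False
    then have big: "card I \<le> card S + card F" by simp
    show ?thesis
    proof (cases "5 \<le> card I")
      case True
      show ?thesis
      proof (rule ccontr)
        assume "\<not> linkable I z F S T"
        then interpret conditional I z F S T p
        proof (unfold_locales)
          show "finite I" "finite z" "F \<subseteq> cube I z" "terminals p (cube I z - F) S T" "5 \<le> card I" "1 \<le> card S"
            "card F + 2 * card S + 3 \<le> 2 * card I" "card I \<le> card S + card F" "solved_below TYPE('a) (card I)"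
            by (fact prems(1-4,6,8) True big sb)+
          show "faulty_degree I F v + 2 \<le> card I" if "v \<in> S \<union> T" for v by (rule prems(5)[OF that])
        qed
        show False by (rule contradiction)
      qed
    next
      case n: False
      \<comment> \<open>From \<open>n \<le> k + f \<le> 2n - k - 3\<close> follows
        \<open>n \<ge> k + 3\<close>, so dimension four is the only one left.\<close>
      then have n: "card I = 4" "card S = 1" "card F = 3" using big prems(6-8) by linarith+
      obtain s where s: "S = {s}" using n(2) by (rule card_1_singletonE)
      obtain t where t: "T = {t}" using n(2)[unfolded ST(5)] by (rule card_1_singletonE)
      have st: "s \<in> cube I z - F" "t \<in> cube I z - F" using ST(1,2) s t by auto
      have ev: "ev s \<noteq> ev t" using ST(3)[of s] ST(4)[of t] s t by simp
      have "faulty_degree I F s \<le> 2" "faulty_degree I F t \<le> 2" using prems(5)[of s] prems(5)[of t] s t n(1) by auto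
      from ex_path_dim_4[OF prems(1) n(1) prems(3) n(3) st ev this]
      obtain C where "C \<subseteq> cube I z - F" "path_on s t C" "10 \<le> card C" by blast
      then show ?thesis unfolding linkable_def s t using n by (intro exI[of _ C]) (simp add: linkage_single)
    qed
  qed
qed

subsection \<open>Transfer to the hypercube\<close>

lemma path_on_list:
  "path_on a b C \<Longrightarrow> \<exists>p. p \<noteq> [] \<and> distinct p \<and> successively adj p \<and> hd p = a \<and> last p = b \<and> set p = C"
proof (induction rule: path_on.induct)
  case (single a)
  show ?case by (intro exI[of _ "[a]"]) simp
next
  case (step a b C c)
  then obtain p where p: "p \<noteq> []" "distinct p" "successively adj p" "hd p = a" "last p = b" "set p = C" by blast
  then have "successively adj (c # p)" using step.hyps(2) by (simp add: successively_Cons)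
  then show ?case using p step.hyps(3) by (intro exI[of _ "c # p"]) simp
qed

lemma linkage_lists:
  "linkage S T C \<Longrightarrow> \<exists>P. finite P \<and> card P = card S \<and>
     (\<forall>p\<in>P. p \<noteq> [] \<and> distinct p \<and> successively adj p) \<and>
     (\<forall>p\<in>P. \<forall>q\<in>P. p \<noteq> q \<longrightarrow> set p \<inter> set q = {}) \<and>
     (\<Union>p\<in>P. set p) = C \<and> hd ` P = S \<and> last ` P = T"
proof (induction rule: linkage.induct)
  case empty
  show ?case by (intro exI[of _ "{}"]) simp
next
  case (add s t A S T C)
  then obtain P where P: "finite P" "card P = card S" "\<forall>p\<in>P. p \<noteq> [] \<and> distinct p \<and> successively adj p"
    "\<forall>p\<in>P. \<forall>q\<in>P. p \<noteq> q \<longrightarrow> set p \<inter> set q = {}" "(\<Union>p\<in>P. set p) = C" "hd ` P = S" "last ` P = T"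
    by blast
  obtain p where p: "p \<noteq> []" "distinct p" "successively adj p" "hd p = s" "last p = t" "set p = A"
    using path_on_list[OF add.hyps(1)] by blast
  have s: "s \<in> A" "s \<notin> S" "finite S"
    using path_on_ends[OF add.hyps(1)] linkage_subset[OF add.hyps(2)] add.hyps(3) by (auto intro: finite_subset)
  have disj: "set q \<inter> A = {}" if "q \<in> P" for q using that P(5) add.hyps(3) by blast
  have pP: "p \<notin> P" using disj[of p] p(6) s(1) by blast
  have "card (insert p P) = card (insert s S)" using P(1,2) pP s by simp
  moreover have "\<forall>q\<in>insert p P. \<forall>q'\<in>insert p P. q \<noteq> q' \<longrightarrow> set q \<inter> set q' = {}"
    using P(4) p(6) disj by blast
  ultimately show ?case
    using P p by (intro exI[of _ "insert p P"]) simp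
qed

section \<open>Binary strings as sets of positions\<close>

definition enc :: "bool list \<Rightarrow> nat set" where
  "enc v = {i. i < length v \<and> v ! i}"

definition bits :: "nat \<Rightarrow> nat set \<Rightarrow> bool list" where
  "bits n A = map (\<lambda>i. i \<in> A) [0..<n]"

lemma length_bits [simp]: "length (bits n A) = n"
  by (simp add: bits_def)

lemma bits_enc: "length v = n \<Longrightarrow> bits n (enc v) = v"
  by (rule nth_equalityI) (auto simp: bits_def enc_def)

lemma enc_bits:
  assumes "A \<in> cube {..<n} {}"
  shows "enc (bits n A) = A"
proof -
  have "i < n" if "i \<in> A" for i using assms that by (auto simp: cube_def)
  then show ?thesis by (auto simp: bits_def enc_def)
qed

lemma enc_cube: "length v = n \<Longrightarrow> enc v \<in> cube {..<n} {}"
  by (auto simp: enc_def cube_def)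

lemma enc_inj: "length u = n \<Longrightarrow> length v = n \<Longrightarrow> enc u = enc v \<longleftrightarrow> u = v"
  by (metis bits_enc)

lemma count_list_enc: "count_list v True = card (enc v)"
proof -
  have "enc v = {i. i < length v \<and> v ! i = True}" unfolding enc_def by simp
  then show ?thesis
    by (simp add: count_list_eq_length_filter length_filter_conv_card)
qed

lemma verts_hypercube: "verts (hypercube n) = {v. length v = n}"
  by (simp add: hypercube_def)

lemma adj_enc:
  assumes "length u = n" "length v = n"
  shows "u \<rightarrow>\<^bsub>hypercube n\<^esub> v \<longleftrightarrow> adj (enc u) (enc v)"
proof -
  have sd: "{i. i < n \<and> u ! i \<noteq> v ! i} = sdiff (enc u) (enc v)"
    using assms by (auto simp: enc_def sdiff_def)
  have "adj (enc u) (enc v) \<longleftrightarrow> card (sdiff (enc u) (enc v)) = 1"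
  proof
    assume "adj (enc u) (enc v)"
    then obtain i where "enc v = flip i (enc u)" unfolding adj_def by blast
    then have "sdiff (enc u) (enc v) = {i}" unfolding sdiff_def by (auto simp: mem_flip)
    then show "card (sdiff (enc u) (enc v)) = 1" by simp
  next
    assume "card (sdiff (enc u) (enc v)) = 1"
    then obtain i where "sdiff (enc u) (enc v) = {i}" by (rule card_1_singletonE)
    then have "enc v = flip i (enc u)" by (rule sdiff_singleton)
    then show "adj (enc u) (enc v)" by simp
  qed
  then show ?thesis using assms sd by (simp add: hypercube_dominates_iff)
qed

lemma set_vwalk_arcs: "(\<forall>x\<in>set (vwalk_arcs p). x \<in> E) \<longleftrightarrow> successively (\<lambda>u v. (u, v) \<in> E) p"
  by (induction p rule: vwalk_arcs.induct) auto

text \<open>The \<open>n\<close> coordinates split into those leading to faults and those leading to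
  fault-free neighbours, and there are at least two of the latter.\<close>

lemma fault_degree_hypercube:
  assumes "F \<subseteq> verts (hypercube n)" "length u = n" "2 \<le> card (fault_free_neighbors (hypercube n) F u)"
  shows "faulty_degree {..<n} (enc ` F) (enc u) + 2 \<le> n"
proof -
  let ?A = "{i \<in> {..<n}. flip i (enc u) \<in> enc ` F}" and ?B = "{i \<in> {..<n}. flip i (enc u) \<notin> enc ` F}"
  let ?N = "fault_free_neighbors (hypercube n) F u"
  have "enc ` ?N \<subseteq> (\<lambda>i. flip i (enc u)) ` ?B"
  proof
    fix w assume "w \<in> enc ` ?N"
    then obtain v where v: "v \<in> ?N" "w = enc v" by blast
    then have v': "length v = n" "v \<notin> F" "u \<rightarrow>\<^bsub>hypercube n\<^esub> v"
      unfolding fault_free_neighbors_def verts_hypercube by auto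
    then have "adj (enc u) (enc v)" using adj_enc assms(2) by blast
    then obtain i where i: "i \<in> {..<n}" "enc v = flip i (enc u)"
      using adj_cube_imp_flip[OF enc_cube[OF assms(2)] enc_cube[OF v'(1)]] by blast
    have "enc v \<notin> enc ` F"
    proof
      assume "enc v \<in> enc ` F"
      then obtain x where x: "x \<in> F" "enc v = enc x" by blast
      then have "length x = n" using assms(1) verts_hypercube by blast
      then show False using x enc_inj v'(1,2) by blast
    qed
    then show "w \<in> (\<lambda>i. flip i (enc u)) ` ?B" using i v(2) by auto
  qed
  then have "card (enc ` ?N) \<le> card ((\<lambda>i. flip i (enc u)) ` ?B)" by (rule card_mono[rotated]) simp
  also have "\<dots> \<le> card ?B" by (rule card_image_le) simp
  finally have "card (enc ` ?N) \<le> card ?B" .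
  moreover have "card (enc ` ?N) = card ?N"
  proof (rule card_image, rule inj_onI)
    fix x y assume "x \<in> ?N" "y \<in> ?N" "enc x = enc y"
    then show "x = y" unfolding fault_free_neighbors_def verts_hypercube by (auto simp: enc_inj)
  qed
  moreover have "card {..<n} = card ?A + card ?B"
  proof -
    have "?A \<union> ?B = {..<n}" by blast
    moreover have "card (?A \<union> ?B) = card ?A + card ?B" by (rule card_Un_disjoint) auto
    ultimately show ?thesis by simp
  qed
  ultimately show ?thesis unfolding faulty_degree_def using assms(3) by simp
qed

theorem mainTheorem1:
  fixes n k :: nat and F S T :: "bool list set"
  assumes "n \<ge> 3"
    and "F \<subseteq> verts (hypercube n)"
    and "1 \<le> k" and "k \<le> n - 2"
    and "card F \<le> 2 * n - 2 * k - 3"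
    and "\<And>u. u \<in> verts (hypercube n) - F \<Longrightarrow>
           card (fault_free_neighbors (hypercube n) F u) \<ge> 2"
    and "S \<subseteq> verts (hypercube n) - F" and "card S = k"
    and "T \<subseteq> verts (hypercube n) - F" and "card T = k"
    and "S \<subseteq> even_part n \<and> T \<subseteq> odd_part n \<or> S \<subseteq> odd_part n \<and> T \<subseteq> even_part n"
  shows "\<exists>P. card P = k \<and> linking_paths (hypercube n) F S T P \<and>
             card (\<Union>p\<in>P. set p) \<ge> 2 ^ n - 2 * card F"
proof -
  let ?V = "{v :: bool list. length v = n}" and ?Q = "cube {..<n} ({} :: nat set)"
  have len: "length v = n" if "v \<in> F \<union> S \<union> T" for v
    using that assms(2,7,9) unfolding verts_hypercube by blast
  have inj: "inj_on enc ?V" by (rule inj_onI) (simp add: enc_inj)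
  have card_enc: "card (enc ` X) = card X" if "X \<subseteq> ?V" for X
    using inj that by (meson card_image inj_on_subset)
  have sub: "F \<subseteq> ?V" "S \<subseteq> ?V" "T \<subseteq> ?V" using len by blast+
  have notF: "enc v \<notin> enc ` F" if "v \<in> S \<union> T" for v
  proof
    assume "enc v \<in> enc ` F"
    then obtain x where "x \<in> F" "enc v = enc x" by blast
    then have "v \<in> F" using enc_inj[of v n x] len that by blast
    then show False using that assms(7,9) by blast
  qed
  have par: "\<exists>p. (\<forall>v\<in>S. ev (enc v) = p) \<and> (\<forall>v\<in>T. ev (enc v) = (\<not> p))"
    using assms(11)
  proof
    assume "S \<subseteq> even_part n \<and> T \<subseteq> odd_part n"
    then show ?thesis
      unfolding even_part_def odd_part_def count_list_enc by (intro exI[of _ True]) auto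
  next
    assume "S \<subseteq> odd_part n \<and> T \<subseteq> even_part n"
    then show ?thesis
      unfolding even_part_def odd_part_def count_list_enc by (intro exI[of _ False]) auto
  qed
  then obtain p where p: "\<forall>v\<in>S. ev (enc v) = p" "\<forall>v\<in>T. ev (enc v) = (\<not> p)" by blast
  have cubeS: "enc ` S \<subseteq> ?Q - enc ` F" "enc ` T \<subseteq> ?Q - enc ` F"
    using notF enc_cube len by blast+
  have tr: "terminals p (?Q - enc ` F) (enc ` S) (enc ` T)"
    unfolding terminals_def using cubeS p card_enc[OF sub(2)] card_enc[OF sub(3)] assms(8,10) by auto
  have alive: "faulty_degree {..<n} (enc ` F) v + 2 \<le> card {..<n}" if v: "v \<in> enc ` S \<union> enc ` T" for v
  proof -
    obtain u where u: "u \<in> S \<union> T" "v = enc u" using v by blast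
    have "u \<in> verts (hypercube n) - F" using u(1) assms(7,9) by blast
    then show ?thesis
      using fault_degree_hypercube[OF assms(2) _ assms(6)] u len by simp
  qed
  have FQ: "enc ` F \<subseteq> ?Q" using enc_cube len by blast
  \<comment> \<open>As \<open>k \<le> n - 2\<close>, the natural subtraction
    \<open>2 * n - 2 * k - 3\<close> does not truncate, and the bound takes its additive
    form.\<close>
  have "linkable {..<n} {} (enc ` F) (enc ` S) (enc ` T)"
    by (rule linkable_conditional[OF _ _ FQ tr alive])
      (use assms(1,3,4,5,8) card_enc[OF sub(1)] card_enc[OF sub(2)] in auto)
  then obtain C where C: "C \<subseteq> ?Q - enc ` F" "linkage (enc ` S) (enc ` T) C" "2 ^ n \<le> card C + 2 * card F"
    unfolding linkable_def using card_enc[OF sub(1)] by auto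
  obtain P where P: "finite P" "card P = card (enc ` S)"
    "\<forall>p\<in>P. p \<noteq> [] \<and> distinct p \<and> successively adj p"
    "\<forall>p\<in>P. \<forall>q\<in>P. p \<noteq> q \<longrightarrow> set p \<inter> set q = {}" "(\<Union>p\<in>P. set p) = C" "hd ` P = enc ` S" "last ` P = enc ` T"
    using linkage_lists[OF C(2)] by (elim exE conjE) (rule that)
  have setp: "set p \<subseteq> ?Q - enc ` F" if "p \<in> P" for p using that P(5) C(1) by blast
  have injb: "inj_on (bits n) ?Q" by (rule inj_onI) (metis enc_bits)
  define R where "R = map (bits n) ` P"
  have enc_map: "map enc (map (bits n) p) = p" if "p \<in> P" for p
  proof -
    have "enc (bits n a) = a" if "a \<in> set p" for a
      using setp[OF \<open>p \<in> P\<close>] that enc_bits by blast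
    then have "map (enc \<circ> bits n) p = p" by (intro map_idI) simp
    then show ?thesis by simp
  qed
  have injm: "inj_on (map (bits n)) P" by (rule inj_onI) (metis enc_map)
  have "card R = k"
    unfolding R_def card_image[OF injm] P(2) card_enc[OF sub(2)] by (rule assms(8))
  have path: "fault_free_path (hypercube n) F (map (bits n) p)" if "p \<in> P" for p
  proof -
    have pQ: "set p \<subseteq> ?Q" "set p \<inter> enc ` F = {}" using setp[OF that] by blast+
    have "distinct (map (bits n) p)"
      using P(3) that inj_on_subset[OF injb pQ(1)] by (simp add: distinct_map)
    moreover have "successively (\<lambda>u v. (u, v) \<in> arcs_ends (hypercube n)) (map (bits n) p)"
    proof -
      have "successively (\<lambda>a b. bits n a \<rightarrow>\<^bsub>hypercube n\<^esub> bits n b) p"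
      proof (rule successively_mono[of adj])
        show "successively adj p" using P(3) that by blast
        show "bits n a \<rightarrow>\<^bsub>hypercube n\<^esub> bits n b" if "a \<in> set p" "b \<in> set p" "adj a b" for a b
        proof -
          have "enc (bits n a) = a" "enc (bits n b) = b" using that(1,2) pQ(1) enc_bits by blast+
          then show ?thesis using adj_enc[of "bits n a" n "bits n b"] that(3) by simp
        qed
      qed
      then show ?thesis by (simp add: successively_map)
    qed
    moreover have "set (map (bits n) p) \<inter> F = {}"
    proof (rule ccontr)
      assume "set (map (bits n) p) \<inter> F \<noteq> {}"
      then obtain a where a: "a \<in> set p" "bits n a \<in> F" by auto
      then have "enc (bits n a) = a" using pQ(1) enc_bits by blast
      then have "a \<in> enc ` F" using a(2) by (metis image_eqI)
      then show False using pQ(2) a(1) by blast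
    qed
    moreover have "map (bits n) p \<noteq> []" using P(3) that by simp
    ultimately show ?thesis
      unfolding fault_free_path_def vpath_def vwalk_def verts_hypercube
      using set_vwalk_arcs[of "map (bits n) p" "arcs_ends (hypercube n)"] by auto
  qed
  have ends: "hd (map (bits n) p) = bits n (hd p)" "last (map (bits n) p) = bits n (last p)" if "p \<in> P" for p
    using P(3) that by (simp_all add: hd_map last_map)
  have hdS: "bits n (hd p) \<in> S" if "p \<in> P" for p
  proof -
    have "hd p \<in> enc ` S" using that P(6) by blast
    then obtain v where "v \<in> S" "hd p = enc v" by blast
    then show ?thesis using bits_enc[of v n] len[of v] by simp
  qed
  have lastT: "bits n (last p) \<in> T" if "p \<in> P" for p
  proof -
    have "last p \<in> enc ` T" using that P(7) by blast
    then obtain v where "v \<in> T" "last p = enc v" by blast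
    then show ?thesis using bits_enc[of v n] len[of v] by simp
  qed
  have disj: "set q \<inter> set r = {}" if qr: "q \<in> R" "r \<in> R" "q \<noteq> r" for q r
  proof -
    obtain a b where ab: "a \<in> P" "b \<in> P" "q = map (bits n) a" "r = map (bits n) b"
      using qr unfolding R_def by blast
    have "a \<noteq> b" using qr(3) ab(3,4) by auto
    then have dj: "set a \<inter> set b = {}" using P(4) ab(1,2) by simp
    have "bits n x \<noteq> bits n y" if xy: "x \<in> set a" "y \<in> set b" for x y
    proof
      assume eq: "bits n x = bits n y"
      have "x \<in> ?Q" "y \<in> ?Q" using setp[OF ab(1)] setp[OF ab(2)] xy by blast+
      then have "x = y" using inj_onD[OF injb eq] by blast
      then show False using dj xy by blast
    qed
    then show ?thesis using ab(3,4) by auto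
  qed
  have "linking_paths (hypercube n) F S T R"
    unfolding linking_paths_def
  proof (intro conjI ballI impI)
    fix q assume "q \<in> R"
    then obtain a where a: "a \<in> P" "q = map (bits n) a" unfolding R_def by blast
    show "fault_free_path (hypercube n) F q" "hd q \<in> S" "last q \<in> T"
      using path[OF a(1)] hdS[OF a(1)] lastT[OF a(1)] ends[OF a(1)] a(2) by simp_all
  next
    fix q r assume "q \<in> R" "r \<in> R" "q \<noteq> r"
    then show "set q \<inter> set r = {}" by (rule disj)
  next
    fix v assume v: "v \<in> S \<union> T"
    have "\<exists>a\<in>P. hd a = enc v \<or> last a = enc v"
    proof (cases "v \<in> S")
      case True
      then have "enc v \<in> hd ` P" using P(6) by blast
      then show ?thesis by (metis imageE)
    next
      case False
      then have "enc v \<in> last ` P" using P(7) v by blast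
      then show ?thesis by (metis imageE)
    qed
    then obtain a where a: "a \<in> P" "hd a = enc v \<or> last a = enc v" by blast
    have "bits n (enc v) = v" using bits_enc[of v n] len[of v] v by blast
    then have "v = hd (map (bits n) a) \<or> v = last (map (bits n) a)" using a(2) ends[OF a(1)] by auto
    moreover have "map (bits n) a \<in> R" using a(1) unfolding R_def by blast
    moreover have "q = map (bits n) a" if q: "q \<in> R" "v = hd q \<or> v = last q" for q
    proof (rule ccontr)
      assume ne: "q \<noteq> map (bits n) a"
      have "r \<noteq> []" if "r \<in> R" for r using that P(3) unfolding R_def by auto
      then have "v \<in> set q" "v \<in> set (map (bits n) a)"
        using q calculation hd_in_set last_in_set by metis+
      then show False using disj[OF q(1) calculation(2) ne] by blast
    qed
    ultimately show "\<exists>!q. q \<in> R \<and> (v = hd q \<or> v = last q)" by blast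
  qed
  moreover have "(\<Union>q\<in>R. set q) = bits n ` C" unfolding R_def P(5)[symmetric] by auto
  moreover have "card (bits n ` C) = card C"
    by (rule card_image, rule inj_on_subset[OF injb]) (use C(1) in blast)
  ultimately show ?thesis using C(3) \<open>card R = k\<close> by (intro exI[of _ R]) simp
qed

end
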